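(* Let $K$ be a simplicial complex of vertex degree at most $D$ and let $\Gamma$ be a group acting simplicially, properly and cocompactly on $K$. Let $G\le\Gamma$ be a finite subgroup and let $H=\{g\in G\mid g \text{ has a finite conjugacy class in }\Gamma\}\le G$. Let $(N_n)_{n\in\mathbb{N}}$ be a descending chain of finite index normal subgroups of $\Gamma$ with $\bigcap_{n\in\mathbb{N}}N_n=\{1\}$. Then the sequence of simplicial $G$-complexes $(K/N_n)_n$ converges to the random rooted simplicial $G$-complex $\mu_K^G:=\mathrm{ind}_H^G(\mu_K^H)$; that is, the measures $\mu^G_{K/N_n}$ converge weakly to $\mathrm{ind}_H^G(\mu_K^H)$ on $\mathcal{SC}_*^D(G)$, where \[\mu_K^H=\frac{1}{w(\Gamma_0)}\sum_{x\in\mathcal{F}_0}|\mathrm{St}_{\Gamma_0}(x)|^{-1}\delta_{[K,Hx]}\] is the measure on $\mathcal{SC}_*^D(H)$ defined using any finite index subgroup $\Gamma_0\le\Gamma$ with $\Gamma_0\subseteq\bigcap_{h\in H}C_\Gamma(h)$ and any fundamental domain $\mathcal{F}_0\subseteq K^{(0)}$ for the action of $\Gamma_0$ on $K^{(0)}$.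
   Context: **Group actions.** The action of $\Gamma$ is simplicial if it is by simplicial automorphisms and an element $\gamma\in\Gamma$ stabilizes a simplex if and only if it stabilizes all of its vertices; proper if every vertex has finite stabilizer; cocompact if there are only finitely many orbits of vertices. $C_\Gamma(h)$ is the centralizer of $h$, $\mathrm{St}_{\Gamma_0}(x)$ is the stabilizer of $x$ in $\Gamma_0$, a fundamental domain is a set containing exactly one element of each orbit, and $w(\Gamma_0)=\sum_{x\in\mathcal{F}_0}|\mathrm{St}_{\Gamma_0}(x)|^{-1}$. The measure $\mu_K^H$ is a random rooted simplicial $H$-complex and does not depend on the choice of $\Gamma_0$ and $\mathcal{F}_0$. For $N\trianglelefteq\Gamma$, the quotient complex $K/N$ has vertex set $K^{(0)}/N$ and as simplices the images of simplices of $K$; it carries the $G$-action $g\cdot Nx=Ngx$. **Rooted $G$-complexes.** In what follows $G$ is an arbitrary finite group (the definitions are also applied to $H$) and $D>0$ a fixed constant. Simplicial complexes are nonempty; $K^{(0)}$ is the vertex set of $K$; the degree of a vertex is the number of $1$-simplices containing it, and the vertex degree of $K$ is the supremum of the degrees. A simplicial $G$-complex is a simplicial complex with an action of $G$ by simplicial automorphisms. For $\emptyset\neq V\subseteq K^{(0)}$ and $r>0$, $B_r(K,V)$ is the full subcomplex of $K$ on all vertices of path distance at most $r$ from some vertex of $V$. A rooted simplicial $G$-complex is a pair $(K,o)$ of a simplicial $G$-complex $K$ and a $G$-orbit $o\subseteq K^{(0)}$ meeting every connected component of $K$. An isomorphism $(K,o)\cong_G(L,o')$ is a $G$-equivariant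 simplicial isomorphism $K\to L$ mapping $o$ onto $o'$. $\mathcal{SC}_*^D(G)$ is the set of isomorphism classes $[K,o]$ with vertex degree at most $D$, with the (possibly infinite-valued) metric $d([K,o],[L,o'])=\inf\{2^{-r} : (B_r(K,o),o)\cong_G (B_r(L,o'),o')\}$. Similarly, $\mathcal{SC}_{**}^D(G)$ is the space of isomorphism classes $[K,o,o']$ of simplicial $G$-complexes of vertex degree at most $D$ with two vertex orbits each meeting every connected component (isomorphisms preserve both orbits; the topology is defined in the same way using balls $B_r(K,o\cup o')$). A random rooted simplicial $G$-complex is a Borel probability measure $\mu$ on $\mathcal{SC}_*^D(G)$ that is unimodular: for all Borel $f\colon\mathcal{SC}_{**}^D(G)\to\mathbb{R}_{\ge0}$, \[\int\sum_{x\in K^{(0)}}f([K,o,Gx])\,d\mu([K,o])=\int\sum_{x\in K^{(0)}}f([K,Gx,o])\,d\mu([K,o]).\] Whenever $x$ is a vertex of a simplicial $G$-complex $L$, $[L,Gx]$ denotes the class of the union of those connected components of $L$ that meet $Gx$, rooted at $Gx$ (and likewise for $H$). For a finite simplicial $G$-complex $L$ of vertex degree at most $D$, $\mu_L^G=\frac{1}{|L^{(0)}|}\sum_{x\in L^{(0)}}\delta_{[L,Gx]}$. **Induction.** For a subgroup $H\le G$ and an $H$-set $Y$, $G\times_H Y$ is the quotient of $G\times Y$ by $(g,y)\sim(gh,h^{-1}y)$, $h\in H$; the class of $(g,y)$ is $\lfloor g,y\rfloor$ and $g_2\lfloor g_1,y\rfloor=\lfloor g_2g_1,y\rfloor$.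 For a simplicial $H$-complex $L$, $G\times_HL$ is the simplicial $G$-complex with vertex set $G\times_HL^{(0)}$ and simplices $\{\lfloor g,x\rfloor: x\in\sigma\}$ for $g\in G$ and $\sigma$ a simplex of $L$. The map $\mathrm{ind}_H^G\colon\mathcal{SC}_*^D(H)\to\mathcal{SC}_*^D(G)$, $[L,o]\mapsto[G\times_HL,G\lfloor1,o\rfloor]$ is continuous, and for a random rooted simplicial $H$-complex $\mu$, $\mathrm{ind}_H^G(\mu)$ denotes the push-forward measure. *)

theory Defs
  imports "HOL-Probability.Probability" "HOL-Algebra.Group_Action"
begin

section \<open>Simplicial complexes\<close>

text \<open>A complex is given by its set of (nonempty) simplices.\<close>

definition simplicial_complex :: "'v set set \<Rightarrow> bool" where
  "simplicial_complex K \<longleftrightarrow> K \<noteq> {} \<and> (\<forall>\<sigma>\<in>K. finite \<sigma> \<and> \<sigma> \<noteq> {}) \<and>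
     (\<forall>\<sigma>\<in>K. \<forall>\<tau>. \<tau> \<noteq> {} \<and> \<tau> \<subseteq> \<sigma> \<longrightarrow> \<tau> \<in> K)"

definition verts :: "'v set set \<Rightarrow> 'v set" where
  "verts K = \<Union> K"

definition vertex_degree :: "'v set set \<Rightarrow> ennreal" where
  "vertex_degree K =
     (SUP v\<in>verts K. emeasure (count_space UNIV) {\<sigma> \<in> K. v \<in> \<sigma> \<and> card \<sigma> = 2})"

definition adj :: "'v set set \<Rightarrow> ('v \<times> 'v) set" where
  "adj K = {(x, y). x \<noteq> y \<and> {x, y} \<in> K}"

definition full_subcomplex :: "'v set set \<Rightarrow> 'v set \<Rightarrow> 'v set set" where
  "full_subcomplex K V = {\<sigma> \<in> K. \<sigma> \<subseteq> V}"

definition ball_complex :: "real \<Rightarrow> 'v set set \<Rightarrow> 'v set \<Rightarrow> 'v set set" where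
  "ball_complex r K V =
     full_subcomplex K {x. \<exists>v\<in>V. \<exists>n::nat. real n \<le> r \<and> (v, x) \<in> adj K ^^ n}"

text \<open>The union of the connected components of the complex that meet \<open>V\<close>.\<close>

definition components_meeting :: "'v set set \<Rightarrow> 'v set \<Rightarrow> 'v set set" where
  "components_meeting K V = full_subcomplex K {x. \<exists>v\<in>V. (v, x) \<in> (adj K)\<^sup>*}"


section \<open>Complexes with group action\<close>

definition g_complex ::
    "('g, 'b) monoid_scheme \<Rightarrow> 'v set set \<Rightarrow> ('g \<Rightarrow> 'v \<Rightarrow> 'v) \<Rightarrow> bool" where
  "g_complex G K \<phi> \<longleftrightarrow> simplicial_complex K \<and> group_action G (verts K) \<phi> \<and>
     (\<forall>g\<in>carrier G. (`) (\<phi> g) ` K = K)"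

text \<open>The action of the ambient group in the theorem satisfies a further condition, which is not
  imposed on simplicial \<open>G\<close>-complexes (and which may fail for quotient complexes).\<close>

definition acts_simplicially ::
    "('g, 'b) monoid_scheme \<Rightarrow> 'v set set \<Rightarrow> ('g \<Rightarrow> 'v \<Rightarrow> 'v) \<Rightarrow> bool" where
  "acts_simplicially G K \<phi> \<longleftrightarrow> g_complex G K \<phi> \<and>
     (\<forall>g\<in>carrier G. \<forall>\<sigma>\<in>K. \<phi> g ` \<sigma> = \<sigma> \<longleftrightarrow> (\<forall>v\<in>\<sigma>. \<phi> g v = v))"

definition acts_properly ::
    "('g, 'b) monoid_scheme \<Rightarrow> 'v set set \<Rightarrow> ('g \<Rightarrow> 'v \<Rightarrow> 'v) \<Rightarrow> bool" where
  "acts_properly G K \<phi> \<longleftrightarrow> (\<forall>v\<in>verts K. finite (stabilizer G \<phi> v))"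

definition acts_cocompactly ::
    "('g, 'b) monoid_scheme \<Rightarrow> 'v set set \<Rightarrow> ('g \<Rightarrow> 'v \<Rightarrow> 'v) \<Rightarrow> bool" where
  "acts_cocompactly G K \<phi> \<longleftrightarrow> finite (orbits G (verts K) \<phi>)"

definition fundamental_domain ::
    "('g, 'b) monoid_scheme \<Rightarrow> 'v set \<Rightarrow> ('g \<Rightarrow> 'v \<Rightarrow> 'v) \<Rightarrow> 'v set \<Rightarrow> bool" where
  "fundamental_domain G E \<phi> F \<longleftrightarrow> F \<subseteq> E \<and> (\<forall>R\<in>orbits G E \<phi>. \<exists>!x. x \<in> F \<and> x \<in> R)"

definition centralizer :: "('g, 'b) monoid_scheme \<Rightarrow> 'g \<Rightarrow> 'g set" where
  "centralizer G h = {g \<in> carrier G. g \<otimes>\<^bsub>G\<^esub> h = h \<otimes>\<^bsub>G\<^esub> g}"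

definition finite_index :: "'g set \<Rightarrow> ('g, 'b) monoid_scheme \<Rightarrow> bool" where
  "finite_index H G \<longleftrightarrow> finite (rcosets\<^bsub>G\<^esub> H)"


section \<open>Rooted complexes and their isomorphism classes\<close>

text \<open>Complexes carry a list of \<open>k\<close> root orbits: \<open>k = 1\<close> gives rooted complexes and
  \<open>k = 2\<close> complexes with two ordered roots.\<close>

definition rooted_complex ::
    "('g, 'b) monoid_scheme \<Rightarrow> real \<Rightarrow> nat \<Rightarrow>
     'v set set \<Rightarrow> ('g \<Rightarrow> 'v \<Rightarrow> 'v) \<Rightarrow> 'v set list \<Rightarrow> bool" where
  "rooted_complex G D k K \<phi> Rs \<longleftrightarrow>
     g_complex G K \<phi> \<and> vertex_degree K \<le> ennreal D \<and> length Rs = k \<and>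
     (\<forall>R\<in>set Rs. R \<in> orbits G (verts K) \<phi> \<and> (\<forall>x\<in>verts K. \<exists>y\<in>R. (x, y) \<in> (adj K)\<^sup>*))"

text \<open>Only the values of the actions on vertices matter here. Therefore an action on a complex
  is passed unchanged to invariant subcomplexes (balls, unions of components).\<close>

definition rooted_iso ::
    "('g, 'b) monoid_scheme \<Rightarrow>
     'v set set \<Rightarrow> ('g \<Rightarrow> 'v \<Rightarrow> 'v) \<Rightarrow> 'v set list \<Rightarrow>
     'w set set \<Rightarrow> ('g \<Rightarrow> 'w \<Rightarrow> 'w) \<Rightarrow> 'w set list \<Rightarrow> bool" where
  "rooted_iso G K \<phi> Rs L \<psi> Ss \<longleftrightarrow>
     (\<exists>f. bij_betw f (verts K) (verts L) \<and> (`) f ` K = L \<and>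
          (\<forall>g\<in>carrier G. \<forall>x\<in>verts K. f (\<phi> g x) = \<psi> g (f x)) \<and>
          map ((`) f) Rs = Ss)"

text \<open>If \<open>G\<close> is finite, then a rooted complex of bounded vertex degree has countably many
  vertices, hence is isomorphic to one with vertices in \<open>nat\<close>. The isomorphism class of a complex
  over an arbitrary vertex type is represented by the set of all such models of it.\<close>

type_synonym 'g model = "nat set set \<times> ('g \<Rightarrow> nat \<Rightarrow> nat) \<times> nat set list"

definition iso_class ::
    "('g, 'b) monoid_scheme \<Rightarrow>
     'v set set \<Rightarrow> ('g \<Rightarrow> 'v \<Rightarrow> 'v) \<Rightarrow> 'v set list \<Rightarrow> 'g model set" where
  "iso_class G K \<phi> Rs = {(L, \<psi>, Ss). g_complex G L \<psi> \<and> rooted_iso G K \<phi> Rs L \<psi> Ss}"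

definition representative :: "'g model set \<Rightarrow> 'g model" where
  "representative C = (SOME X. X \<in> C)"

definition SC :: "('g, 'b) monoid_scheme \<Rightarrow> real \<Rightarrow> nat \<Rightarrow> 'g model set set" where
  "SC G D k = {iso_class G K \<phi> Rs | (K :: nat set set) \<phi> Rs. rooted_complex G D k K \<phi> Rs}"

text \<open>The distance is infinite if there is no admissible radius.\<close>

definition SC_dist ::
    "('g, 'b) monoid_scheme \<Rightarrow> 'g model set \<Rightarrow> 'g model set \<Rightarrow> ennreal" where
  "SC_dist G C C' = Inf {ennreal (2 powr (- r)) | r::real. r > 0 \<and>
     (\<exists>(K, \<phi>, Rs)\<in>C. \<exists>(L, \<psi>, Ss)\<in>C'.
        rooted_iso G (ball_complex r K (\<Union>(set Rs))) \<phi> Rs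
                     (ball_complex r L (\<Union>(set Ss))) \<psi> Ss)}"

definition emetric_topology :: "'a set \<Rightarrow> ('a \<Rightarrow> 'a \<Rightarrow> ennreal) \<Rightarrow> 'a topology" where
  "emetric_topology S d =
     topology (\<lambda>U. U \<subseteq> S \<and> (\<forall>x\<in>U. \<exists>e>0. \<forall>y\<in>S. d x y < e \<longrightarrow> y \<in> U))"

lemma openin_emetric_topology:
  "openin (emetric_topology S d) U \<longleftrightarrow>
     U \<subseteq> S \<and> (\<forall>x\<in>U. \<exists>e>0. \<forall>y\<in>S. d x y < e \<longrightarrow> y \<in> U)"
proof -
  have "istopology (\<lambda>U. U \<subseteq> S \<and> (\<forall>x\<in>U. \<exists>e>0. \<forall>y\<in>S. d x y < e \<longrightarrow> y \<in> U))"
    (is "istopology ?P")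
    unfolding istopology_def
  proof (intro conjI allI impI)
    fix U V assume U: "?P U" and V: "?P V"
    show "U \<inter> V \<subseteq> S" using U by blast
    show "\<forall>x\<in>U \<inter> V. \<exists>e>0. \<forall>y\<in>S. d x y < e \<longrightarrow> y \<in> U \<inter> V"
    proof
      fix x assume "x \<in> U \<inter> V"
      then obtain a b where "a > 0" "\<forall>y\<in>S. d x y < a \<longrightarrow> y \<in> U"
        "b > 0" "\<forall>y\<in>S. d x y < b \<longrightarrow> y \<in> V" using U V by blast
      then show "\<exists>e>0. \<forall>y\<in>S. d x y < e \<longrightarrow> y \<in> U \<inter> V"
        by (intro exI[of _ "min a b"]) auto
    qed
  next
    fix \<U> assume *: "\<forall>U\<in>\<U>. ?P U"
    then show "\<Union>\<U> \<subseteq> S" by blast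
    show "\<forall>x\<in>\<Union>\<U>. \<exists>e>0. \<forall>y\<in>S. d x y < e \<longrightarrow> y \<in> \<Union>\<U>"
      using * by (metis UnionE UnionI)
  qed
  then show ?thesis
    unfolding emetric_topology_def by (simp add: topology_inverse')
qed

definition SC_topology :: "('g, 'b) monoid_scheme \<Rightarrow> real \<Rightarrow> nat \<Rightarrow> 'g model set topology" where
  "SC_topology G D k = emetric_topology (SC G D k) (SC_dist G)"

definition borel_of_topology :: "'a topology \<Rightarrow> 'a measure" where
  "borel_of_topology T = sigma (topspace T) {U. openin T U}"

abbreviation SC_borel :: "('g, 'b) monoid_scheme \<Rightarrow> real \<Rightarrow> nat \<Rightarrow> 'g model set measure" where
  "SC_borel G D k \<equiv> borel_of_topology (SC_topology G D k)"


section \<open>Random rooted complexes\<close>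

text \<open>\<open>class_at G K \<phi> x\<close> is the class \<open>[K, Gx]\<close> of the components of \<open>K\<close> meeting \<open>Gx\<close>,
  rooted at \<open>Gx\<close>.\<close>

definition class_at ::
    "('g, 'b) monoid_scheme \<Rightarrow> 'v set set \<Rightarrow> ('g \<Rightarrow> 'v \<Rightarrow> 'v) \<Rightarrow> 'v \<Rightarrow> 'g model set" where
  "class_at G K \<phi> x =
     iso_class G (components_meeting K (orbit G \<phi> x)) \<phi> [orbit G \<phi> x]"

definition unimodular ::
    "('g, 'b) monoid_scheme \<Rightarrow> real \<Rightarrow> 'g model set measure \<Rightarrow> bool" where
  "unimodular G D \<mu> \<longleftrightarrow>
     (\<forall>f::'g model set \<Rightarrow> real.
        f \<in> borel_measurable (SC_borel G D 2) \<and> (\<forall>C\<in>SC G D 2. f C \<ge> 0) \<longrightarrow>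
        (\<integral>\<^sup>+ C. (case representative C of (K, \<phi>, Rs) \<Rightarrow>
            \<integral>\<^sup>+ x. ennreal (f (iso_class G K \<phi> (Rs @ [orbit G \<phi> x]))) \<partial>count_space (verts K)) \<partial>\<mu>) =
        (\<integral>\<^sup>+ C. (case representative C of (K, \<phi>, Rs) \<Rightarrow>
            \<integral>\<^sup>+ x. ennreal (f (iso_class G K \<phi> (orbit G \<phi> x # Rs))) \<partial>count_space (verts K)) \<partial>\<mu>))"

definition random_rooted_complex ::
    "('g, 'b) monoid_scheme \<Rightarrow> real \<Rightarrow> 'g model set measure \<Rightarrow> bool" where
  "random_rooted_complex G D \<mu> \<longleftrightarrow>
     prob_space \<mu> \<and> sets \<mu> = sets (SC_borel G D 1) \<and> unimodular G D \<mu>"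

text \<open>The uniform average of the Dirac measures at \<open>[L, Gx]\<close>.\<close>

definition finite_complex_measure ::
    "('g, 'b) monoid_scheme \<Rightarrow> real \<Rightarrow> 'v set set \<Rightarrow> ('g \<Rightarrow> 'v \<Rightarrow> 'v) \<Rightarrow> 'g model set measure" where
  "finite_complex_measure G D L \<psi> =
     distr (uniform_count_measure (verts L)) (SC_borel G D 1) (class_at G L \<psi>)"

definition orbit_weight ::
    "('g, 'b) monoid_scheme \<Rightarrow> ('g \<Rightarrow> 'v \<Rightarrow> 'v) \<Rightarrow> 'v set \<Rightarrow> real" where
  "orbit_weight \<Gamma>\<^sub>0 \<phi> F = (\<Sum>x\<in>F. 1 / real (card (stabilizer \<Gamma>\<^sub>0 \<phi> x)))"

text \<open>The sum of the Dirac measures at \<open>[K, Hx]\<close>, where \<open>x\<close> ranges over \<open>F\<close>, with weights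
  \<open>1 / (w |St x|)\<close>.\<close>

definition cocompact_complex_measure ::
    "('g, 'b) monoid_scheme \<Rightarrow> real \<Rightarrow> 'v set set \<Rightarrow> ('g \<Rightarrow> 'v \<Rightarrow> 'v) \<Rightarrow>
     ('g, 'c) monoid_scheme \<Rightarrow> 'v set \<Rightarrow> 'g model set measure" where
  "cocompact_complex_measure H D K \<phi> \<Gamma>\<^sub>0 F =
     distr (point_measure F
              (\<lambda>x. ennreal (1 / orbit_weight \<Gamma>\<^sub>0 \<phi> F * (1 / real (card (stabilizer \<Gamma>\<^sub>0 \<phi> x))))))
           (SC_borel H D 1) (class_at H K \<phi>)"

definition converges_weakly :: "'a topology \<Rightarrow> (nat \<Rightarrow> 'a measure) \<Rightarrow> 'a measure \<Rightarrow> bool" where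
  "converges_weakly T \<mu>s \<mu> \<longleftrightarrow>
     (\<forall>n. prob_space (\<mu>s n) \<and> sets (\<mu>s n) = sets (borel_of_topology T)) \<and>
     prob_space \<mu> \<and> sets \<mu> = sets (borel_of_topology T) \<and>
     (\<forall>f::'a \<Rightarrow> real. continuous_map T euclideanreal f \<and> bounded (f ` topspace T) \<longrightarrow>
        (\<lambda>n. \<integral>x. f x \<partial>(\<mu>s n)) \<longlonglongrightarrow> (\<integral>x. f x \<partial>\<mu>))"


section \<open>Quotients and induction\<close>

definition quotient_complex ::
    "('g, 'b) monoid_scheme \<Rightarrow> 'v set set \<Rightarrow> ('g \<Rightarrow> 'v \<Rightarrow> 'v) \<Rightarrow> 'g set \<Rightarrow> 'v set set set" where
  "quotient_complex \<Gamma> K \<phi> N = (`) (orbit (\<Gamma>\<lparr>carrier := N\<rparr>) \<phi>) ` K"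

text \<open>For normal \<open>N\<close>, the image \<open>g(Nx)\<close> of the set \<open>Nx\<close> under \<open>g\<close> is \<open>N(gx)\<close>.\<close>

definition quotient_action ::
    "('g, 'b) monoid_scheme \<Rightarrow> 'v set set \<Rightarrow> ('g \<Rightarrow> 'v \<Rightarrow> 'v) \<Rightarrow> 'g set \<Rightarrow> 'g \<Rightarrow> 'v set \<Rightarrow> 'v set" where
  "quotient_action \<Gamma> K \<phi> N g = (\<lambda>X\<in>verts (quotient_complex \<Gamma> K \<phi> N). \<phi> g ` X)"

text \<open>The class of \<open>(g, y)\<close> in \<open>G \<times>\<^sub>H Y\<close>.\<close>

definition ind_pt ::
    "('g, 'b) monoid_scheme \<Rightarrow> 'g set \<Rightarrow> ('g \<Rightarrow> 'y \<Rightarrow> 'y) \<Rightarrow> 'g \<Rightarrow> 'y \<Rightarrow> ('g \<times> 'y) set" where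
  "ind_pt G H \<phi> g y = {(g \<otimes>\<^bsub>G\<^esub> h, \<phi> (inv\<^bsub>G\<^esub> h) y) | h. h \<in> H}"

definition ind_complex ::
    "('g, 'b) monoid_scheme \<Rightarrow> 'g set \<Rightarrow> 'y set set \<Rightarrow> ('g \<Rightarrow> 'y \<Rightarrow> 'y) \<Rightarrow> ('g \<times> 'y) set set set" where
  "ind_complex G H L \<phi> = {ind_pt G H \<phi> g ` \<sigma> | g \<sigma>. g \<in> carrier G \<and> \<sigma> \<in> L}"

definition ind_action ::
    "('g, 'b) monoid_scheme \<Rightarrow> 'g set \<Rightarrow> 'y set set \<Rightarrow> ('g \<Rightarrow> 'y \<Rightarrow> 'y) \<Rightarrow>
     'g \<Rightarrow> ('g \<times> 'y) set \<Rightarrow> ('g \<times> 'y) set" where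
  "ind_action G H L \<phi> g =
     (\<lambda>X\<in>verts (ind_complex G H L \<phi>). (\<lambda>(g', y). (g \<otimes>\<^bsub>G\<^esub> g', y)) ` X)"

definition ind_class :: "('g, 'b) monoid_scheme \<Rightarrow> 'g set \<Rightarrow> 'g model set \<Rightarrow> 'g model set" where
  "ind_class G H C = (case representative C of (L, \<phi>, Rs) \<Rightarrow>
     iso_class G (ind_complex G H L \<phi>) (ind_action G H L \<phi>)
       (map (\<lambda>R. {ind_pt G H \<phi> g x | g x. g \<in> carrier G \<and> x \<in> R}) Rs))"

definition ind_measure ::
    "('g, 'b) monoid_scheme \<Rightarrow> 'g set \<Rightarrow> real \<Rightarrow> 'g model set measure \<Rightarrow> 'g model set measure" where
  "ind_measure G H D \<mu> = distr \<mu> (SC_borel G D 1) (ind_class G H)"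

end

theory Submission
  imports Defs "HOL-Library.Diagonal_Subsequence"
begin

text \<open>Call a vertex \<open>x\<close> of \<open>K\<close> separated if an element \<open>n g\<close> with \<open>n \<in> N\<close> and \<open>g \<in> G\<close> can move \<open>x\<close> by
  a distance of at most \<open>R = 2 r + 1\<close> only for \<open>n = 1\<close> and \<open>g \<in> H\<close>. Then \<open>(g, y) \<mapsto> N g y\<close> is an
  isomorphism from the \<open>r\<close>-ball of \<open>G \<times>\<^sub>H K\<close> around \<open>(1, x)\<close> to the \<open>r\<close>-ball of \<open>K / N\<close> around \<open>G N x\<close>.

  If \<open>t x\<close> is not separated, then some \<open>t\<inverse> g t\<close> with \<open>g \<in> G\<close> is congruent modulo \<open>N\<close> to one of the
  finitely many elements that move \<open>x\<close> by at most \<open>R\<close>. An element of \<open>H\<close> has only finitely many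
  conjugates, so here the congruence is an equality as soon as \<open>N\<close> avoids a finite set. For \<open>g \<notin> H\<close> the
  number of conjugates of \<open>g\<close> modulo \<open>N\<^sub>n\<close> tends to infinity, and each of them is attained equally
  often, so that the proportion of the vertices that are not separated tends to \<open>0\<close>. The averages over
  the vertices of \<open>K / N\<^sub>n\<close> and over \<open>F\<^sub>0\<close> are both averages over cosets in \<open>\<Gamma>\<close>, and they are compared
  over the cosets of \<open>N\<^sub>n \<inter> \<Gamma>\<^sub>0\<close>.

  Unimodularity of the limit is the mass transport principle for the action of \<open>\<Gamma>\<^sub>0\<close>. The integrals are
  finite sums because a class is determined by its finite balls, which makes single classes Borel
  sets.\<close>

section \<open>Complexes, balls and components\<close>

text \<open>The domain \<open>F\<^sub>0\<close> and the vertices of the quotients are indexed by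
  unrelated sets. Both averages are therefore referred to one finite set \<open>I\<close> of
  representatives of the \<Gamma>-orbits: each becomes an average over \<open>i\<close> in
  \<open>I\<close> of means of functions of \<open>t\<close>, evaluated at the vertex
  \<open>t i\<close>. The stabilizer weights are what makes this conversion exact. On the quotient
  side they have to be uniform, which holds as soon as the normal subgroup \<open>N n\<close> meets
  the finitely many stabilizers over \<open>I\<close> trivially. Since
  \<open>\<Gamma>\<^sub>0\<close> centralizes \<open>H\<close>, its translations are
  \<open>H\<close>-equivariant, so the limiting class depends only on the
  \<open>\<Gamma>\<^sub>0\<close>-orbit of a vertex. Hence only finitely many limiting classes
  occur, and a merely continuous test function has one modulus for all of them. In
  \<open>R = 2 r + 1\<close>, each end of a displacement contributes a radius \<open>r\<close>; the
  extra 1 is for an edge that might leave the ball although its image in the quotient does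
  not.\<close>

lemma verts_insert: "\<sigma> \<in> K \<Longrightarrow> x \<in> \<sigma> \<Longrightarrow> x \<in> verts K"
  by (auto simp: verts_def)

lemma simplicial_complexD:
  assumes "simplicial_complex K" "\<sigma> \<in> K"
  shows "finite \<sigma>" "\<sigma> \<noteq> {}" "\<sigma> \<subseteq> verts K" "\<tau> \<noteq> {} \<Longrightarrow> \<tau> \<subseteq> \<sigma> \<Longrightarrow> \<tau> \<in> K"
proof -
  show "finite \<sigma>" "\<sigma> \<noteq> {}" using assms unfolding simplicial_complex_def by blast+
  show "\<sigma> \<subseteq> verts K" using assms(2) unfolding verts_def by blast
  have "\<forall>\<sigma>\<in>K. \<forall>\<tau>. \<tau> \<noteq> {} \<and> \<tau> \<subseteq> \<sigma> \<longrightarrow> \<tau> \<in> K"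
    using assms(1) unfolding simplicial_complex_def by (elim conjE)
  thus "\<tau> \<noteq> {} \<Longrightarrow> \<tau> \<subseteq> \<sigma> \<Longrightarrow> \<tau> \<in> K" using assms(2) by blast
qed

lemma simplicial_complexI:
  assumes "K \<noteq> {}" "\<And>\<sigma>. \<sigma> \<in> K \<Longrightarrow> finite \<sigma> \<and> \<sigma> \<noteq> {}"
    and "\<And>\<sigma> \<tau>. \<sigma> \<in> K \<Longrightarrow> \<tau> \<noteq> {} \<Longrightarrow> \<tau> \<subseteq> \<sigma> \<Longrightarrow> \<tau> \<in> K"
  shows "simplicial_complex K"
  unfolding simplicial_complex_def
proof (intro conjI ballI allI impI)
  show "K \<noteq> {}" by fact
  fix \<sigma> assume "\<sigma> \<in> K"
  with assms(2) show "finite \<sigma>" "\<sigma> \<noteq> {}" by blast+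
  fix \<tau> assume "\<tau> \<noteq> {} \<and> \<tau> \<subseteq> \<sigma>"
  with assms(3)[OF \<open>\<sigma> \<in> K\<close>] show "\<tau> \<in> K" by blast
qed

lemma singleton_simplex: "simplicial_complex K \<Longrightarrow> x \<in> verts K \<Longrightarrow> {x} \<in> K"
  unfolding verts_def by (auto intro: simplicial_complexD(4))

lemma adj_verts: "(x, y) \<in> adj K \<Longrightarrow> x \<in> verts K \<and> y \<in> verts K"
  by (auto simp: adj_def verts_def)

lemma adj_sym: "(x, y) \<in> adj K \<Longrightarrow> (y, x) \<in> adj K"
  by (auto simp: adj_def insert_commute)

lemma sym_adj: "sym (adj K)"
  by (auto intro: symI adj_sym)

lemma adj_relpow_verts: "(x, y) \<in> adj K ^^ n \<Longrightarrow> x \<in> verts K \<Longrightarrow> y \<in> verts K"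
  by (induction n arbitrary: y) (auto dest: adj_verts)

lemma adj_rtrancl_verts: "(x, y) \<in> (adj K)\<^sup>* \<Longrightarrow> x \<in> verts K \<Longrightarrow> y \<in> verts K"
  by (induction rule: rtrancl_induct) (auto dest: adj_verts)

lemma adj_rtrancl_sym: "(x, y) \<in> (adj K)\<^sup>* \<Longrightarrow> (y, x) \<in> (adj K)\<^sup>*"
  by (meson sym_adj sym_rtrancl symD)

lemma relpow_sym: "sym R \<Longrightarrow> (x, y) \<in> R ^^ n \<Longrightarrow> (y, x) \<in> R ^^ n"
proof (induction n arbitrary: y)
  case (Suc n)
  then obtain z where "(x, z) \<in> R ^^ n" "(z, y) \<in> R" by auto
  thus ?case using Suc by (intro relpow_Suc_I2[of y z]) (auto dest: symD)
qed auto

lemma relpow_image: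
  assumes "\<And>x y. (x, y) \<in> R \<Longrightarrow> (f x, f y) \<in> S" "(x, y) \<in> R ^^ n"
  shows "(f x, f y) \<in> S ^^ n"
  using assms(2) by (induction n arbitrary: y) (auto intro: assms(1))

lemma rtrancl_image:
  assumes "\<And>x y. (x, y) \<in> R \<Longrightarrow> (f x, f y) \<in> S" "(x, y) \<in> R\<^sup>*"
  shows "(f x, f y) \<in> S\<^sup>*"
  using assms(2) by (induction rule: rtrancl_induct) (auto intro: assms(1) rtrancl_into_rtrancl)

text \<open>Balls and components are both full subcomplexes; with their vertex sets named, facts
  about \<open>full_subcomplex\<close> serve for both.\<close>

definition ball_verts :: "real \<Rightarrow> 'v set set \<Rightarrow> 'v set \<Rightarrow> 'v set" where
  "ball_verts r K V = {x. \<exists>v\<in>V. \<exists>n::nat. real n \<le> r \<and> (v, x) \<in> adj K ^^ n}"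

definition component_verts :: "'v set set \<Rightarrow> 'v set \<Rightarrow> 'v set" where
  "component_verts K V = {x. \<exists>v\<in>V. (v, x) \<in> (adj K)\<^sup>*}"

lemma ball_complex_eq: "ball_complex r K V = full_subcomplex K (ball_verts r K V)"
  by (simp add: ball_complex_def ball_verts_def)

lemma components_meeting_eq: "components_meeting K V = full_subcomplex K (component_verts K V)"
  by (simp add: components_meeting_def component_verts_def)

lemma ball_verts_subset: "V \<subseteq> verts K \<Longrightarrow> ball_verts r K V \<subseteq> verts K"
  by (auto simp: ball_verts_def dest: adj_relpow_verts)

lemma component_verts_subset: "V \<subseteq> verts K \<Longrightarrow> component_verts K V \<subseteq> verts K"
  by (auto simp: component_verts_def dest: adj_rtrancl_verts)

lemma ball_verts_center: "r \<ge> 0 \<Longrightarrow> V \<subseteq> ball_verts r K V"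
  unfolding ball_verts_def by (force intro: exI[of _ "0::nat"])

lemma component_verts_center: "V \<subseteq> component_verts K V"
  by (auto simp: component_verts_def)

lemma ball_verts_component: "ball_verts r K V \<subseteq> component_verts K V"
  by (auto simp: ball_verts_def component_verts_def intro: relpow_imp_rtrancl)

lemma ball_verts_mono: "r \<le> s \<Longrightarrow> ball_verts r K V \<subseteq> ball_verts s K V"
  unfolding ball_verts_def by force

lemma full_subcomplex_subset: "full_subcomplex K W \<subseteq> K"
  by (auto simp: full_subcomplex_def)

lemma simplicial_complex_full:
  assumes "simplicial_complex K" "W \<inter> verts K \<noteq> {}"
  shows "simplicial_complex (full_subcomplex K W)"
proof -
  obtain x where "x \<in> W" "x \<in> verts K" using assms by blast
  hence "{x} \<in> full_subcomplex K W"
    using singleton_simplex[OF assms(1)] by (auto simp: full_subcomplex_def)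
  hence "full_subcomplex K W \<noteq> {}" by blast
  thus ?thesis
  proof (rule simplicial_complexI)
    fix \<sigma> assume "\<sigma> \<in> full_subcomplex K W"
    hence \<sigma>: "\<sigma> \<in> K" "\<sigma> \<subseteq> W" by (simp_all add: full_subcomplex_def)
    show "finite \<sigma> \<and> \<sigma> \<noteq> {}" using simplicial_complexD(1,2)[OF assms(1) \<sigma>(1)] by simp
    show "\<tau> \<in> full_subcomplex K W" if "\<tau> \<noteq> {}" "\<tau> \<subseteq> \<sigma>" for \<tau>
      using simplicial_complexD(4)[OF assms(1) \<sigma>(1) that] \<sigma>(2) that(2)
      by (simp add: full_subcomplex_def)
  qed
qed

lemma verts_full:
  assumes "simplicial_complex K" "W \<subseteq> verts K"
  shows "verts (full_subcomplex K W) = W"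
proof
  show "verts (full_subcomplex K W) \<subseteq> W" by (auto simp: verts_def full_subcomplex_def)
  show "W \<subseteq> verts (full_subcomplex K W)"
  proof
    fix x assume "x \<in> W"
    hence "{x} \<in> full_subcomplex K W"
      using singleton_simplex[OF assms(1)] assms(2) by (auto simp: full_subcomplex_def)
    thus "x \<in> verts (full_subcomplex K W)" by (rule verts_insert) simp
  qed
qed

lemma adj_full: "adj (full_subcomplex K W) = adj K \<inter> W \<times> W"
  by (auto simp: adj_def full_subcomplex_def)

lemma full_full: "U \<subseteq> W \<Longrightarrow> full_subcomplex (full_subcomplex K W) U = full_subcomplex K U"
  by (auto simp: full_subcomplex_def)

text \<open>An initial segment of a walk of length at most \<open>r\<close> from \<open>V\<close> is
  again such a walk. So the walk runs inside the ball, hence inside \<open>W\<close>, and its edges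
  survive in the full subcomplex.\<close>

lemma ball_complex_full:
  assumes "ball_verts r K V \<subseteq> W"
  shows "ball_complex r (full_subcomplex K W) V = ball_complex r K V"
proof -
  have "(v, x) \<in> adj (full_subcomplex K W) ^^ n"
    if "v \<in> V" "real n \<le> r" "(v, x) \<in> adj K ^^ n" for v x n
    using that
  proof (induction n arbitrary: x)
    case (Suc n)
    then obtain y where y: "(v, y) \<in> adj K ^^ n" "(y, x) \<in> adj K" by auto
    have "y \<in> W" "x \<in> W"
      using Suc.prems y assms unfolding ball_verts_def by (force simp del: relpow.simps)+
    hence "(y, x) \<in> adj (full_subcomplex K W)" using y by (simp add: adj_full)
    moreover have "(v, y) \<in> adj (full_subcomplex K W) ^^ n"
      using Suc y by simp
    ultimately show ?case by auto
  qed auto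
  moreover have "(v, x) \<in> adj K ^^ n" if "(v, x) \<in> adj (full_subcomplex K W) ^^ n" for v x n
    using relpow_image[of "adj (full_subcomplex K W)" "\<lambda>x. x" "adj K", OF _ that] adj_full by blast
  ultimately have "ball_verts r (full_subcomplex K W) V = ball_verts r K V"
    unfolding ball_verts_def by blast
  thus ?thesis using assms by (simp add: ball_complex_eq full_full)
qed

lemma ball_complex_components: "ball_complex r (components_meeting K V) V = ball_complex r K V"
  by (simp add: components_meeting_eq ball_complex_full ball_verts_component)

lemma ball_complex_ball_complex:
  "r \<le> s \<Longrightarrow> ball_complex r (ball_complex s K V) V = ball_complex r K V"
  by (simp add: ball_complex_eq[of s] ball_complex_full ball_verts_mono)

text \<open>A path that starts in a component stays there, so reachability is still witnessed after
  passing to the components. This is what lets the root meet every component of the smaller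
  complex.\<close>

lemma rtrancl_components:
  assumes "(x, y) \<in> (adj K)\<^sup>*" "x \<in> component_verts K V"
  shows "(x, y) \<in> (adj (components_meeting K V))\<^sup>* \<and> y \<in> component_verts K V"
  using assms
proof (induction rule: rtrancl_induct)
  case (step y z)
  hence "z \<in> component_verts K V"
    unfolding component_verts_def by (blast intro: rtrancl_into_rtrancl)
  with step show ?case
    by (auto simp: components_meeting_eq adj_full intro: rtrancl_into_rtrancl)
qed auto

section \<open>Vertex degrees and finiteness of balls\<close>

definition edges_at :: "'v set set \<Rightarrow> 'v \<Rightarrow> 'v set set" where
  "edges_at K v = {\<sigma> \<in> K. v \<in> \<sigma> \<and> card \<sigma> = 2}"

lemma vertex_degree_eq: "vertex_degree K = (SUP v\<in>verts K. emeasure (count_space UNIV) (edges_at K v))"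
  by (simp add: vertex_degree_def edges_at_def)

lemma emeasure_count_space_surj_le:
  assumes "B \<subseteq> f ` A"
  shows "emeasure (count_space UNIV) B \<le> emeasure (count_space UNIV) A"
proof (cases "finite A")
  case True
  hence "finite B" "card B \<le> card A"
    using assms by (auto intro: finite_subset surj_card_le)
  thus ?thesis using True by (simp add: emeasure_count_space)
qed (simp add: emeasure_count_space)

text \<open>The form fits all the constructions in use: for subcomplexes, isomorphic copies, induced
  complexes and quotients, the edges at a vertex are images of edges at a suitable vertex of the
  original complex.\<close>

lemma vertex_degree_le:
  assumes "\<And>w. w \<in> verts L \<Longrightarrow> \<exists>v\<in>verts K. \<exists>f. edges_at L w \<subseteq> f ` edges_at K v"
  shows "vertex_degree L \<le> vertex_degree K"
  unfolding vertex_degree_eq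
proof (rule SUP_mono)
  fix w assume "w \<in> verts L"
  thus "\<exists>v\<in>verts K. emeasure (count_space UNIV) (edges_at L w) \<le> emeasure (count_space UNIV) (edges_at K v)"
    using assms[of w] by (meson emeasure_count_space_surj_le)
qed

lemma vertex_degree_subcomplex: "L \<subseteq> K \<Longrightarrow> vertex_degree L \<le> vertex_degree K"
  by (rule vertex_degree_le) (force simp: edges_at_def verts_def intro!: exI[of _ "\<lambda>x. x"])

lemma finite_neighbours:
  assumes "vertex_degree K \<le> ennreal D"
  shows "finite {y. (x, y) \<in> adj K}"
proof (cases "x \<in> verts K")
  case True
  have "emeasure (count_space UNIV) (edges_at K x) \<le> ennreal D"
    using assms True unfolding vertex_degree_eq by (meson SUP_le_iff)
  hence "finite (edges_at K x)"
    \<comment> \<open>An infinite edge set would have infinite counting measure, above the finite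
      bound \<open>ennreal D\<close>.\<close>
    by (rule_tac ccontr) (auto simp: emeasure_count_space_infinite top_unique)
  \<comment> \<open>An edge at \<open>x\<close> is sent to its other endpoint.\<close>
  moreover have "{y. (x, y) \<in> adj K} \<subseteq> (\<lambda>\<sigma>. the_elem (\<sigma> - {x})) ` edges_at K x"
  proof
    fix y assume "y \<in> {y. (x, y) \<in> adj K}"
    hence "x \<noteq> y" "{x, y} \<in> K" by (auto simp: adj_def)
    hence "{x, y} \<in> edges_at K x" "the_elem ({x, y} - {x}) = y"
      by (auto simp: edges_at_def insert_Diff_if)
    thus "y \<in> (\<lambda>\<sigma>. the_elem (\<sigma> - {x})) ` edges_at K x" by force
  qed
  ultimately show ?thesis by (meson finite_imageI finite_subset)
next
  case False
  hence "{y. (x, y) \<in> adj K} = {}" by (auto dest: adj_verts)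
  thus ?thesis by (metis finite.emptyI)
qed

lemma finite_sphere:
  assumes "vertex_degree K \<le> ennreal D"
  shows "finite {y. (x, y) \<in> adj K ^^ n}"
proof (induction n)
  case (Suc n)
  have "{y. (x, y) \<in> adj K ^^ Suc n} = (\<Union>z\<in>{y. (x, y) \<in> adj K ^^ n}. {y. (z, y) \<in> adj K})"
    by auto
  thus ?case using Suc finite_neighbours[OF assms] by simp
qed auto

lemma finite_ball_verts:
  assumes "vertex_degree K \<le> ennreal D" "finite V"
  shows "finite (ball_verts r K V)"
proof -
  \<comment> \<open>Path lengths are natural numbers, so a real radius may be replaced by its
    floor.\<close>
  have "ball_verts r K V \<subseteq> (\<Union>v\<in>V. \<Union>n\<in>{..nat \<lfloor>r\<rfloor>}. {y. (v, y) \<in> adj K ^^ n})"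
    unfolding ball_verts_def by (fastforce simp: le_nat_floor)
  thus ?thesis using finite_sphere[OF assms(1)] assms(2) by (auto intro: finite_subset)
qed

section \<open>Actions and rooted isomorphisms\<close>

text \<open>In contrast to \<^const>\<open>g_complex\<close>, nothing is required of the action outside of the vertex
  set, so that the notion passes to invariant subcomplexes.\<close>

definition simplicial_action ::
    "('g, 'b) monoid_scheme \<Rightarrow> 'v set set \<Rightarrow> ('g \<Rightarrow> 'v \<Rightarrow> 'v) \<Rightarrow> bool" where
  "simplicial_action G K \<phi> \<longleftrightarrow> group G \<and> simplicial_complex K \<and>
     (\<forall>g\<in>carrier G. \<forall>\<sigma>\<in>K. \<phi> g ` \<sigma> \<in> K) \<and> (\<forall>x\<in>verts K. \<phi> \<one>\<^bsub>G\<^esub> x = x) \<and>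
     (\<forall>g\<in>carrier G. \<forall>h\<in>carrier G. \<forall>x\<in>verts K. \<phi> (g \<otimes>\<^bsub>G\<^esub> h) x = \<phi> g (\<phi> h x))"

lemma simplicial_actionD:
  assumes "simplicial_action G K \<phi>"
  shows "simplicial_complex K"
    and "g \<in> carrier G \<Longrightarrow> \<sigma> \<in> K \<Longrightarrow> \<phi> g ` \<sigma> \<in> K"
    and "x \<in> verts K \<Longrightarrow> \<phi> \<one>\<^bsub>G\<^esub> x = x"
    and "g \<in> carrier G \<Longrightarrow> h \<in> carrier G \<Longrightarrow> x \<in> verts K \<Longrightarrow> \<phi> (g \<otimes>\<^bsub>G\<^esub> h) x = \<phi> g (\<phi> h x)"
    and "g \<in> carrier G \<Longrightarrow> x \<in> verts K \<Longrightarrow> \<phi> g x \<in> verts K"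
    and "group G"
  using assms unfolding simplicial_action_def verts_def by blast+

lemma simplicial_actionI:
  assumes "group G" "simplicial_complex K"
    and "\<And>g \<sigma>. g \<in> carrier G \<Longrightarrow> \<sigma> \<in> K \<Longrightarrow> \<phi> g ` \<sigma> \<in> K"
    and "\<And>x. x \<in> verts K \<Longrightarrow> \<phi> \<one>\<^bsub>G\<^esub> x = x"
    and "\<And>g h x. g \<in> carrier G \<Longrightarrow> h \<in> carrier G \<Longrightarrow> x \<in> verts K \<Longrightarrow>
      \<phi> (g \<otimes>\<^bsub>G\<^esub> h) x = \<phi> g (\<phi> h x)"
  shows "simplicial_action G K \<phi>"
  unfolding simplicial_action_def by (intro conjI ballI) (fact assms(1,2) | erule (2) assms(5) | erule (1) assms(3) | erule assms(4))+

lemma simplicial_action_inv: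
  assumes "simplicial_action G K \<phi>" "g \<in> carrier G" "x \<in> verts K"
  shows "\<phi> (inv\<^bsub>G\<^esub> g) (\<phi> g x) = x" "\<phi> g (\<phi> (inv\<^bsub>G\<^esub> g) x) = x"
proof -
  interpret group G using assms(1) by (rule simplicial_actionD)
  show "\<phi> (inv\<^bsub>G\<^esub> g) (\<phi> g x) = x" "\<phi> g (\<phi> (inv\<^bsub>G\<^esub> g) x) = x"
    using simplicial_actionD(4)[OF assms(1) _ _ assms(3), symmetric] assms(2)
      simplicial_actionD(3)[OF assms(1,3)] by simp_all
qed

lemma simplicial_action_inj:
  assumes "simplicial_action G K \<phi>" "g \<in> carrier G"
  shows "inj_on (\<phi> g) (verts K)"
  by (rule inj_on_inverseI[of _ "\<phi> (inv\<^bsub>G\<^esub> g)"]) (rule simplicial_action_inv(1)[OF assms])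

lemma simplicial_action_adj:
  assumes "simplicial_action G K \<phi>" "g \<in> carrier G" "(x, y) \<in> adj K"
  shows "(\<phi> g x, \<phi> g y) \<in> adj K"
proof -
  have "x \<noteq> y" "{x, y} \<in> K" "x \<in> verts K" "y \<in> verts K"
    using assms(3) by (auto simp: adj_def verts_def)
  moreover from this have "\<phi> g x \<noteq> \<phi> g y"
    using simplicial_action_inj[OF assms(1,2)] by (auto dest: inj_onD)
  moreover have "\<phi> g ` {x, y} \<in> K" using simplicial_actionD(2)[OF assms(1)] assms(2) calculation by blast
  ultimately show ?thesis by (auto simp: adj_def)
qed

lemma g_complex_imp_action:
  assumes "g_complex G K \<phi>"
  shows "simplicial_action G K \<phi>"
proof -
  interpret group_action G "verts K" \<phi> using assms by (simp add: g_complex_def)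
  have grp: "group G" by (rule group_hom.axioms(1)[OF group_hom])
  have "(`) (\<phi> g) ` K = K" if "g \<in> carrier G" for g
    using assms that unfolding g_complex_def by (elim conjE bspec)
  hence "\<phi> g ` \<sigma> \<in> K" if "g \<in> carrier G" "\<sigma> \<in> K" for g \<sigma>
    using that by blast
  moreover have "simplicial_complex K" using assms by (simp add: g_complex_def)
  moreover have "\<phi> \<one>\<^bsub>G\<^esub> x = x" if "x \<in> verts K" for x
    using fun_cong[OF id_eq_one, of x] that by simp
  moreover have "\<phi> (g \<otimes>\<^bsub>G\<^esub> h) x = \<phi> g (\<phi> h x)"
    if "g \<in> carrier G" "h \<in> carrier G" "x \<in> verts K" for g h x
    by (rule composition_rule[OF that(3,1,2)])
  ultimately show ?thesis
    using grp by (intro simplicial_actionI)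
qed

text \<open>\<open>group_action\<close> is a homomorphism into \<open>BijGroup\<close>, whose
  elements are extensional maps; an action known only on the vertices has to be cut off outside of
  them to become one.\<close>

lemma g_complex_restrict:
  assumes "simplicial_action G K \<phi>"
  shows "g_complex G K (\<lambda>g. restrict (\<phi> g) (verts K))"
proof -
  interpret group G using assms by (rule simplicial_actionD)
  have bij: "bij_betw (\<phi> g) (verts K) (verts K)" if "g \<in> carrier G" for g
    using that simplicial_actionD(5)[OF assms] simplicial_action_inv[OF assms]
    by (intro bij_betw_byWitness[of _ "\<phi> (inv\<^bsub>G\<^esub> g)"]) auto
  let ?\<psi> = "\<lambda>g. restrict (\<phi> g) (verts K)"
  have B: "?\<psi> g \<in> Bij (verts K)" if "g \<in> carrier G" for g
    using bij[OF that] by (simp add: Bij_def)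
  have "?\<psi> (g \<otimes>\<^bsub>G\<^esub> h) = compose (verts K) (?\<psi> g) (?\<psi> h)"
    if "g \<in> carrier G" "h \<in> carrier G" for g h
    using that simplicial_actionD(4,5)[OF assms] by (intro ext) (simp add: compose_def)
  hence "?\<psi> \<in> hom G (BijGroup (verts K))"
    by (intro homI) (simp_all add: BijGroup_def B)
  hence "group_action G (verts K) ?\<psi>"
    by (simp add: group_action_def group_hom_def group_hom_axioms_def group_BijGroup is_group)
  moreover have "(`) (restrict (\<phi> g) (verts K)) ` K = K" if g: "g \<in> carrier G" for g
  proof -
    have "restrict (\<phi> g) (verts K) ` \<sigma> = \<phi> g ` \<sigma>" if "\<sigma> \<in> K" for \<sigma>
      by (rule image_cong) (use that in \<open>auto simp: verts_def\<close>)
    hence eq: "(`) (restrict (\<phi> g) (verts K)) ` K = (`) (\<phi> g) ` K" by (rule image_cong[OF refl])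
    have "\<sigma> = \<phi> g ` \<phi> (inv\<^bsub>G\<^esub> g) ` \<sigma>" if "\<sigma> \<in> K" for \<sigma>
    proof -
      have "\<phi> g (\<phi> (inv\<^bsub>G\<^esub> g) x) = x" if "x \<in> \<sigma>" for x
        using simplicial_action_inv(2)[OF assms g] that \<open>\<sigma> \<in> K\<close> by (auto simp: verts_def)
      thus ?thesis by (simp add: image_image cong: image_cong)
    qed
    moreover have "\<phi> (inv\<^bsub>G\<^esub> g) ` \<sigma> \<in> K" if "\<sigma> \<in> K" for \<sigma>
      using simplicial_actionD(2)[OF assms inv_closed[OF g] that] .
    ultimately have "K \<subseteq> (`) (\<phi> g) ` K" by blast
    moreover have "(`) (\<phi> g) ` K \<subseteq> K" using simplicial_actionD(2)[OF assms g] by blast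
    ultimately show ?thesis using eq by simp
  qed
  ultimately show ?thesis using simplicial_actionD(1)[OF assms] by (simp add: g_complex_def)
qed

lemma simplicial_action_full:
  assumes "simplicial_action G K \<phi>" "W \<subseteq> verts K" "W \<noteq> {}"
    and "\<And>g x. g \<in> carrier G \<Longrightarrow> x \<in> W \<Longrightarrow> \<phi> g x \<in> W"
  shows "simplicial_action G (full_subcomplex K W) \<phi>"
proof -
  have v: "verts (full_subcomplex K W) = W"
    by (rule verts_full[OF simplicial_actionD(1)[OF assms(1)] assms(2)])
  have "simplicial_complex (full_subcomplex K W)"
    using assms by (intro simplicial_complex_full simplicial_actionD(1)) auto
  moreover have "\<phi> g ` \<sigma> \<in> full_subcomplex K W" if "g \<in> carrier G" "\<sigma> \<in> full_subcomplex K W" for g \<sigma>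
    using that simplicial_actionD(2)[OF assms(1)] assms(4) by (auto simp: full_subcomplex_def)
  ultimately show ?thesis
    using simplicial_actionD(3,4,6)[OF assms(1)] assms(2) v by (intro simplicial_actionI) auto
qed

lemma orbit_subset_verts: "simplicial_action G K \<phi> \<Longrightarrow> x \<in> verts K \<Longrightarrow> orbit G \<phi> x \<subseteq> verts K"
  by (auto simp: orbit_def dest: simplicial_actionD(5))

lemma orbit_self:
  assumes "simplicial_action G K \<phi>" "x \<in> verts K"
  shows "x \<in> orbit G \<phi> x"
proof -
  interpret group G using assms(1) by (rule simplicial_actionD)
  have "x = \<phi> \<one>\<^bsub>G\<^esub> x" using simplicial_actionD(3)[OF assms] by simp
  thus ?thesis unfolding orbit_def using one_closed by blast
qed

lemma orbit_closed:
  assumes "simplicial_action G K \<phi>" "x \<in> verts K" "y \<in> orbit G \<phi> x" "g \<in> carrier G"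
  shows "\<phi> g y \<in> orbit G \<phi> x"
proof -
  interpret group G using assms(1) by (rule simplicial_actionD)
  obtain h where h: "h \<in> carrier G" "y = \<phi> h x" using assms(3) unfolding orbit_def by blast
  hence "\<phi> g y = \<phi> (g \<otimes>\<^bsub>G\<^esub> h) x" using simplicial_actionD(4)[OF assms(1,4) h(1) assms(2)] by simp
  moreover have "g \<otimes>\<^bsub>G\<^esub> h \<in> carrier G" using h(1) assms(4) by simp
  ultimately show ?thesis unfolding orbit_def by blast
qed

lemma orbit_translate:
  assumes "simplicial_action G K \<phi>" "x \<in> verts K" "g \<in> carrier G"
  shows "orbit G \<phi> (\<phi> g x) = orbit G \<phi> x"
proof (rule equalityI)
  interpret group G using assms(1) by (rule simplicial_actionD)
  have v: "\<phi> g x \<in> verts K" using simplicial_actionD(5)[OF assms(1,3,2)] .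
  have "\<phi> g x \<in> orbit G \<phi> x" by (rule orbit_closed[OF assms(1,2) orbit_self[OF assms(1,2)] assms(3)])
  thus "orbit G \<phi> (\<phi> g x) \<subseteq> orbit G \<phi> x"
    unfolding orbit_def[of G \<phi> "\<phi> g x"] using orbit_closed[OF assms(1,2)] by blast
  have "x = \<phi> (inv\<^bsub>G\<^esub> g) (\<phi> g x)" using simplicial_action_inv(1)[OF assms(1,3,2)] by simp
  hence "x \<in> orbit G \<phi> (\<phi> g x)" unfolding orbit_def using inv_closed[OF assms(3)] by blast
  thus "orbit G \<phi> x \<subseteq> orbit G \<phi> (\<phi> g x)"
    unfolding orbit_def[of G \<phi> x] using orbit_closed[OF assms(1) v] by blast
qed

lemma component_verts_invariant:
  assumes "simplicial_action G K \<phi>" "g \<in> carrier G"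
    and "\<And>x. x \<in> V \<Longrightarrow> \<phi> g x \<in> V" "x \<in> component_verts K V"
  shows "\<phi> g x \<in> component_verts K V"
proof -
  obtain v where v: "v \<in> V" "(v, x) \<in> (adj K)\<^sup>*" using assms(4) by (auto simp: component_verts_def)
  have "(\<phi> g v, \<phi> g x) \<in> (adj K)\<^sup>*"
    using rtrancl_image[of "adj K" "\<phi> g" "adj K", OF _ v(2)] simplicial_action_adj[OF assms(1,2)] by blast
  thus ?thesis using v assms(3) by (auto simp: component_verts_def)
qed

text \<open>The witness of \<open>rooted_iso\<close> made explicit: the same map is restricted to
  balls, induced up to a larger group and passed to limits.\<close>

definition rooted_isomorphism ::
    "('v \<Rightarrow> 'w) \<Rightarrow> ('g, 'b) monoid_scheme \<Rightarrow>
     'v set set \<Rightarrow> ('g \<Rightarrow> 'v \<Rightarrow> 'v) \<Rightarrow> 'v set list \<Rightarrow>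
     'w set set \<Rightarrow> ('g \<Rightarrow> 'w \<Rightarrow> 'w) \<Rightarrow> 'w set list \<Rightarrow> bool" where
  "rooted_isomorphism f G K \<phi> Rs L \<psi> Ss \<longleftrightarrow>
     bij_betw f (verts K) (verts L) \<and> (`) f ` K = L \<and>
     (\<forall>g\<in>carrier G. \<forall>x\<in>verts K. f (\<phi> g x) = \<psi> g (f x)) \<and> map ((`) f) Rs = Ss"

lemma rooted_iso_iff: "rooted_iso G K \<phi> Rs L \<psi> Ss \<longleftrightarrow> (\<exists>f. rooted_isomorphism f G K \<phi> Rs L \<psi> Ss)"
  by (simp add: rooted_iso_def rooted_isomorphism_def)

lemma rooted_isomorphism_trans:
  assumes "rooted_isomorphism f G K \<phi> Rs L \<psi> Ss" "rooted_isomorphism g G L \<psi> Ss M \<xi> Ts"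
  shows "rooted_isomorphism (g \<circ> f) G K \<phi> Rs M \<xi> Ts"
proof -
  have fv: "f x \<in> verts L" if "x \<in> verts K" for x
    using assms(1) that by (auto simp: rooted_isomorphism_def bij_betw_def)
  have "bij_betw (g \<circ> f) (verts K) (verts M)"
    using assms by (auto simp: rooted_isomorphism_def intro: bij_betw_trans)
  moreover have "(`) (g \<circ> f) ` K = M"
  proof -
    have "(`) (g \<circ> f) ` K = (`) g ` (`) f ` K"
      unfolding image_image[of "(`) g"] by (simp add: image_comp)
    thus ?thesis using assms by (simp add: rooted_isomorphism_def)
  qed
  moreover have "map ((`) (g \<circ> f)) Rs = Ts"
    using assms by (auto simp: rooted_isomorphism_def image_comp)
  ultimately show ?thesis
    using assms fv by (simp add: rooted_isomorphism_def)
qed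

text \<open>The source action has to preserve the vertices: only then is the value of the inverse at
  \<open>f (\<phi> g x)\<close> known to be \<open>\<phi> g x\<close>.\<close>

lemma rooted_isomorphism_sym:
  assumes "simplicial_action G K \<phi>" "\<forall>R\<in>set Rs. R \<subseteq> verts K"
    and f: "rooted_isomorphism f G K \<phi> Rs L \<psi> Ss"
  shows "rooted_isomorphism (the_inv_into (verts K) f) G L \<psi> Ss K \<phi> Rs"
proof -
  let ?g = "the_inv_into (verts K) f"
  have bij: "bij_betw f (verts K) (verts L)" and L: "(`) f ` K = L" and Ss: "map ((`) f) Rs = Ss"
    and eqv: "\<And>g x. g \<in> carrier G \<Longrightarrow> x \<in> verts K \<Longrightarrow> f (\<phi> g x) = \<psi> g (f x)"
    using f by (auto simp: rooted_isomorphism_def)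
  have gf: "?g (f x) = x" if "x \<in> verts K" for x
    using bij that by (simp add: bij_betw_def the_inv_into_f_f)
  have gfi: "?g ` f ` A = A" if "A \<subseteq> verts K" for A
  proof -
    have "?g ` f ` A = (\<lambda>x. x) ` A"
      unfolding image_image by (rule image_cong) (use that gf in auto)
    thus ?thesis by simp
  qed
  have "(`) ?g ` L = K"
  proof -
    have "(`) ?g ` L = (\<lambda>\<sigma>. \<sigma>) ` K"
      unfolding L[symmetric] image_image[of "(`) ?g"]
      by (rule image_cong[OF refl], rule gfi) (auto intro: verts_insert)
    thus ?thesis by simp
  qed
  moreover have "?g (\<psi> g y) = \<phi> g (?g y)" if "g \<in> carrier G" "y \<in> verts L" for g y
  proof -
    obtain x where "x \<in> verts K" "y = f x"
      using \<open>y \<in> verts L\<close> bij_betw_imp_surj_on[OF bij] by blast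
    thus ?thesis using that eqv[of g x] gf simplicial_actionD(5)[OF assms(1), of g x] gf[of "\<phi> g x"] by simp
  qed
  moreover have "map ((`) ?g) Ss = Rs"
    unfolding Ss[symmetric] map_map using gfi assms(2) by (auto intro!: map_idI)
  ultimately show ?thesis
    using bij_betw_the_inv_into[OF bij] by (simp add: rooted_isomorphism_def)
qed

text \<open>Every vertex and every simplex of \<open>L\<close> is an image under \<open>f\<close>,
  so the laws of an action are carried over by equivariance. This supplies the properties of a
  target that is given only through an isomorphism.\<close>

lemma rooted_isomorphism_action:
  assumes "simplicial_action G K \<phi>" and f: "rooted_isomorphism f G K \<phi> Rs L \<psi> Ss"
  shows "simplicial_action G L \<psi>"
proof -
  note K = simplicial_actionD[OF assms(1)]
  have fv: "f ` verts K = verts L" and L: "(`) f ` K = L" 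
    and eqv: "\<And>g x. g \<in> carrier G \<Longrightarrow> x \<in> verts K \<Longrightarrow> f (\<phi> g x) = \<psi> g (f x)"
    using f by (auto simp: rooted_isomorphism_def bij_betw_def)
  have eqv_simplex: "\<psi> g ` f ` \<sigma> = f ` \<phi> g ` \<sigma>" if "g \<in> carrier G" "\<sigma> \<in> K" for g \<sigma>
    proof -
    have "\<psi> g (f x) = f (\<phi> g x)" if "x \<in> \<sigma>" for x
      using eqv[of g x] \<open>g \<in> carrier G\<close> verts_insert[OF \<open>\<sigma> \<in> K\<close> that] by simp
    thus ?thesis unfolding image_image by (rule image_cong[OF refl])
  qed
  have "simplicial_complex L"
  proof (rule simplicial_complexI)
    have "K \<noteq> {}" using K(1) by (simp add: simplicial_complex_def)
    thus "L \<noteq> {}" unfolding L[symmetric] by simp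
    fix \<sigma> assume "\<sigma> \<in> L"
    then obtain \<rho> where \<rho>: "\<rho> \<in> K" "\<sigma> = f ` \<rho>" unfolding L[symmetric] by blast
    show "finite \<sigma> \<and> \<sigma> \<noteq> {}" using simplicial_complexD(1,2)[OF K(1) \<rho>(1)] \<rho>(2) by simp
    fix \<tau> assume \<tau>: "\<tau> \<noteq> {}" "\<tau> \<subseteq> \<sigma>"
    hence "\<tau> \<subseteq> f ` \<rho>" using \<rho>(2) by simp
    then obtain \<rho>' where \<rho>': "\<rho>' \<subseteq> \<rho>" "\<tau> = f ` \<rho>'" unfolding subset_image_iff by blast
    hence "\<rho>' \<in> K" using simplicial_complexD(4)[OF K(1) \<rho>(1), of \<rho>'] \<tau> by auto
    thus "\<tau> \<in> L" unfolding L[symmetric] \<rho>'(2) by (rule imageI)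
  qed
  moreover have "\<psi> g ` \<sigma> \<in> L" if "g \<in> carrier G" "\<sigma> \<in> L" for g \<sigma>
  proof -
    obtain \<rho> where \<rho>: "\<rho> \<in> K" "\<sigma> = f ` \<rho>" using \<open>\<sigma> \<in> L\<close> unfolding L[symmetric] by blast
    show ?thesis
      unfolding \<rho>(2) eqv_simplex[OF \<open>g \<in> carrier G\<close> \<rho>(1)] L[symmetric] by (rule imageI, rule K(2)[OF \<open>g \<in> carrier G\<close> \<rho>(1)])
  qed
  moreover have "\<psi> \<one>\<^bsub>G\<^esub> y = y" if "y \<in> verts L" for y
  proof -
    obtain x where "x \<in> verts K" "y = f x" using \<open>y \<in> verts L\<close> fv by blast
    moreover have "\<one>\<^bsub>G\<^esub> \<in> carrier G" using K(6) by (simp add: group.is_monoid)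
    ultimately show ?thesis using eqv[of "\<one>\<^bsub>G\<^esub>" x] K(3)[of x] by simp
  qed
  moreover have "\<psi> (g \<otimes>\<^bsub>G\<^esub> h) y = \<psi> g (\<psi> h y)" if "g \<in> carrier G" "h \<in> carrier G" "y \<in> verts L" for g h y
  proof -
    obtain x where x: "x \<in> verts K" "y = f x" using \<open>y \<in> verts L\<close> fv by blast
    have gh: "g \<otimes>\<^bsub>G\<^esub> h \<in> carrier G" using that(1,2) K(6) by (simp add: group.is_monoid monoid.m_closed)
    show ?thesis
      unfolding x(2) eqv[OF gh x(1), symmetric] eqv[OF that(2) x(1), symmetric] K(4)[OF that(1,2) x(1)]
      by (rule eqv[OF that(1) K(5)[OF that(2) x(1)]])
  qed
  ultimately show ?thesis using K(6) by (intro simplicial_actionI)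
qed

lemma rooted_isomorphismD:
  assumes "rooted_isomorphism f G K \<phi> Rs L \<psi> Ss"
  shows "inj_on f (verts K)" "f ` verts K = verts L" "(`) f ` K = L" "map ((`) f) Rs = Ss"
    and "g \<in> carrier G \<Longrightarrow> x \<in> verts K \<Longrightarrow> f (\<phi> g x) = \<psi> g (f x)"
  using assms by (simp_all add: rooted_isomorphism_def bij_betw_def)

lemma rooted_isomorphismI:
  assumes "inj_on f (verts K)" "f ` verts K = verts L" "(`) f ` K = L" "map ((`) f) Rs = Ss"
    and "\<And>g x. g \<in> carrier G \<Longrightarrow> x \<in> verts K \<Longrightarrow> f (\<phi> g x) = \<psi> g (f x)"
  shows "rooted_isomorphism f G K \<phi> Rs L \<psi> Ss"
  using assms by (simp add: rooted_isomorphism_def bij_betw_def)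

lemma rooted_isomorphism_id:
  assumes "\<And>g x. g \<in> carrier G \<Longrightarrow> x \<in> verts K \<Longrightarrow> \<phi> g x = \<psi> g x"
  shows "rooted_isomorphism (\<lambda>x. x) G K \<phi> Rs K \<psi> Rs"
  using assms by (intro rooted_isomorphismI) (simp_all add: map_idI)

lemma rooted_isomorphism_adj:
  assumes f: "rooted_isomorphism f G K \<phi> Rs L \<psi> Ss" and "(x, y) \<in> adj K"
  shows "(f x, f y) \<in> adj L"
proof -
  have xy: "x \<noteq> y" "{x, y} \<in> K" "x \<in> verts K" "y \<in> verts K"
    using assms(2) adj_verts[OF assms(2)] by (auto simp: adj_def)
  have "f x \<noteq> f y" using inj_onD[OF rooted_isomorphismD(1)[OF f] _ xy(3,4)] xy(1) by blast
  moreover have "f ` {x, y} \<in> L"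
    unfolding rooted_isomorphismD(3)[OF f, symmetric] by (rule imageI[OF xy(2)])
  ultimately show ?thesis by (simp add: adj_def)
qed

lemma rooted_isomorphism_ball_verts_subset:
  assumes f: "rooted_isomorphism f G K \<phi> Rs L \<psi> Ss"
  shows "f ` ball_verts r K V \<subseteq> ball_verts r L (f ` V)"
proof
  fix y assume "y \<in> f ` ball_verts r K V"
  then obtain v n x where x: "v \<in> V" "real n \<le> r" "(v, x) \<in> adj K ^^ n" "y = f x"
    unfolding ball_verts_def by blast
  have "(f v, f x) \<in> adj L ^^ n"
    by (rule relpow_image[of "adj K", OF rooted_isomorphism_adj[OF f] x(3)])
  thus "y \<in> ball_verts r L (f ` V)" unfolding ball_verts_def using x(1,2,4) by blast
qed

text \<open>Neither \<open>f\<close> nor its inverse increases distances.\<close>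

lemma rooted_isomorphism_ball_verts:
  assumes "simplicial_action G K \<phi>" "\<forall>R\<in>set Rs. R \<subseteq> verts K"
    and f: "rooted_isomorphism f G K \<phi> Rs L \<psi> Ss" and V: "V \<subseteq> verts K"
  shows "f ` ball_verts r K V = ball_verts r L (f ` V)"
proof
  let ?g = "the_inv_into (verts K) f"
  note inj = rooted_isomorphismD(1)[OF f]
  have gf: "?g ` f ` V = V"
  proof -
    have "?g (f x) = x" if "x \<in> V" for x using the_inv_into_f_f[OF inj] V that by blast
    thus ?thesis by (simp add: image_image)
  qed
  show "ball_verts r L (f ` V) \<subseteq> f ` ball_verts r K V"
  proof
    fix y assume y: "y \<in> ball_verts r L (f ` V)"
    have "f ` V \<subseteq> verts L" using V rooted_isomorphismD(2)[OF f] by blast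
    hence "y \<in> f ` verts K" using y ball_verts_subset rooted_isomorphismD(2)[OF f] by blast
    hence "f (?g y) = y" by (rule f_the_inv_into_f[OF inj])
    moreover have "?g y \<in> ball_verts r K V"
      using rooted_isomorphism_ball_verts_subset[OF rooted_isomorphism_sym[OF assms(1,2) f], of r "f ` V"] y gf
      by auto
    ultimately show "y \<in> f ` ball_verts r K V" by (metis imageI)
  qed
qed (rule rooted_isomorphism_ball_verts_subset[OF f])

lemma rooted_isomorphism_full:
  assumes K: "simplicial_action G K \<phi>" and f: "rooted_isomorphism f G K \<phi> Rs L \<psi> Ss"
    and W: "W \<subseteq> verts K"
  shows "rooted_isomorphism f G (full_subcomplex K W) \<phi> Rs (full_subcomplex L (f ` W)) \<psi> Ss"
proof -
  note sc = simplicial_actionD(1)[OF K] simplicial_actionD(1)[OF rooted_isomorphism_action[OF K f]]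
  note fD = rooted_isomorphismD[OF f]
  have fW: "f ` W \<subseteq> verts L" using W fD(2) by blast
  note vv = verts_full[OF sc(1) W] verts_full[OF sc(2) fW]
  have "(`) f ` full_subcomplex K W = full_subcomplex L (f ` W)"
  proof
    show "(`) f ` full_subcomplex K W \<subseteq> full_subcomplex L (f ` W)"
      using fD(3) by (auto simp: full_subcomplex_def)
    show "full_subcomplex L (f ` W) \<subseteq> (`) f ` full_subcomplex K W"
    proof
      fix \<tau> assume "\<tau> \<in> full_subcomplex L (f ` W)"
      hence \<tau>: "\<tau> \<in> L" "\<tau> \<subseteq> f ` W" by (simp_all add: full_subcomplex_def)
      then obtain \<sigma> where \<sigma>: "\<sigma> \<in> K" "\<tau> = f ` \<sigma>" unfolding fD(3)[symmetric] by blast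
      \<comment> \<open>By injectivity on the vertices, a simplex whose image lies over
        \<open>W\<close> lies in \<open>W\<close> itself.\<close>
      have "\<sigma> \<subseteq> W"
        using inj_on_image_subset_iff[OF fD(1) simplicial_complexD(3)[OF sc(1) \<sigma>(1)] W] \<tau>(2) \<sigma>(2) by simp
      thus "\<tau> \<in> (`) f ` full_subcomplex K W" using \<sigma> by (auto simp: full_subcomplex_def)
    qed
  qed
  thus ?thesis
    using W fD(5) by (intro rooted_isomorphismI) (auto simp: vv fD(4) intro: inj_on_subset[OF fD(1)])
qed

lemma Union_map_image: "\<Union>(set (map ((`) f) Rs)) = f ` \<Union>(set Rs)"
  by auto

lemma rooted_isomorphism_ball_complex:
  assumes "simplicial_action G K \<phi>" "\<forall>R\<in>set Rs. R \<subseteq> verts K"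
    and f: "rooted_isomorphism f G K \<phi> Rs L \<psi> Ss"
  shows "rooted_isomorphism f G (ball_complex r K (\<Union>(set Rs))) \<phi> Rs (ball_complex r L (\<Union>(set Ss))) \<psi> Ss"
proof -
  have V: "\<Union>(set Rs) \<subseteq> verts K" using assms(2) by blast
  have eq: "\<Union>(set Ss) = f ` \<Union>(set Rs)"
    unfolding rooted_isomorphismD(4)[OF f, symmetric] by (rule Union_map_image)
  show ?thesis
    unfolding ball_complex_eq eq rooted_isomorphism_ball_verts[OF assms V, symmetric]
    by (rule rooted_isomorphism_full[OF assms(1) f ball_verts_subset[OF V]])
qed

lemma orbit_image: "orbit G \<phi> x = (\<lambda>g. \<phi> g x) ` carrier G"
  unfolding orbit_def by blast

lemma rooted_isomorphism_orbit:
  assumes "rooted_isomorphism f G K \<phi> Rs L \<psi> Ss" "x \<in> verts K"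
  shows "f ` orbit G \<phi> x = orbit G \<psi> (f x)"
  unfolding orbit_image image_image
  by (rule image_cong[OF refl]) (rule rooted_isomorphismD(5)[OF assms(1) _ assms(2)])

lemma rooted_isomorphism_vertex_degree:
  assumes f: "rooted_isomorphism f G K \<phi> Rs L \<psi> Ss"
  shows "vertex_degree L \<le> vertex_degree K"
proof (rule vertex_degree_le)
  note fD = rooted_isomorphismD[OF f]
  fix w assume "w \<in> verts L"
  then obtain v where v: "v \<in> verts K" "w = f v" using fD(2) by blast
  have "edges_at L w \<subseteq> (`) f ` edges_at K v"
  proof
    fix \<tau> assume "\<tau> \<in> edges_at L w"
    hence \<tau>: "\<tau> \<in> L" "w \<in> \<tau>" "card \<tau> = 2" by (simp_all add: edges_at_def)
    then obtain \<sigma> where \<sigma>: "\<sigma> \<in> K" "\<tau> = f ` \<sigma>" unfolding fD(3)[symmetric] by blast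
    have sub: "\<sigma> \<subseteq> verts K" using \<sigma>(1) by (auto intro: verts_insert)
    have "v \<in> \<sigma>" using inj_on_image_mem_iff[OF fD(1) v(1) sub] \<tau>(2) \<sigma>(2) v(2) by simp
    moreover have "card \<sigma> = 2" using card_image[OF inj_on_subset[OF fD(1) sub]] \<tau>(3) \<sigma>(2) by simp
    ultimately show "\<tau> \<in> (`) f ` edges_at K v" using \<sigma> by (auto simp: edges_at_def)
  qed
  thus "\<exists>v\<in>verts K. \<exists>h. edges_at L w \<subseteq> h ` edges_at K v" using v(1) by blast
qed

text \<open>The analogue of \<open>rooted_complex\<close> for actions that are arbitrary off the
  vertices. It is stable under isomorphism and induction without any adjustment of the maps.\<close>

definition orbit_rooted ::
    "('g, 'b) monoid_scheme \<Rightarrow> real \<Rightarrow> 'v set set \<Rightarrow> ('g \<Rightarrow> 'v \<Rightarrow> 'v) \<Rightarrow> 'v set list \<Rightarrow> bool" where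
  "orbit_rooted G D K \<phi> Rs \<longleftrightarrow>
     simplicial_action G K \<phi> \<and> vertex_degree K \<le> ennreal D \<and>
     (\<forall>R\<in>set Rs. R \<in> orbits G (verts K) \<phi> \<and> (\<forall>x\<in>verts K. \<exists>y\<in>R. (x, y) \<in> (adj K)\<^sup>*))"

lemma orbit_rootedD:
  assumes "orbit_rooted G D K \<phi> Rs"
  shows "simplicial_action G K \<phi>" "vertex_degree K \<le> ennreal D" "\<forall>R\<in>set Rs. R \<subseteq> verts K"
    and "R \<in> set Rs \<Longrightarrow> R \<in> orbits G (verts K) \<phi>"
    and "R \<in> set Rs \<Longrightarrow> x \<in> verts K \<Longrightarrow> \<exists>y\<in>R. (x, y) \<in> (adj K)\<^sup>*"
proof -
  show *: "simplicial_action G K \<phi>" "vertex_degree K \<le> ennreal D"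
    "R \<in> set Rs \<Longrightarrow> R \<in> orbits G (verts K) \<phi>" for R
    using assms by (simp_all add: orbit_rooted_def)
  show "R \<in> set Rs \<Longrightarrow> x \<in> verts K \<Longrightarrow> \<exists>y\<in>R. (x, y) \<in> (adj K)\<^sup>*"
    using assms by (simp add: orbit_rooted_def)
  show "\<forall>R\<in>set Rs. R \<subseteq> verts K"
  proof
    fix R assume "R \<in> set Rs"
    from *(3)[OF this] obtain x where "x \<in> verts K" "R = orbit G \<phi> x" unfolding orbits_def by blast
    thus "R \<subseteq> verts K" using orbit_subset_verts[OF *(1)] by simp
  qed
qed

lemma rooted_complex_iff:
  "rooted_complex G D k K \<phi> Rs \<longleftrightarrow> g_complex G K \<phi> \<and> orbit_rooted G D K \<phi> Rs \<and> length Rs = k"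
  unfolding rooted_complex_def orbit_rooted_def
  by (rule iffI; elim conjE; intro conjI; (assumption | erule g_complex_imp_action))

lemma orbit_rooted_isomorphism:
  assumes K: "orbit_rooted G D K \<phi> Rs" and f: "rooted_isomorphism f G K \<phi> Rs L \<psi> Ss"
  shows "orbit_rooted G D L \<psi> Ss"
  unfolding orbit_rooted_def
proof (intro conjI ballI)
  note KD = orbit_rootedD[OF K]
  note fD = rooted_isomorphismD[OF f]
  show "simplicial_action G L \<psi>" by (rule rooted_isomorphism_action[OF KD(1) f])
  show "vertex_degree L \<le> ennreal D" using rooted_isomorphism_vertex_degree[OF f] KD(2) by order
  fix S assume "S \<in> set Ss"
  then obtain R where R: "R \<in> set Rs" "S = f ` R" unfolding fD(4)[symmetric] by auto
  obtain x where x: "x \<in> verts K" "R = orbit G \<phi> x" using KD(4)[OF R(1)] unfolding orbits_def by blast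
  have "S = orbit G \<psi> (f x)" using R(2) x(2) rooted_isomorphism_orbit[OF f x(1)] by simp
  moreover have "f x \<in> verts L" using fD(2) x(1) by blast
  ultimately show "S \<in> orbits G (verts L) \<psi>" unfolding orbits_def by blast
  fix z assume "z \<in> verts L"
  then obtain v where v: "v \<in> verts K" "z = f v" using fD(2) by blast
  obtain y where y: "y \<in> R" "(v, y) \<in> (adj K)\<^sup>*" using KD(5)[OF R(1) v(1)] by blast
  have "(f v, f y) \<in> (adj L)\<^sup>*"
    by (rule rtrancl_image[of "adj K", OF rooted_isomorphism_adj[OF f] y(2)])
  thus "\<exists>y\<in>S. (z, y) \<in> (adj L)\<^sup>*" using v y R by blast
qed

section \<open>Isomorphism classes\<close>

lemma iso_class_iff:
  "(M, \<xi>, Ts) \<in> iso_class G K \<phi> Rs \<longleftrightarrow> g_complex G M \<xi> \<and> rooted_iso G K \<phi> Rs M \<xi> Ts"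
  by (simp add: iso_class_def)

lemma rooted_iso_trans:
  "rooted_iso G K \<phi> Rs L \<psi> Ss \<Longrightarrow> rooted_iso G L \<psi> Ss M \<xi> Ts \<Longrightarrow> rooted_iso G K \<phi> Rs M \<xi> Ts"
  unfolding rooted_iso_iff by (elim exE, rule exI, rule rooted_isomorphism_trans)

lemma rooted_iso_sym:
  "simplicial_action G K \<phi> \<Longrightarrow> \<forall>R\<in>set Rs. R \<subseteq> verts K \<Longrightarrow>
   rooted_iso G K \<phi> Rs L \<psi> Ss \<Longrightarrow> rooted_iso G L \<psi> Ss K \<phi> Rs"
  unfolding rooted_iso_iff by (elim exE, rule exI, rule rooted_isomorphism_sym)

lemma rooted_iso_refl: "rooted_iso G K \<phi> Rs K \<phi> Rs"
  unfolding rooted_iso_iff by (rule exI, rule rooted_isomorphism_id, rule refl)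

lemma rooted_iso_length: "rooted_iso G K \<phi> Rs L \<psi> Ss \<Longrightarrow> length Ss = length Rs"
  unfolding rooted_iso_def by auto

text \<open>Being isomorphic is an equivalence relation; its symmetry is the reason for asking that
  the source be an action with roots among its vertices.\<close>

lemma iso_class_eqI:
  assumes "simplicial_action G K \<phi>" "\<forall>R\<in>set Rs. R \<subseteq> verts K" "rooted_iso G K \<phi> Rs L \<psi> Ss"
  shows "iso_class G K \<phi> Rs = iso_class G L \<psi> Ss"
proof -
  have "rooted_iso G K \<phi> Rs M \<xi> Ts \<longleftrightarrow> rooted_iso G L \<psi> Ss M \<xi> Ts" for M :: "nat set set" and \<xi> Ts
    using rooted_iso_trans[OF assms(3)] rooted_iso_trans[OF rooted_iso_sym[OF assms]] by blast
  thus ?thesis unfolding iso_class_def by simp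
qed

text \<open>An enumeration of the vertices gives a model on \<open>nat\<close>. So the class of a
  countable complex over any vertex type is nonempty, and \<open>representative\<close> really
  chooses a member of it.\<close>

lemma nat_model:
  assumes K: "simplicial_action G K \<phi>" and "countable (verts K)"
  obtains M \<xi> Ts where "(M, \<xi>, Ts) \<in> iso_class G K \<phi> Rs"
proof -
  define e where "e = to_nat_on (verts K)"
  have inj: "inj_on e (verts K)" unfolding e_def by (rule inj_on_to_nat_on[OF assms(2)])
  define M where "M = (`) e ` K"
  define \<psi> where "\<psi> = (\<lambda>g n. e (\<phi> g (the_inv_into (verts K) e n)))"
  have e: "rooted_isomorphism e G K \<phi> Rs M \<psi> (map ((`) e) Rs)"
  proof (rule rooted_isomorphismI)
    show "e ` verts K = verts M" unfolding M_def verts_def by blast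
    show "e (\<phi> g x) = \<psi> g (e x)" if "x \<in> verts K" for g x
      unfolding \<psi>_def using the_inv_into_f_f[OF inj that] by simp
  qed (simp_all add: inj M_def)
  note M = rooted_isomorphism_action[OF K e]
  \<comment> \<open>The identity leads from the transported action to its extensional version, which
    agrees with it on the vertices.\<close>
  have "rooted_isomorphism (\<lambda>x. x) G M \<psi> (map ((`) e) Rs) M (\<lambda>g. restrict (\<psi> g) (verts M)) (map ((`) e) Rs)"
    by (rule rooted_isomorphism_id) simp
  hence "rooted_iso G K \<phi> Rs M (\<lambda>g. restrict (\<psi> g) (verts M)) (map ((`) e) Rs)"
    using rooted_isomorphism_trans[OF e] unfolding rooted_iso_iff by blast
  with g_complex_restrict[OF M] that show thesis unfolding iso_class_iff by blast
qed

lemma iso_class_in_SC: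
  assumes "orbit_rooted G D K \<phi> Rs" "countable (verts K)" "length Rs = k"
  shows "iso_class G K \<phi> Rs \<in> SC G D k"
proof -
  note KD = orbit_rootedD[OF assms(1)]
  obtain M \<xi> Ts where M: "(M, \<xi>, Ts) \<in> iso_class G K \<phi> Rs" by (rule nat_model[OF KD(1) assms(2)])
  then obtain f where f: "rooted_isomorphism f G K \<phi> Rs M \<xi> Ts" "g_complex G M \<xi>"
    unfolding iso_class_iff rooted_iso_iff by blast
  have iso: "rooted_iso G K \<phi> Rs M \<xi> Ts" using f unfolding rooted_iso_iff by blast
  have "rooted_complex G D k M \<xi> Ts"
    unfolding rooted_complex_iff
    using f(2) orbit_rooted_isomorphism[OF assms(1) f(1)] rooted_iso_length[OF iso] assms(3) by simp
  thus ?thesis unfolding SC_def using iso_class_eqI[OF KD(1,3) iso] by blast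
qed

text \<open>Used to pass from a class to any convenient member: properties invariant under
  isomorphism are shared by all of them.\<close>

lemma SC_model:
  assumes "C \<in> SC G D k" "(M, \<xi>, Ts) \<in> C"
  shows "g_complex G M \<xi>" "orbit_rooted G D M \<xi> Ts" "length Ts = k" "C = iso_class G M \<xi> Ts"
proof -
  obtain K :: "nat set set" and \<phi> Rs where K: "rooted_complex G D k K \<phi> Rs" "C = iso_class G K \<phi> Rs"
    using assms(1) unfolding SC_def by blast
  have K': "orbit_rooted G D K \<phi> Rs" "length Rs = k" using K(1) unfolding rooted_complex_iff by blast+
  have M: "g_complex G M \<xi>" "rooted_iso G K \<phi> Rs M \<xi> Ts" using assms(2)[unfolded K(2) iso_class_iff] by blast+
  show "g_complex G M \<xi>" by fact
  show "orbit_rooted G D M \<xi> Ts"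
    using M(2) orbit_rooted_isomorphism[OF K'(1)] unfolding rooted_iso_iff by blast
  show "length Ts = k" using rooted_iso_length[OF M(2)] K'(2) by simp
  show "C = iso_class G M \<xi> Ts"
    unfolding K(2) by (rule iso_class_eqI[OF orbit_rootedD(1,3)[OF K'(1)] M(2)])
qed

lemma SC_nonempty:
  assumes "C \<in> SC G D k"
  shows "C \<noteq> {}"
proof -
  obtain K :: "nat set set" and \<phi> Rs where K: "rooted_complex G D k K \<phi> Rs" "C = iso_class G K \<phi> Rs"
    using assms(1) unfolding SC_def by blast
  have "(K, \<phi>, Rs) \<in> C"
    unfolding K(2) iso_class_iff using K(1) rooted_iso_refl unfolding rooted_complex_iff by blast
  thus ?thesis by blast
qed

lemma representative_in: "C \<noteq> {} \<Longrightarrow> representative C \<in> C"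
  unfolding representative_def by (rule someI_ex) blast

lemma finite_roots:
  assumes "orbit_rooted G D K \<phi> Rs" "finite (carrier G)"
  shows "finite (\<Union>(set Rs))"
proof -
  have "finite R" if "R \<in> set Rs" for R
  proof -
    have "R \<in> orbits G (verts K) \<phi>" by (rule orbit_rootedD(4)[OF assms(1) that])
    then obtain x where x: "R = orbit G \<phi> x" unfolding orbits_def by blast
    have "R = (\<lambda>g. \<phi> g x) ` carrier G" unfolding x orbit_def by blast
    thus ?thesis using assms(2) by simp
  qed
  thus ?thesis by simp
qed

text \<open>Every vertex is joined to a root, and a path has finite length. With finite balls this
  gives countability, without which there would be no models on \<open>nat\<close>.\<close>

lemma verts_eq_balls:
  assumes "orbit_rooted G D K \<phi> Rs" "Rs \<noteq> []"
  shows "verts K = (\<Union>n::nat. ball_verts (real n) K (\<Union>(set Rs)))"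
proof
  show "(\<Union>n::nat. ball_verts (real n) K (\<Union>(set Rs))) \<subseteq> verts K"
    using orbit_rootedD(3)[OF assms(1)] by (intro UN_least ball_verts_subset) blast
  show "verts K \<subseteq> (\<Union>n::nat. ball_verts (real n) K (\<Union>(set Rs)))"
  proof
    fix x assume x: "x \<in> verts K"
    obtain R where R: "R \<in> set Rs" using assms(2) by (cases Rs) auto
    obtain y where y: "y \<in> R" "(x, y) \<in> (adj K)\<^sup>*" using orbit_rootedD(5)[OF assms(1) R x] by blast
    obtain n where "(y, x) \<in> adj K ^^ n"
      using adj_rtrancl_sym[OF y(2)] rtrancl_imp_relpow by blast
    hence "x \<in> ball_verts (real n) K (\<Union>(set Rs))" unfolding ball_verts_def using R y(1) by blast
    thus "x \<in> (\<Union>n::nat. ball_verts (real n) K (\<Union>(set Rs)))" by blast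
  qed
qed

lemma countable_verts:
  assumes "orbit_rooted G D K \<phi> Rs" "Rs \<noteq> []" "finite (carrier G)"
  shows "countable (verts K)"
  unfolding verts_eq_balls[OF assms(1,2)]
  using finite_ball_verts[OF orbit_rootedD(2)[OF assms(1)] finite_roots[OF assms(1,3)]]
  by (intro countable_UN) (auto intro: countable_finite)

text \<open>\<open>SC_dist\<close> speaks of models on \<open>nat\<close> only. The given
  isomorphism of balls is composed with isomorphisms onto two such models, which map balls about the
  roots to balls about the roots.\<close>

lemma SC_dist_le:
  assumes K: "orbit_rooted G D K \<phi> Rs" "countable (verts K)"
    and L: "orbit_rooted G D L \<psi> Ss" "countable (verts L)" and "r > 0"
    and iso: "rooted_iso G (ball_complex r K (\<Union>(set Rs))) \<phi> Rs (ball_complex r L (\<Union>(set Ss))) \<psi> Ss"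
  shows "SC_dist G (iso_class G K \<phi> Rs) (iso_class G L \<psi> Ss) \<le> ennreal (2 powr (- r))"
proof -
  obtain M \<xi> Ts where M: "(M, \<xi>, Ts) \<in> iso_class G K \<phi> Rs"
    by (rule nat_model[OF orbit_rootedD(1)[OF K(1)] K(2)])
  obtain M' \<xi>' Ts' where M': "(M', \<xi>', Ts') \<in> iso_class G L \<psi> Ss"
    by (rule nat_model[OF orbit_rootedD(1)[OF L(1)] L(2)])
  obtain f where f: "rooted_isomorphism f G K \<phi> Rs M \<xi> Ts"
    using M unfolding iso_class_iff rooted_iso_iff by blast
  obtain f' where f': "rooted_isomorphism f' G L \<psi> Ss M' \<xi>' Ts'"
    using M' unfolding iso_class_iff rooted_iso_iff by blast
  note RM = orbit_rooted_isomorphism[OF K(1) f]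
  have 1: "rooted_iso G (ball_complex r M (\<Union>(set Ts))) \<xi> Ts (ball_complex r K (\<Union>(set Rs))) \<phi> Rs"
    using rooted_isomorphism_ball_complex[OF orbit_rootedD(1,3)[OF RM]
        rooted_isomorphism_sym[OF orbit_rootedD(1,3)[OF K(1)] f]]
    unfolding rooted_iso_iff by blast
  have 2: "rooted_iso G (ball_complex r L (\<Union>(set Ss))) \<psi> Ss (ball_complex r M' (\<Union>(set Ts'))) \<xi>' Ts'"
    using rooted_isomorphism_ball_complex[OF orbit_rootedD(1,3)[OF L(1)] f'] unfolding rooted_iso_iff by blast
  have 3: "rooted_iso G (ball_complex r M (\<Union>(set Ts))) \<xi> Ts (ball_complex r M' (\<Union>(set Ts'))) \<xi>' Ts'"
    using rooted_iso_trans[OF rooted_iso_trans[OF 1 iso] 2] .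
  show ?thesis
    unfolding SC_dist_def by (rule Inf_lower) (use M M' 3 assms(5) in blast)
qed

lemma SC_dist_lessE:
  assumes "SC_dist G C C' < e"
  obtains r K \<phi> Rs L \<psi> Ss where "r > 0" "ennreal (2 powr (- r)) < e" "(K, \<phi>, Rs) \<in> C" "(L, \<psi>, Ss) \<in> C'"
    "rooted_iso G (ball_complex r K (\<Union>(set Rs))) \<phi> Rs (ball_complex r L (\<Union>(set Ss))) \<psi> Ss"
  using assms unfolding SC_dist_def Inf_less_iff by auto

section \<open>The Borel structure of the space of classes\<close>

text \<open>Needed for pointwise limits, where the limit map is known to agree with an isomorphism
  only on the vertices of a ball.\<close>

lemma rooted_isomorphism_cong:
  assumes f: "rooted_isomorphism f G K \<phi> Rs L \<psi> Ss" and "simplicial_action G K \<phi>"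
    and "\<forall>R\<in>set Rs. R \<subseteq> verts K" and eq: "\<And>x. x \<in> verts K \<Longrightarrow> f x = g x"
  shows "rooted_isomorphism g G K \<phi> Rs L \<psi> Ss"
proof (rule rooted_isomorphismI)
  note fD = rooted_isomorphismD[OF f]
  have img: "g ` A = f ` A" if "A \<subseteq> verts K" for A
    by (rule image_cong[OF refl]) (use that eq in auto)
  show "inj_on g (verts K)" using fD(1) by (simp add: inj_on_def eq)
  show "g ` verts K = verts L" using fD(2) img by simp
  have "(`) g ` K = (`) f ` K"
  proof (rule image_cong[OF refl])
    fix \<sigma> assume "\<sigma> \<in> K"
    thus "g ` \<sigma> = f ` \<sigma>" by (intro img) (auto intro: verts_insert)
  qed
  thus "(`) g ` K = L" using fD(3) by simp
  have "map ((`) g) Rs = map ((`) f) Rs" by (rule map_cong[OF refl]) (use img assms(3) in auto)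
  thus "map ((`) g) Rs = Ss" using fD(4) by simp
  show "g (\<phi> k x) = \<psi> k (g x)" if "k \<in> carrier G" "x \<in> verts K" for k x
    using fD(5)[OF that] eq[OF that(2)] eq[OF simplicial_actionD(5)[OF assms(2) that]] by simp
qed

lemma ball_verts_invariant:
  assumes "simplicial_action G K \<phi>" "g \<in> carrier G"
    and "\<And>x. x \<in> V \<Longrightarrow> \<phi> g x \<in> V" "x \<in> ball_verts r K V"
  shows "\<phi> g x \<in> ball_verts r K V"
proof -
  obtain v n where v: "v \<in> V" "real n \<le> r" "(v, x) \<in> adj K ^^ n"
    using assms(4) unfolding ball_verts_def by blast
  have "(\<phi> g v, \<phi> g x) \<in> adj K ^^ n"
    by (rule relpow_image[of "adj K", OF simplicial_action_adj[OF assms(1,2)] v(3)])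
  thus ?thesis unfolding ball_verts_def using v(1,2) assms(3) by blast
qed

lemma roots_invariant:
  assumes "orbit_rooted G D K \<phi> Rs" "g \<in> carrier G" "x \<in> \<Union>(set Rs)"
  shows "\<phi> g x \<in> \<Union>(set Rs)"
proof -
  obtain R where R: "R \<in> set Rs" "x \<in> R" using assms(3) by blast
  have "R \<in> orbits G (verts K) \<phi>" by (rule orbit_rootedD(4)[OF assms(1) R(1)])
  then obtain y where y: "y \<in> verts K" "R = orbit G \<phi> y" unfolding orbits_def by blast
  have "\<phi> g x \<in> R"
    using orbit_closed[OF orbit_rootedD(1)[OF assms(1)] y(1) _ assms(2)] R(2) y(2) by simp
  thus ?thesis using R(1) by blast
qed

lemma roots_nonempty:
  assumes "orbit_rooted G D K \<phi> Rs" "Rs \<noteq> []"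
  shows "\<Union>(set Rs) \<noteq> {}"
proof -
  obtain R where R: "R \<in> set Rs" using assms(2) by (cases Rs) auto
  have "R \<in> orbits G (verts K) \<phi>" by (rule orbit_rootedD(4)[OF assms(1) R(1)])
  then obtain y where y: "y \<in> verts K" "R = orbit G \<phi> y" unfolding orbits_def by blast
  hence "y \<in> R" using orbit_self[OF orbit_rootedD(1)[OF assms(1)]] by simp
  thus ?thesis using R by blast
qed

lemma simplicial_action_ball:
  assumes K: "orbit_rooted G D K \<phi> Rs" and "Rs \<noteq> []" "r \<ge> 0"
  defines "B \<equiv> ball_complex r K (\<Union>(set Rs))"
  shows "simplicial_action G B \<phi>" "\<forall>R\<in>set Rs. R \<subseteq> verts B" "verts B = ball_verts r K (\<Union>(set Rs))"
proof -
  note KD = orbit_rootedD[OF K]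
  have sub: "\<Union>(set Rs) \<subseteq> verts K" using KD(3) by blast
  note W = ball_verts_subset[OF sub, of r] and C = ball_verts_center[OF assms(3), of "\<Union>(set Rs)" K]
  show v: "verts B = ball_verts r K (\<Union>(set Rs))"
    unfolding B_def ball_complex_eq by (rule verts_full[OF simplicial_actionD(1)[OF KD(1)] W])
  show "\<forall>R\<in>set Rs. R \<subseteq> verts B" unfolding v using C by blast
  show "simplicial_action G B \<phi>"
    unfolding B_def ball_complex_eq
  proof (rule simplicial_action_full[OF KD(1) W])
    show "ball_verts r K (\<Union>(set Rs)) \<noteq> {}" using C roots_nonempty[OF K assms(2)] by blast
    show "\<phi> g x \<in> ball_verts r K (\<Union>(set Rs))"
      if "g \<in> carrier G" "x \<in> ball_verts r K (\<Union>(set Rs))" for g x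
      by (rule ball_verts_invariant[OF KD(1) that(1) roots_invariant[OF K that(1)] that(2)])
  qed
qed

text \<open>An isomorphism of balls maps roots to roots and so preserves the distance to them; the
  smaller ball is recovered from the larger one as a ball about the same roots.\<close>

lemma ball_isomorphism_mono:
  assumes K: "orbit_rooted G D K \<phi> Rs" and "Rs \<noteq> []" "0 \<le> r" "r \<le> s"
    and f: "rooted_isomorphism f G (ball_complex s K (\<Union>(set Rs))) \<phi> Rs
              (ball_complex s L (\<Union>(set Ss))) \<psi> Ss"
  shows "rooted_isomorphism f G (ball_complex r K (\<Union>(set Rs))) \<phi> Rs
           (ball_complex r L (\<Union>(set Ss))) \<psi> Ss"
proof -
  have s: "0 \<le> s" using assms(3,4) by simp
  show ?thesis
    using rooted_isomorphism_ball_complex[OF simplicial_action_ball(1,2)[OF K assms(2) s] f, of r]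
    unfolding ball_complex_ball_complex[OF assms(4)] .
qed

text \<open>Compactness: since the balls are finite, a diagonal subsequence of isomorphisms of the balls
  converges pointwise.\<close>

lemma rooted_iso_of_balls:
  fixes K :: "nat set set"
  assumes K: "orbit_rooted G D K \<phi> Rs" and L: "orbit_rooted G D' L \<psi> Ss"
    and "Rs \<noteq> []" "Ss \<noteq> []" and fin: "finite (carrier G)"
    and iso: "\<And>n::nat. rooted_iso G (ball_complex (real n) K (\<Union>(set Rs))) \<phi> Rs
                (ball_complex (real n) L (\<Union>(set Ss))) \<psi> Ss"
  shows "rooted_iso G K \<phi> Rs L \<psi> Ss"
proof -
  let ?B = "\<lambda>n::nat. ball_complex (real n) K (\<Union>(set Rs))"
  let ?B' = "\<lambda>n::nat. ball_complex (real n) L (\<Union>(set Ss))"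
  note BK = simplicial_action_ball[OF K assms(3) of_nat_0_le_iff]
  note BL = simplicial_action_ball[OF L assms(4) of_nat_0_le_iff]
  note KD = orbit_rootedD[OF K]
  note LD = orbit_rootedD[OF L]
  note finK = finite_ball_verts[OF KD(2) finite_roots[OF K fin]]
  note finL = finite_ball_verts[OF LD(2) finite_roots[OF L fin]]
  have UK: "verts K = (\<Union>n. verts (?B n))" unfolding BK(3) by (rule verts_eq_balls[OF K assms(3)])
  have UL: "verts L = (\<Union>n. verts (?B' n))" unfolding BL(3) by (rule verts_eq_balls[OF L assms(4)])
  have "\<forall>n. \<exists>f. rooted_isomorphism f G (?B n) \<phi> Rs (?B' n) \<psi> Ss"
    using iso unfolding rooted_iso_iff by blast
  then obtain F where F: "\<And>n. rooted_isomorphism (F n) G (?B n) \<phi> Rs (?B' n) \<psi> Ss" by metis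
  have Fm: "rooted_isomorphism (F n) G (?B m) \<phi> Rs (?B' m) \<psi> Ss" if "m \<le> n" for m n
    by (rule ball_isomorphism_mono[OF K assms(3) _ _ F]) (use that in simp_all)
  \<comment> \<open>The vertices are natural numbers and so index the diagonal argument: along
    \<open>s\<close>, the isomorphisms agree at the vertex \<open>x\<close>.\<close>
  define P where "P x s \<longleftrightarrow> (x \<in> verts K \<longrightarrow> (\<exists>y. \<forall>i. F (s i) x = y))" for x :: nat and s :: "nat \<Rightarrow> nat"
  interpret subseqs P
  proof
    fix x and s :: "nat \<Rightarrow> nat" assume s: "strict_mono s"
    show "\<exists>r. strict_mono r \<and> P x (s \<circ> r)"
    proof (cases "x \<in> verts K")
      case True
      then obtain m where m: "x \<in> verts (?B m)" unfolding UK by blast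
      \<comment> \<open>All values at \<open>x\<close> lie in one finite ball of \<open>L\<close>,
        so infinitely many of the maps share a value.\<close>
      have "F (s i) x \<in> verts (?B' m)" if "i \<ge> m" for i
      proof -
        have "m \<le> s i" using that seq_suble[OF s, of i] by simp
        thus ?thesis using rooted_isomorphismD(2)[OF Fm] m by blast
      qed
      hence "(\<lambda>i. F (s i) x) ` {m..} \<subseteq> verts (?B' m)" by auto
      hence fi: "finite ((\<lambda>i. F (s i) x) ` {m..})"
        using finL[of "real m"] unfolding BL(3) by (rule finite_subset)
      obtain y where y: "infinite ((\<lambda>i. F (s i) x) -` {y} \<inter> {m..})"
        by (rule inf_img_fin_domE'[OF fi infinite_Ici])
      obtain r :: "nat \<Rightarrow> nat" where r: "strict_mono r" "\<forall>n. r n \<in> (\<lambda>i. F (s i) x) -` {y} \<inter> {m..}"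
        using infinite_enumerate[OF y] by blast
      have "F ((s \<circ> r) i) x = y" for i using r(2)[rule_format, of i] by simp
      hence "P x (s \<circ> r)" unfolding P_def by blast
      thus ?thesis using r(1) by blast
    next
      case False
      thus ?thesis unfolding P_def using strict_mono_id by blast
    qed
  qed
  \<comment> \<open>From index \<open>Suc x\<close> on, the diagonal sequence is a subsequence of
    the one chosen for \<open>x\<close>.\<close>
  have "P x (diagseq \<circ> (+) (Suc x))" for x
    by (rule diagseq_holds) (auto simp: P_def)
  hence ex: "\<exists>y. \<forall>i. F (diagseq (Suc x + i)) x = y" if "x \<in> verts K" for x
    using that unfolding P_def by simp
  define f where "f x = F (diagseq (Suc x)) x" for x
  have f: "F (diagseq j) x = f x" if "x \<in> verts K" "Suc x \<le> j" for x j
  proof -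
    obtain y where y: "\<And>i. F (diagseq (Suc x + i)) x = y" using ex[OF \<open>x \<in> verts K\<close>] by blast
    from y[of "j - Suc x"] y[of 0] show ?thesis using that(2) by (simp add: f_def)
  qed
  have fm: "rooted_isomorphism f G (?B m) \<phi> Rs (?B' m) \<psi> Ss" for m
  proof -
    have fi: "finite (verts (?B m))" using finK[of "real m"] unfolding BK(3) .
    \<comment> \<open>So late that the chosen map is an isomorphism on the ball of radius
      \<open>m\<close> and has reached its final value at each of the finitely many vertices
      there.\<close>
    define j where "j = Max (insert m (Suc ` verts (?B m)))"
    have j: "m \<le> j" "\<And>x. x \<in> verts (?B m) \<Longrightarrow> Suc x \<le> j"
      unfolding j_def by (rule Max_ge; use fi in simp)+
    have "m \<le> diagseq j" using j(1) seq_suble[OF subseq_diagseq, of j] by simp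
    note g = Fm[OF this]
    show ?thesis
    proof (rule rooted_isomorphism_cong[OF g BK(1,2)])
      fix x assume x: "x \<in> verts (?B m)"
      hence "x \<in> verts K" unfolding UK by blast
      thus "F (diagseq j) x = f x" using f j(2)[OF x] by blast
    qed
  qed
  \<comment> \<open>A simplex is finite, so one ball contains its vertices, and the ball is a full
    subcomplex.\<close>
  have level: "\<exists>m. \<sigma> \<subseteq> verts (?B m) \<and> \<sigma> \<in> ?B m" if "\<sigma> \<in> K" for \<sigma>
  proof -
    note scD = simplicial_complexD[OF simplicial_actionD(1)[OF KD(1)] that]
    have "\<forall>x\<in>\<sigma>. \<exists>n. x \<in> verts (?B n)" using scD(3) unfolding UK by blast
    then obtain n where n: "\<And>x. x \<in> \<sigma> \<Longrightarrow> x \<in> verts (?B (n x))" by metis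
    define m where "m = Max (n ` \<sigma>)"
    have "x \<in> verts (?B m)" if "x \<in> \<sigma>" for x
    proof -
      have "n x \<le> m" unfolding m_def using scD(1) that by simp
      hence "verts (?B (n x)) \<subseteq> verts (?B m)" unfolding BK(3) by (intro ball_verts_mono) simp
      thus ?thesis using n[OF that] by blast
    qed
    hence "\<sigma> \<subseteq> verts (?B m)" by blast
    moreover from this[unfolded BK(3)] have "\<sigma> \<in> ?B m"
      unfolding ball_complex_eq full_subcomplex_def using that by blast
    ultimately show ?thesis by blast
  qed
  have levelL: "\<exists>m. \<sigma> \<in> ?B' m" if "\<sigma> \<in> L" for \<sigma>
  proof -
    note scD = simplicial_complexD[OF simplicial_actionD(1)[OF LD(1)] that]
    have "\<forall>x\<in>\<sigma>. \<exists>n. x \<in> verts (?B' n)" using scD(3) unfolding UL by blast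
    then obtain n where n: "\<And>x. x \<in> \<sigma> \<Longrightarrow> x \<in> verts (?B' (n x))" by metis
    define m where "m = Max (n ` \<sigma>)"
    have "x \<in> verts (?B' m)" if "x \<in> \<sigma>" for x
    proof -
      have "n x \<le> m" unfolding m_def using scD(1) that by simp
      hence "verts (?B' (n x)) \<subseteq> verts (?B' m)" unfolding BL(3) by (intro ball_verts_mono) simp
      thus ?thesis using n[OF that] by blast
    qed
    hence "\<sigma> \<subseteq> verts (?B' m)" by blast
    from this[unfolded BL(3)] have "\<sigma> \<in> ?B' m"
      unfolding ball_complex_eq full_subcomplex_def using that by blast
    thus ?thesis by blast
  qed
  have "rooted_isomorphism f G K \<phi> Rs L \<psi> Ss"
  proof (rule rooted_isomorphismI)
    show "inj_on f (verts K)"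
    proof (rule inj_onI)
      fix x y assume xy: "x \<in> verts K" "y \<in> verts K" "f x = f y"
      then obtain m n where "x \<in> verts (?B m)" "y \<in> verts (?B n)" unfolding UK by blast
      moreover have "verts (?B m) \<subseteq> verts (?B (max m n))" "verts (?B n) \<subseteq> verts (?B (max m n))"
        unfolding BK(3) by (intro ball_verts_mono; simp)+
      ultimately show "x = y" using inj_onD[OF rooted_isomorphismD(1)[OF fm] xy(3)] by blast
    qed
    have "f ` verts K = (\<Union>m. f ` verts (?B m))" unfolding UK by (rule image_UN)
    also have "\<dots> = (\<Union>m. verts (?B' m))" using rooted_isomorphismD(2)[OF fm] by simp
    finally show "f ` verts K = verts L" unfolding UL .
    show "(`) f ` K = L"
    proof
      show "(`) f ` K \<subseteq> L"
      proof
        fix \<tau> assume "\<tau> \<in> (`) f ` K"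
        then obtain \<sigma> where \<sigma>: "\<sigma> \<in> K" "\<tau> = f ` \<sigma>" by blast
        then obtain m where "\<sigma> \<in> ?B m" using level by blast
        hence "\<tau> \<in> ?B' m" using rooted_isomorphismD(3)[OF fm, of m] \<sigma>(2) by blast
        thus "\<tau> \<in> L" unfolding ball_complex_eq full_subcomplex_def by blast
      qed
      show "L \<subseteq> (`) f ` K"
      proof
        fix \<tau> assume "\<tau> \<in> L"
        then obtain m where "\<tau> \<in> ?B' m" using levelL by blast
        then obtain \<sigma> where "\<sigma> \<in> ?B m" "\<tau> = f ` \<sigma>"
          using rooted_isomorphismD(3)[OF fm, of m] by blast
        thus "\<tau> \<in> (`) f ` K" unfolding ball_complex_eq full_subcomplex_def by blast
      qed
    qed
    show "map ((`) f) Rs = Ss" by (rule rooted_isomorphismD(4)[OF fm[of 0]])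
    show "f (\<phi> g x) = \<psi> g (f x)" if "g \<in> carrier G" "x \<in> verts K" for g x
    proof -
      obtain m where "x \<in> verts (?B m)" using \<open>x \<in> verts K\<close> unfolding UK by blast
      thus ?thesis using rooted_isomorphismD(5)[OF fm[of m] that(1)] by blast
    qed
  qed
  thus ?thesis unfolding rooted_iso_iff by blast
qed

section \<open>Open sets, Borel sets and single classes\<close>

lemma openin_borel: "openin T U \<Longrightarrow> U \<in> sets (borel_of_topology T)"
  unfolding borel_of_topology_def using openin_subset by (subst sets_measure_of) auto

lemma space_borel_of_topology [simp]: "space (borel_of_topology T) = topspace T"
  unfolding borel_of_topology_def by (rule space_measure_of) (auto dest: openin_subset)

lemma topspace_SC_topology [simp]: "topspace (SC_topology G D k) = SC G D k"
proof
  show "topspace (SC_topology G D k) \<subseteq> SC G D k"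
    using openin_topspace[of "SC_topology G D k"] unfolding SC_topology_def openin_emetric_topology by blast
  have "openin (SC_topology G D k) (SC G D k)"
    unfolding SC_topology_def openin_emetric_topology using zero_less_one by blast
  thus "SC G D k \<subseteq> topspace (SC_topology G D k)" by (rule openin_subset)
qed

lemma continuous_borel_measurable:
  fixes f :: "'a \<Rightarrow> real"
  assumes "continuous_map T euclideanreal f"
  shows "f \<in> borel_measurable (borel_of_topology T)"
proof (rule borel_measurableI)
  fix S :: "real set" assume "open S"
  hence "openin T {x \<in> topspace T. f x \<in> S}"
    using openin_continuous_map_preimage[OF assms] by simp
  moreover have "{x \<in> topspace T. f x \<in> S} = f -` S \<inter> space (borel_of_topology T)" by auto
  ultimately show "f -` S \<inter> space (borel_of_topology T) \<in> sets (borel_of_topology T)"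
    using openin_borel by metis
qed

definition ball_nbhd :: "('g, 'b) monoid_scheme \<Rightarrow> real \<Rightarrow> nat \<Rightarrow> real \<Rightarrow> 'g model \<Rightarrow> 'g model set set" where
  "ball_nbhd G D k r = (\<lambda>(K, \<phi>, Rs). {C \<in> SC G D k. \<exists>(L, \<psi>, Ss)\<in>C.
     rooted_iso G (ball_complex r K (\<Union>(set Rs))) \<phi> Rs (ball_complex r L (\<Union>(set Ss))) \<psi> Ss})"

lemma ball_nbhd_iff:
  "C \<in> ball_nbhd G D k r (K, \<phi>, Rs) \<longleftrightarrow> C \<in> SC G D k \<and> (\<exists>L \<psi> Ss. (L, \<psi>, Ss) \<in> C \<and>
     rooted_iso G (ball_complex r K (\<Union>(set Rs))) \<phi> Rs (ball_complex r L (\<Union>(set Ss))) \<psi> Ss)"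
  unfolding ball_nbhd_def by auto

text \<open>A distance below \<open>2 powr (- r)\<close> is witnessed by isomorphic balls of a
  radius larger than \<open>r\<close>, and these restrict to radius \<open>r\<close>.\<close>

lemma openin_ball_nbhd:
  assumes "r > 0" "k > 0"
  shows "openin (SC_topology G D k) (ball_nbhd G D k r X)"
proof -
  obtain K \<phi> Rs where X: "X = (K, \<phi>, Rs)" by (cases X)
  have "\<exists>e>0. \<forall>C'\<in>SC G D k. SC_dist G C C' < e \<longrightarrow> C' \<in> ball_nbhd G D k r X"
    if CU: "C \<in> ball_nbhd G D k r X" for C
  proof (intro exI[of _ "ennreal (2 powr (- r))"] conjI ballI impI)
    fix C' assume C': "C' \<in> SC G D k" "SC_dist G C C' < ennreal (2 powr (- r))"
    obtain L \<psi> Ss where L: "C \<in> SC G D k" "(L, \<psi>, Ss) \<in> C"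
      "rooted_iso G (ball_complex r K (\<Union>(set Rs))) \<phi> Rs (ball_complex r L (\<Union>(set Ss))) \<psi> Ss"
      using CU unfolding X ball_nbhd_iff by blast
    obtain s M \<xi> Ts M' \<xi>' Ts' where s: "s > 0" "ennreal (2 powr (- s)) < ennreal (2 powr (- r))"
      and M: "(M, \<xi>, Ts) \<in> C" and M': "(M', \<xi>', Ts') \<in> C'"
      and iso: "rooted_iso G (ball_complex s M (\<Union>(set Ts))) \<xi> Ts (ball_complex s M' (\<Union>(set Ts'))) \<xi>' Ts'"
      by (rule SC_dist_lessE[OF C'(2)])
    have "2 powr (- s) < 2 powr (- r)" using s(2) by (simp add: ennreal_less_iff)
    hence rs: "r \<le> s" by simp
    note MD = SC_model[OF L(1) M]
    note LD = SC_model[OF L(1,2)]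
    have "Ts \<noteq> []" using MD(3) assms(2) by auto
    hence 1: "rooted_iso G (ball_complex r M (\<Union>(set Ts))) \<xi> Ts (ball_complex r M' (\<Union>(set Ts'))) \<xi>' Ts'"
      using iso ball_isomorphism_mono[OF MD(2) _ _ rs] assms(1) unfolding rooted_iso_iff by fastforce
    have "(M, \<xi>, Ts) \<in> iso_class G L \<psi> Ss" using M LD(4) by simp
    then obtain f where f: "rooted_isomorphism f G L \<psi> Ss M \<xi> Ts"
      unfolding iso_class_iff rooted_iso_iff by blast
    hence 2: "rooted_iso G (ball_complex r L (\<Union>(set Ss))) \<psi> Ss (ball_complex r M (\<Union>(set Ts))) \<xi> Ts"
      using rooted_isomorphism_ball_complex[OF orbit_rootedD(1,3)[OF LD(2)] f] unfolding rooted_iso_iff by blast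
    have "rooted_iso G (ball_complex r K (\<Union>(set Rs))) \<phi> Rs (ball_complex r M' (\<Union>(set Ts'))) \<xi>' Ts'"
      by (rule rooted_iso_trans[OF L(3) rooted_iso_trans[OF 2 1]])
    thus "C' \<in> ball_nbhd G D k r X" unfolding X ball_nbhd_iff using C'(1) M' by blast
  qed simp
  moreover have "ball_nbhd G D k r X \<subseteq> SC G D k" unfolding X using ball_nbhd_iff[of _ G D k r K \<phi> Rs] by blast
  ultimately show ?thesis unfolding SC_topology_def openin_emetric_topology by blast
qed

lemma singleton_SC_borel:
  assumes "C \<in> SC G D k" "k > 0" "finite (carrier G)"
  shows "{C} \<in> sets (SC_borel G D k)"
proof -
  obtain K \<phi> Rs where K: "(K, \<phi>, Rs) \<in> C" using SC_nonempty[OF assms(1)] by auto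
  note KD = SC_model[OF assms(1) K]
  have Rs: "Rs \<noteq> []" using KD(3) assms(2) by auto
  \<comment> \<open>The radii start at 1 because openness was obtained for positive radii; radius 0
    follows by restriction.\<close>
  have "(\<Inter>n::nat. ball_nbhd G D k (real (Suc n)) (K, \<phi>, Rs)) = {C}"
  proof
    show "{C} \<subseteq> (\<Inter>n::nat. ball_nbhd G D k (real (Suc n)) (K, \<phi>, Rs))"
      unfolding INT_iff subset_iff singleton_iff ball_nbhd_iff using assms(1) K rooted_iso_refl by fast
    show "(\<Inter>n::nat. ball_nbhd G D k (real (Suc n)) (K, \<phi>, Rs)) \<subseteq> {C}"
    proof
      fix C' assume C': "C' \<in> (\<Inter>n::nat. ball_nbhd G D k (real (Suc n)) (K, \<phi>, Rs))"
      hence S: "C' \<in> SC G D k" unfolding INT_iff ball_nbhd_iff by blast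
      obtain L \<psi> Ss where L: "(L, \<psi>, Ss) \<in> C'" using SC_nonempty[OF S] by auto
      note LD = SC_model[OF S L]
      have Ss: "Ss \<noteq> []" using LD(3) assms(2) by auto
      have "rooted_iso G (ball_complex (real n) K (\<Union>(set Rs))) \<phi> Rs
              (ball_complex (real n) L (\<Union>(set Ss))) \<psi> Ss" for n :: nat
      proof -
        \<comment> \<open>The member of \<open>C'\<close> provided here changes with the radius. It
          is replaced by the fixed model \<open>L\<close>, as the compactness argument needs a
          single target.\<close>
        obtain M \<xi> Ts where M: "(M, \<xi>, Ts) \<in> C'"
          "rooted_iso G (ball_complex (real (Suc n)) K (\<Union>(set Rs))) \<phi> Rs
             (ball_complex (real (Suc n)) M (\<Union>(set Ts))) \<xi> Ts"
          using C' unfolding INT_iff ball_nbhd_iff by blast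
        note MD = SC_model[OF S M(1)]
        have "rooted_iso G (ball_complex (real n) K (\<Union>(set Rs))) \<phi> Rs
              (ball_complex (real n) M (\<Union>(set Ts))) \<xi> Ts"
          using M(2) ball_isomorphism_mono[OF KD(2) Rs, of "real n" "real (Suc n)"]
          unfolding rooted_iso_iff by fastforce
        moreover have "(L, \<psi>, Ss) \<in> iso_class G M \<xi> Ts" using L MD(4) by simp
        then obtain f where f: "rooted_isomorphism f G M \<xi> Ts L \<psi> Ss"
          unfolding iso_class_iff rooted_iso_iff by blast
        hence "rooted_iso G (ball_complex (real n) M (\<Union>(set Ts))) \<xi> Ts
                 (ball_complex (real n) L (\<Union>(set Ss))) \<psi> Ss"
          using rooted_isomorphism_ball_complex[OF orbit_rootedD(1,3)[OF MD(2)] f]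
          unfolding rooted_iso_iff by blast
        ultimately show ?thesis by (rule rooted_iso_trans)
      qed
      hence "rooted_iso G K \<phi> Rs L \<psi> Ss"
        by (rule rooted_iso_of_balls[OF KD(2) LD(2) Rs Ss assms(3)])
      hence "iso_class G K \<phi> Rs = iso_class G L \<psi> Ss"
        by (rule iso_class_eqI[OF orbit_rootedD(1,3)[OF KD(2)]])
      thus "C' \<in> {C}" using KD(4) LD(4) by simp
    qed
  qed
  moreover have "(\<Inter>n::nat. ball_nbhd G D k (real (Suc n)) (K, \<phi>, Rs)) \<in> sets (SC_borel G D k)"
  proof -
    have "ball_nbhd G D k (real (Suc n)) (K, \<phi>, Rs) \<in> sets (SC_borel G D k)" for n
      by (rule openin_borel[OF openin_ball_nbhd]) (use assms(2) in simp_all)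
    hence "range (\<lambda>n. ball_nbhd G D k (real (Suc n)) (K, \<phi>, Rs)) \<subseteq> sets (SC_borel G D k)" by blast
    thus ?thesis by (intro sets.countable_INT UNIV_not_empty)
  qed
  ultimately show ?thesis by simp
qed

text \<open>The distribution is concentrated on finitely many measurable points, so that every function
  agrees almost everywhere with a simple one.\<close>

lemma nn_integral_distr_point_measure:
  assumes "finite F" "c \<in> F \<rightarrow> space N" "\<And>x. x \<in> F \<Longrightarrow> {c x} \<in> sets N"
  shows "(\<integral>\<^sup>+ y. g y \<partial>distr (point_measure F w) N c) = (\<Sum>x\<in>F. w x * g (c x))"
proof -
  have m[measurable]: "c \<in> measurable (point_measure F w) N"
    using assms(2) by (simp add: measurable_point_measure_eq1)
  have cF: "c ` F \<in> sets N"
  proof -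
    have "(\<Union>x\<in>F. {c x}) \<in> sets N" using assms(1,3) by (intro sets.finite_UN) auto
    moreover have "(\<Union>x\<in>F. {c x}) = c ` F" by auto
    ultimately show ?thesis by simp
  qed
  define g' where "g' y = (\<Sum>s\<in>c ` F. g s * indicator {s} y)" for y
  have g'm: "g' \<in> borel_measurable N"
    unfolding g'_def using assms(3) by (intro borel_measurable_sum borel_measurable_times) auto
  have g'c: "g' y = g y" if "y \<in> c ` F" for y
  proof -
    have "g' y = (\<Sum>s\<in>c ` F. if s = y then g s else 0)"
      unfolding g'_def by (rule sum.cong) (auto simp: indicator_def)
    thus ?thesis using that assms(1) by simp
  qed
  have "{y \<in> space N. y \<in> c ` F} = c ` F" using assms(2) by auto
  hence "AE y in distr (point_measure F w) N c. y \<in> c ` F"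
    using cF by (subst AE_distr_iff) (auto simp: AE_point_measure)
  hence "(\<integral>\<^sup>+ y. g y \<partial>distr (point_measure F w) N c) = (\<integral>\<^sup>+ y. g' y \<partial>distr (point_measure F w) N c)"
    by (intro nn_integral_cong_AE) (auto simp: g'c)
  also have "\<dots> = (\<integral>\<^sup>+ x. g' (c x) \<partial>point_measure F w)"
    by (rule nn_integral_distr[OF m]) (use g'm in simp)
  also have "\<dots> = (\<Sum>x\<in>F. w x * g' (c x))" by (rule nn_integral_point_measure_finite[OF assms(1)])
  also have "\<dots> = (\<Sum>x\<in>F. w x * g (c x))" by (rule sum.cong) (auto simp: g'c)
  finally show ?thesis .
qed

section \<open>Induction\<close>

text \<open>This one operation produces the induced root and, for \<open>R = verts L\<close>, the
  whole vertex set of the induced complex; the same holds for balls.\<close>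

definition ind_root :: "('g, 'b) monoid_scheme \<Rightarrow> 'g set \<Rightarrow> ('g \<Rightarrow> 'y \<Rightarrow> 'y) \<Rightarrow> 'y set \<Rightarrow> ('g \<times> 'y) set set" where
  "ind_root G H \<phi> R = {ind_pt G H \<phi> g x | g x. g \<in> carrier G \<and> x \<in> R}"

lemma Union_map_ind_root: "\<Union>(set (map (ind_root G H \<phi>) Rs)) = ind_root G H \<phi> (\<Union>(set Rs))"
  unfolding ind_root_def by auto

lemma ind_rootI: "g \<in> carrier G \<Longrightarrow> x \<in> R \<Longrightarrow> ind_pt G H \<phi> g x \<in> ind_root G H \<phi> R"
  unfolding ind_root_def by blast

lemma ind_complexI: "g \<in> carrier G \<Longrightarrow> \<sigma> \<in> L \<Longrightarrow> ind_pt G H \<phi> g ` \<sigma> \<in> ind_complex G H L \<phi>"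
  unfolding ind_complex_def by blast

lemma verts_ind_complex: "verts (ind_complex G H L \<phi>) = ind_root G H \<phi> (verts L)"
  unfolding ind_complex_def ind_root_def verts_def by blast

locale subgroup_induction = group G for G (structure) +
  fixes H :: "'a set"
  assumes subgroup: "subgroup H G"
begin

abbreviation "GH \<equiv> G\<lparr>carrier := H\<rparr>"

lemma H_carrier: "h \<in> H \<Longrightarrow> h \<in> carrier G"
  using subgroup.mem_carrier[OF subgroup] .

lemmas H_closed = subgroup.m_closed[OF subgroup] subgroup.m_inv_closed[OF subgroup]
  subgroup.one_closed[OF subgroup]

lemma action:
  assumes "simplicial_action GH L \<phi>" "x \<in> verts L"
  shows "h \<in> H \<Longrightarrow> \<phi> h x \<in> verts L" "\<phi> \<one> x = x"
    and "h \<in> H \<Longrightarrow> k \<in> H \<Longrightarrow> \<phi> (h \<otimes> k) x = \<phi> h (\<phi> k x)"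
    and "h \<in> H \<Longrightarrow> \<phi> (inv h) (\<phi> h x) = x" "h \<in> H \<Longrightarrow> \<phi> h (\<phi> (inv h) x) = x"
proof -
  show "h \<in> H \<Longrightarrow> \<phi> h x \<in> verts L" "\<phi> \<one> x = x"
    "h \<in> H \<Longrightarrow> k \<in> H \<Longrightarrow> \<phi> (h \<otimes> k) x = \<phi> h (\<phi> k x)"
    using simplicial_actionD(3,4,5)[OF assms(1)] assms(2) by simp_all
  have "inv\<^bsub>GH\<^esub> h = inv h" if "h \<in> H" using m_inv_consistent[OF subgroup that] .
  thus "h \<in> H \<Longrightarrow> \<phi> (inv h) (\<phi> h x) = x" "h \<in> H \<Longrightarrow> \<phi> h (\<phi> (inv h) x) = x"
    using simplicial_action_inv[OF assms(1) _ assms(2), of h] by simp_all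
qed

lemma ind_pt_self:
  assumes "simplicial_action GH L \<phi>" "x \<in> verts L" "g \<in> carrier G"
  shows "(g, x) \<in> ind_pt G H \<phi> g x"
  unfolding ind_pt_def using H_closed(3) action(2)[OF assms(1,2)] assms(3) by force

text \<open>The identification that defines the induced set, in the form in which it is applied:
  replacing the running element \<open>k\<close> of \<open>H\<close> by the product of
  \<open>h\<close> and \<open>k\<close> turns one class into the other.\<close>

lemma ind_pt_shift:
  assumes "simplicial_action GH L \<phi>" "x \<in> verts L" "g \<in> carrier G" "h \<in> H"
  shows "ind_pt G H \<phi> (g \<otimes> h) x = ind_pt G H \<phi> g (\<phi> h x)"
proof
  note hc = H_carrier[OF assms(4)]
  show "ind_pt G H \<phi> (g \<otimes> h) x \<subseteq> ind_pt G H \<phi> g (\<phi> h x)"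
  proof
    fix p assume "p \<in> ind_pt G H \<phi> (g \<otimes> h) x"
    then obtain k where k: "k \<in> H" "p = (g \<otimes> h \<otimes> k, \<phi> (inv k) x)" unfolding ind_pt_def by blast
    have kc: "k \<in> carrier G" by (rule H_carrier[OF k(1)])
    have "\<phi> (inv (h \<otimes> k)) (\<phi> h x) = \<phi> (inv k) x"
      using action(3)[OF assms(1), of "\<phi> h x" "inv k" "inv h"] action(1,4)[OF assms(1,2), of h]
        k(1) kc assms(4) hc H_closed by (simp add: inv_mult_group)
    hence "p = (g \<otimes> (h \<otimes> k), \<phi> (inv (h \<otimes> k)) (\<phi> h x))"
      using k(2) assms(3) hc kc by (simp add: m_assoc)
    moreover have "h \<otimes> k \<in> H" using assms(4) k(1) H_closed by simp
    ultimately show "p \<in> ind_pt G H \<phi> g (\<phi> h x)" unfolding ind_pt_def by blast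
  qed
  show "ind_pt G H \<phi> g (\<phi> h x) \<subseteq> ind_pt G H \<phi> (g \<otimes> h) x"
  proof
    fix p assume "p \<in> ind_pt G H \<phi> g (\<phi> h x)"
    then obtain k where k: "k \<in> H" "p = (g \<otimes> k, \<phi> (inv k) (\<phi> h x))" unfolding ind_pt_def by blast
    have kc: "k \<in> carrier G" by (rule H_carrier[OF k(1)])
    have "\<phi> (inv (inv h \<otimes> k)) x = \<phi> (inv k) (\<phi> h x)"
      using action(3)[OF assms(1,2), of "inv k" h] k(1) kc assms(4) hc H_closed by (simp add: inv_mult_group)
    hence "p = (g \<otimes> h \<otimes> (inv h \<otimes> k), \<phi> (inv (inv h \<otimes> k)) x)"
      using k(2) assms(3) hc kc by (simp add: m_assoc[symmetric]) (simp add: m_assoc)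
    moreover have "inv h \<otimes> k \<in> H" using assms(4) k(1) H_closed by simp
    ultimately show "p \<in> ind_pt G H \<phi> (g \<otimes> h) x" unfolding ind_pt_def by blast
  qed
qed

text \<open>No identifications beyond those of \<open>ind_pt_shift\<close> occur, because each class
  contains its own defining pair.\<close>

lemma ind_pt_eqD:
  assumes "simplicial_action GH L \<phi>" "x \<in> verts L" "y \<in> verts L" "g \<in> carrier G" "k \<in> carrier G"
    and "ind_pt G H \<phi> g x = ind_pt G H \<phi> k y"
  obtains h where "h \<in> H" "g = k \<otimes> h" "y = \<phi> h x"
proof -
  have "(g, x) \<in> ind_pt G H \<phi> k y" using ind_pt_self[OF assms(1,2,4)] assms(6) by simp
  then obtain h where h: "h \<in> H" "g = k \<otimes> h" "x = \<phi> (inv h) y" unfolding ind_pt_def by blast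
  have "y = \<phi> h x" using action(5)[OF assms(1,3) h(1)] h(3) by simp
  thus thesis by (rule that[OF h(1,2)])
qed

lemma ind_pt_inj:
  assumes L: "simplicial_action GH L \<phi>" and "g \<in> carrier G"
  shows "inj_on (ind_pt G H \<phi> g) (verts L)"
proof (rule inj_onI)
  fix x y assume xy: "x \<in> verts L" "y \<in> verts L" "ind_pt G H \<phi> g x = ind_pt G H \<phi> g y"
  obtain h where h: "h \<in> H" "g = g \<otimes> h" "y = \<phi> h x"
    by (rule ind_pt_eqD[OF L xy(1,2) assms(2,2) xy(3)])
  have "h = \<one>" using h(2) assms(2) H_carrier[OF h(1)] by (metis l_cancel_one' m_closed)
  thus "x = y" using h(3) action(2)[OF L xy(1)] by simp
qed

lemma ind_action_pt:
  assumes "x \<in> verts L" "g \<in> carrier G" "k \<in> carrier G"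
  shows "ind_action G H L \<phi> k (ind_pt G H \<phi> g x) = ind_pt G H \<phi> (k \<otimes> g) x"
proof -
  have "ind_pt G H \<phi> g x \<in> verts (ind_complex G H L \<phi>)"
    unfolding verts_ind_complex by (rule ind_rootI[OF assms(2,1)])
  hence "ind_action G H L \<phi> k (ind_pt G H \<phi> g x) = (\<lambda>(g', y). (k \<otimes> g', y)) ` ind_pt G H \<phi> g x"
    unfolding ind_action_def by simp
  moreover have "ind_pt G H \<phi> g x = (\<lambda>h. (g \<otimes> h, \<phi> (inv h) x)) ` H" unfolding ind_pt_def by blast
  moreover have "(\<lambda>(g', y). (k \<otimes> g', y)) ` (\<lambda>h. (g \<otimes> h, \<phi> (inv h) x)) ` H = (\<lambda>h. (k \<otimes> g \<otimes> h, \<phi> (inv h) x)) ` H"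
    unfolding image_image by (rule image_cong) (use assms(2,3) H_carrier in \<open>simp_all add: m_assoc\<close>)
  moreover have "(\<lambda>h. (k \<otimes> g \<otimes> h, \<phi> (inv h) x)) ` H = ind_pt G H \<phi> (k \<otimes> g) x"
    unfolding ind_pt_def by blast
  ultimately show ?thesis by simp
qed

text \<open>Shifting an element of \<open>H\<close> across rewrites a simplex so that a given vertex
  keeps its own presentation. Hence an induced complex is a disjoint union of copies of
  \<open>L\<close>, and the simplices at the class of \<open>(g, x)\<close> all come from the copy
  that belongs to \<open>g\<close>.\<close>

lemma ind_complexE:
  assumes L: "simplicial_action GH L \<phi>" and "\<tau> \<in> ind_complex G H L \<phi>"
    and "ind_pt G H \<phi> g x \<in> \<tau>" "g \<in> carrier G" "x \<in> verts L"
  obtains \<sigma> where "\<sigma> \<in> L" "x \<in> \<sigma>" "\<tau> = ind_pt G H \<phi> g ` \<sigma>"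
proof -
  obtain k \<sigma> where k: "k \<in> carrier G" "\<sigma> \<in> L" "\<tau> = ind_pt G H \<phi> k ` \<sigma>"
    using assms(2) unfolding ind_complex_def by blast
  then obtain y where y: "y \<in> \<sigma>" "ind_pt G H \<phi> k y = ind_pt G H \<phi> g x" using assms(3) by auto
  have yv: "y \<in> verts L" by (rule verts_insert[OF k(2) y(1)])
  obtain h where h: "h \<in> H" "k = g \<otimes> h" "x = \<phi> h y"
    by (rule ind_pt_eqD[OF L yv assms(5) k(1) assms(4) y(2)])
  have "ind_pt G H \<phi> k z = ind_pt G H \<phi> g (\<phi> h z)" if "z \<in> \<sigma>" for z
    using ind_pt_shift[OF L verts_insert[OF k(2) that] assms(4) h(1)] h(2) by simp
  hence "\<tau> = ind_pt G H \<phi> g ` \<phi> h ` \<sigma>" unfolding k(3) image_image by (rule image_cong[OF refl])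
  moreover have "\<phi> h ` \<sigma> \<in> L" using simplicial_actionD(2)[OF L _ k(2)] h(1) by simp
  moreover have "x \<in> \<phi> h ` \<sigma>" using h(3) y(1) by blast
  ultimately show thesis using that by blast
qed

lemma simplicial_complex_ind:
  assumes L: "simplicial_action GH L \<phi>"
  shows "simplicial_complex (ind_complex G H L \<phi>)"
proof (rule simplicial_complexI)
  note sc = simplicial_actionD(1)[OF L]
  obtain \<sigma> where "\<sigma> \<in> L" using sc unfolding simplicial_complex_def by blast
  thus "ind_complex G H L \<phi> \<noteq> {}" using ind_complexI[OF one_closed] by blast
  fix \<tau> assume "\<tau> \<in> ind_complex G H L \<phi>"
  then obtain k \<sigma> where k: "k \<in> carrier G" "\<sigma> \<in> L" "\<tau> = ind_pt G H \<phi> k ` \<sigma>"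
    unfolding ind_complex_def by blast
  show "finite \<tau> \<and> \<tau> \<noteq> {}" using simplicial_complexD(1,2)[OF sc k(2)] k(3) by simp
  fix \<rho> assume \<rho>: "\<rho> \<noteq> {}" "\<rho> \<subseteq> \<tau>"
  then obtain \<sigma>' where \<sigma>': "\<sigma>' \<subseteq> \<sigma>" "\<rho> = ind_pt G H \<phi> k ` \<sigma>'"
    using subset_image_iff[of \<rho> "ind_pt G H \<phi> k" \<sigma>] k(3) by blast
  hence "\<sigma>' \<in> L" using simplicial_complexD(4)[OF sc k(2) _ \<sigma>'(1)] \<rho>(1) by blast
  thus "\<rho> \<in> ind_complex G H L \<phi>" using ind_complexI[OF k(1)] \<sigma>'(2) by simp
qed

lemma simplicial_action_ind:
  assumes L: "simplicial_action GH L \<phi>"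
  shows "simplicial_action G (ind_complex G H L \<phi>) (ind_action G H L \<phi>)"
proof (rule simplicial_actionI)
  show "group G" by (rule is_group)
  show "simplicial_complex (ind_complex G H L \<phi>)" by (rule simplicial_complex_ind[OF L])
  fix g assume g: "g \<in> carrier G"
  show "ind_action G H L \<phi> g ` \<tau> \<in> ind_complex G H L \<phi>" if "\<tau> \<in> ind_complex G H L \<phi>" for \<tau>
  proof -
    obtain k \<sigma> where k: "k \<in> carrier G" "\<sigma> \<in> L" "\<tau> = ind_pt G H \<phi> k ` \<sigma>"
      using \<open>\<tau> \<in> ind_complex G H L \<phi>\<close> unfolding ind_complex_def by blast
    have "ind_action G H L \<phi> g ` \<tau> = ind_pt G H \<phi> (g \<otimes> k) ` \<sigma>"
      unfolding k(3) image_image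
      by (rule image_cong[OF refl]) (rule ind_action_pt[OF verts_insert[OF k(2)] k(1) g])
    thus ?thesis using ind_complexI[OF m_closed[OF g k(1)] k(2)] by simp
  qed
  fix X assume "X \<in> verts (ind_complex G H L \<phi>)"
  then obtain k x where x: "k \<in> carrier G" "x \<in> verts L" "X = ind_pt G H \<phi> k x"
    unfolding verts_ind_complex ind_root_def by blast
  show "ind_action G H L \<phi> (g \<otimes> h) X = ind_action G H L \<phi> g (ind_action G H L \<phi> h X)"
    if "h \<in> carrier G" for h
    unfolding x(3) using ind_action_pt[OF x(2)] x(1) g that by (simp add: m_assoc)
next
  fix X assume "X \<in> verts (ind_complex G H L \<phi>)"
  then obtain k x where x: "k \<in> carrier G" "x \<in> verts L" "X = ind_pt G H \<phi> k x"
    unfolding verts_ind_complex ind_root_def by blast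
  show "ind_action G H L \<phi> \<one> X = X"
    unfolding x(3) using ind_action_pt[OF x(2,1) one_closed] x(1) by simp
qed

lemma ind_adj:
  assumes L: "simplicial_action GH L \<phi>" and "g \<in> carrier G" "(x, y) \<in> adj L"
  shows "(ind_pt G H \<phi> g x, ind_pt G H \<phi> g y) \<in> adj (ind_complex G H L \<phi>)"
proof -
  have xy: "x \<noteq> y" "{x, y} \<in> L" "x \<in> verts L" "y \<in> verts L"
    using assms(3) adj_verts[OF assms(3)] by (auto simp: adj_def)
  have "ind_pt G H \<phi> g x \<noteq> ind_pt G H \<phi> g y"
    using inj_onD[OF ind_pt_inj[OF L assms(2)] _ xy(3,4)] xy(1) by blast
  moreover have "ind_pt G H \<phi> g ` {x, y} \<in> ind_complex G H L \<phi>" by (rule ind_complexI[OF assms(2) xy(2)])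
  ultimately show ?thesis by (simp add: adj_def)
qed

lemma ind_adjE:
  assumes L: "simplicial_action GH L \<phi>" and "g \<in> carrier G" "x \<in> verts L"
    and "(ind_pt G H \<phi> g x, Y) \<in> adj (ind_complex G H L \<phi>)"
  obtains y where "Y = ind_pt G H \<phi> g y" "(x, y) \<in> adj L"
proof -
  have Y: "{ind_pt G H \<phi> g x, Y} \<in> ind_complex G H L \<phi>" "ind_pt G H \<phi> g x \<noteq> Y"
    using assms(4) by (simp_all add: adj_def)
  obtain \<sigma> where \<sigma>: "\<sigma> \<in> L" "x \<in> \<sigma>" "{ind_pt G H \<phi> g x, Y} = ind_pt G H \<phi> g ` \<sigma>"
    by (rule ind_complexE[OF L Y(1) _ assms(2,3)]) simp
  then obtain y where y: "y \<in> \<sigma>" "Y = ind_pt G H \<phi> g y" by blast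
  have "{x, y} \<in> L"
    by (rule simplicial_complexD(4)[OF simplicial_actionD(1)[OF L] \<sigma>(1)]) (use y \<sigma>(2) in auto)
  thus thesis using that y(2) Y(2) by (auto simp: adj_def)
qed

text \<open>Paths never leave the copy in which they start, so distances in the induced complex are
  distances in \<open>L\<close>.\<close>

lemma ind_relpowE:
  assumes L: "simplicial_action GH L \<phi>" and g: "g \<in> carrier G" and x: "x \<in> verts L"
    and "(ind_pt G H \<phi> g x, Y) \<in> adj (ind_complex G H L \<phi>) ^^ n"
  shows "\<exists>y. Y = ind_pt G H \<phi> g y \<and> (x, y) \<in> adj L ^^ n"
  using assms(4)
proof (induction n arbitrary: Y)
  case (Suc n)
  then obtain Z where Z: "(ind_pt G H \<phi> g x, Z) \<in> adj (ind_complex G H L \<phi>) ^^ n"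
    "(Z, Y) \<in> adj (ind_complex G H L \<phi>)" by auto
  from Suc.IH[OF Z(1)] obtain z where z: "Z = ind_pt G H \<phi> g z" "(x, z) \<in> adj L ^^ n" by blast
  have zv: "z \<in> verts L" by (rule adj_relpow_verts[OF z(2) x])
  obtain y where "Y = ind_pt G H \<phi> g y" "(z, y) \<in> adj L"
    by (rule ind_adjE[OF L g zv Z(2)[unfolded z(1)]])
  thus ?case using z(2) by auto
qed auto

lemma ind_vertex_degree:
  assumes L: "simplicial_action GH L \<phi>"
  shows "vertex_degree (ind_complex G H L \<phi>) \<le> vertex_degree L"
proof (rule vertex_degree_le)
  fix X assume "X \<in> verts (ind_complex G H L \<phi>)"
  then obtain g x where x: "g \<in> carrier G" "x \<in> verts L" "X = ind_pt G H \<phi> g x"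
    unfolding verts_ind_complex ind_root_def by blast
  have "edges_at (ind_complex G H L \<phi>) X \<subseteq> (`) (ind_pt G H \<phi> g) ` edges_at L x"
  proof
    fix \<tau> assume "\<tau> \<in> edges_at (ind_complex G H L \<phi>) X"
    hence \<tau>: "\<tau> \<in> ind_complex G H L \<phi>" "ind_pt G H \<phi> g x \<in> \<tau>" "card \<tau> = 2"
      by (simp_all add: edges_at_def x(3))
    obtain \<sigma> where \<sigma>: "\<sigma> \<in> L" "x \<in> \<sigma>" "\<tau> = ind_pt G H \<phi> g ` \<sigma>"
      by (rule ind_complexE[OF L \<tau>(1,2) x(1,2)])
    have "\<sigma> \<subseteq> verts L" using \<sigma>(1) by (auto intro: verts_insert)
    hence "card \<sigma> = 2" using card_image[OF inj_on_subset[OF ind_pt_inj[OF L x(1)]]] \<tau>(3) \<sigma>(3) by simp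
    thus "\<tau> \<in> (`) (ind_pt G H \<phi> g) ` edges_at L x" using \<sigma> by (auto simp: edges_at_def)
  qed
  thus "\<exists>v\<in>verts L. \<exists>f. edges_at (ind_complex G H L \<phi>) X \<subseteq> f ` edges_at L v" using x(2) by blast
qed

text \<open>This matches the root set used by \<open>ind_class\<close> with the orbit of the class
  of \<open>(\<one>, x)\<close>, which is the root in the usual description of induction; in
  particular it is a single orbit.\<close>

lemma ind_root_orbit:
  assumes L: "simplicial_action GH L \<phi>" and x: "x \<in> verts L"
  shows "ind_root G H \<phi> (orbit GH \<phi> x) = orbit G (ind_action G H L \<phi>) (ind_pt G H \<phi> \<one> x)"
proof -
  have 1: "orbit G (ind_action G H L \<phi>) (ind_pt G H \<phi> \<one> x) = (\<lambda>g. ind_pt G H \<phi> g x) ` carrier G"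
    unfolding orbit_image by (rule image_cong[OF refl]) (simp add: ind_action_pt[OF x one_closed])
  have "ind_root G H \<phi> (orbit GH \<phi> x) \<subseteq> (\<lambda>g. ind_pt G H \<phi> g x) ` carrier G"
  proof
    fix X assume "X \<in> ind_root G H \<phi> (orbit GH \<phi> x)"
    then obtain g h where g: "g \<in> carrier G" "h \<in> H" "X = ind_pt G H \<phi> g (\<phi> h x)"
      unfolding ind_root_def orbit_def by auto
    hence "X = ind_pt G H \<phi> (g \<otimes> h) x" using ind_pt_shift[OF L x g(1,2)] by simp
    moreover have "g \<otimes> h \<in> carrier G" using g(1,2) H_carrier by simp
    ultimately show "X \<in> (\<lambda>g. ind_pt G H \<phi> g x) ` carrier G" by blast
  qed
  moreover have "(\<lambda>g. ind_pt G H \<phi> g x) ` carrier G \<subseteq> ind_root G H \<phi> (orbit GH \<phi> x)"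
    by (rule image_subsetI) (rule ind_rootI[OF _ orbit_self[OF L x]])
  ultimately show ?thesis unfolding 1 by blast
qed

lemma orbit_rooted_ind:
  assumes "orbit_rooted GH D L \<phi> Rs"
  shows "orbit_rooted G D (ind_complex G H L \<phi>) (ind_action G H L \<phi>) (map (ind_root G H \<phi>) Rs)"
  unfolding orbit_rooted_def
proof (intro conjI ballI)
  note LD = orbit_rootedD[OF assms]
  show "simplicial_action G (ind_complex G H L \<phi>) (ind_action G H L \<phi>)"
    by (rule simplicial_action_ind[OF LD(1)])
  show "vertex_degree (ind_complex G H L \<phi>) \<le> ennreal D"
    using ind_vertex_degree[OF LD(1)] LD(2) by order
  fix S assume "S \<in> set (map (ind_root G H \<phi>) Rs)"
  then obtain R where R: "R \<in> set Rs" "S = ind_root G H \<phi> R" by auto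
  have "R \<in> orbits GH (verts L) \<phi>" by (rule LD(4)[OF R(1)])
  then obtain x where x: "x \<in> verts L" "R = orbit GH \<phi> x" unfolding orbits_def by blast
  have "ind_pt G H \<phi> \<one> x \<in> verts (ind_complex G H L \<phi>)"
    unfolding verts_ind_complex by (rule ind_rootI[OF one_closed x(1)])
  thus "S \<in> orbits G (verts (ind_complex G H L \<phi>)) (ind_action G H L \<phi>)"
    unfolding orbits_def R(2) x(2) ind_root_orbit[OF LD(1) x(1)] by blast
  fix X assume "X \<in> verts (ind_complex G H L \<phi>)"
  then obtain g v where v: "g \<in> carrier G" "v \<in> verts L" "X = ind_pt G H \<phi> g v"
    unfolding verts_ind_complex ind_root_def by blast
  obtain y where y: "y \<in> R" "(v, y) \<in> (adj L)\<^sup>*" using LD(5)[OF R(1) v(2)] by blast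
  have "(X, ind_pt G H \<phi> g y) \<in> (adj (ind_complex G H L \<phi>))\<^sup>*"
    unfolding v(3) by (rule rtrancl_image[of "adj L", OF ind_adj[OF LD(1) v(1)] y(2)])
  moreover have "ind_pt G H \<phi> g y \<in> S" unfolding R(2) by (rule ind_rootI[OF v(1) y(1)])
  ultimately show "\<exists>Y\<in>S. (X, Y) \<in> (adj (ind_complex G H L \<phi>))\<^sup>*" by blast
qed

lemma ind_ball_verts:
  assumes L: "simplicial_action GH L \<phi>" and V: "V \<subseteq> verts L"
  shows "ball_verts r (ind_complex G H L \<phi>) (ind_root G H \<phi> V) = ind_root G H \<phi> (ball_verts r L V)"
proof
  show "ball_verts r (ind_complex G H L \<phi>) (ind_root G H \<phi> V) \<subseteq> ind_root G H \<phi> (ball_verts r L V)"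
  proof
    fix Y assume "Y \<in> ball_verts r (ind_complex G H L \<phi>) (ind_root G H \<phi> V)"
    then obtain g v n where v: "g \<in> carrier G" "v \<in> V" "real n \<le> r"
      "(ind_pt G H \<phi> g v, Y) \<in> adj (ind_complex G H L \<phi>) ^^ n"
      unfolding ball_verts_def ind_root_def by blast
    have vv: "v \<in> verts L" using v(2) V by blast
    obtain y where y: "Y = ind_pt G H \<phi> g y" "(v, y) \<in> adj L ^^ n"
      using ind_relpowE[OF L v(1) vv v(4)] by blast
    hence "y \<in> ball_verts r L V" unfolding ball_verts_def using v(2,3) by blast
    thus "Y \<in> ind_root G H \<phi> (ball_verts r L V)" unfolding y(1) by (rule ind_rootI[OF v(1)])
  qed
  show "ind_root G H \<phi> (ball_verts r L V) \<subseteq> ball_verts r (ind_complex G H L \<phi>) (ind_root G H \<phi> V)"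
  proof
    fix Y assume "Y \<in> ind_root G H \<phi> (ball_verts r L V)"
    then obtain g y where y: "g \<in> carrier G" "y \<in> ball_verts r L V" "Y = ind_pt G H \<phi> g y"
      unfolding ind_root_def by blast
    then obtain v n where v: "v \<in> V" "real n \<le> r" "(v, y) \<in> adj L ^^ n" unfolding ball_verts_def by blast
    have "(ind_pt G H \<phi> g v, Y) \<in> adj (ind_complex G H L \<phi>) ^^ n"
      unfolding y(3) by (rule relpow_image[of "adj L", OF ind_adj[OF L y(1)] v(3)])
    thus "Y \<in> ball_verts r (ind_complex G H L \<phi>) (ind_root G H \<phi> V)"
      unfolding ball_verts_def using ind_rootI[OF y(1) v(1)] v(2) by blast
  qed
qed

text \<open>The invariance of \<open>W\<close> under \<open>H\<close> makes membership of a class in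
  the induced vertex set independent of its presentation.\<close>

lemma ind_full_subcomplex:
  assumes L: "simplicial_action GH L \<phi>" and W: "W \<subseteq> verts L"
    and inv: "\<And>h x. h \<in> H \<Longrightarrow> x \<in> W \<Longrightarrow> \<phi> h x \<in> W"
  shows "full_subcomplex (ind_complex G H L \<phi>) (ind_root G H \<phi> W) = ind_complex G H (full_subcomplex L W) \<phi>"
proof
  show "ind_complex G H (full_subcomplex L W) \<phi> \<subseteq> full_subcomplex (ind_complex G H L \<phi>) (ind_root G H \<phi> W)"
    unfolding ind_complex_def full_subcomplex_def ind_root_def by blast
  show "full_subcomplex (ind_complex G H L \<phi>) (ind_root G H \<phi> W) \<subseteq> ind_complex G H (full_subcomplex L W) \<phi>"
  proof
    fix \<tau> assume "\<tau> \<in> full_subcomplex (ind_complex G H L \<phi>) (ind_root G H \<phi> W)"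
    hence \<tau>: "\<tau> \<in> ind_complex G H L \<phi>" "\<tau> \<subseteq> ind_root G H \<phi> W" unfolding full_subcomplex_def by blast+
    then obtain g \<sigma> where g: "g \<in> carrier G" "\<sigma> \<in> L" "\<tau> = ind_pt G H \<phi> g ` \<sigma>"
      unfolding ind_complex_def by blast
    have "y \<in> W" if "y \<in> \<sigma>" for y
    proof -
      have "ind_pt G H \<phi> g y \<in> ind_root G H \<phi> W" using \<tau>(2) g(3) \<open>y \<in> \<sigma>\<close> by blast
      then obtain k w where w: "k \<in> carrier G" "w \<in> W" "ind_pt G H \<phi> k w = ind_pt G H \<phi> g y"
        unfolding ind_root_def by force
      have wv: "w \<in> verts L" using w(2) W by blast
      obtain h where "h \<in> H" "k = g \<otimes> h" "y = \<phi> h w"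
        by (rule ind_pt_eqD[OF L wv verts_insert[OF g(2) \<open>y \<in> \<sigma>\<close>] w(1) g(1) w(3)])
      thus ?thesis using inv w(2) by blast
    qed
    hence "\<sigma> \<in> full_subcomplex L W" unfolding full_subcomplex_def using g(2) by blast
    thus "\<tau> \<in> ind_complex G H (full_subcomplex L W) \<phi>" unfolding g(3) by (rule ind_complexI[OF g(1)])
  qed
qed

lemma ind_ball_complex:
  assumes L: "simplicial_action GH L \<phi>" and V: "V \<subseteq> verts L"
    and inv: "\<And>h x. h \<in> H \<Longrightarrow> x \<in> V \<Longrightarrow> \<phi> h x \<in> V"
  shows "ball_complex r (ind_complex G H L \<phi>) (ind_root G H \<phi> V) = ind_complex G H (ball_complex r L V) \<phi>"
  unfolding ball_complex_eq ind_ball_verts[OF L V]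
proof (rule ind_full_subcomplex[OF L ball_verts_subset[OF V]])
  fix h x assume "h \<in> H" "x \<in> ball_verts r L V"
  thus "\<phi> h x \<in> ball_verts r L V" using ball_verts_invariant[OF L _ inv] by simp
qed

text \<open>Applying \<open>f\<close> to the second entries of all pairs in a class gives a class
  again, by equivariance. So induction is functorial, which is what makes it well defined on
  isomorphism classes.\<close>

lemma ind_isomorphism:
  assumes L: "simplicial_action GH L \<phi>" and Rs: "\<forall>R\<in>set Rs. R \<subseteq> verts L"
    and f: "rooted_isomorphism f GH L \<phi> Rs M \<psi> Ss"
  shows "rooted_isomorphism ((`) (\<lambda>(g, y). (g, f y))) G
     (ind_complex G H L \<phi>) (ind_action G H L \<phi>) (map (ind_root G H \<phi>) Rs)
     (ind_complex G H M \<psi>) (ind_action G H M \<psi>) (map (ind_root G H \<psi>) Ss)"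
    (is "rooted_isomorphism ?F G _ _ _ _ _ _")
proof (rule rooted_isomorphismI)
  note fD = rooted_isomorphismD[OF f]
  note M = rooted_isomorphism_action[OF L f]
  have fv: "f x \<in> verts M" if "x \<in> verts L" for x using fD(2) that by blast
  have F: "?F (ind_pt G H \<phi> g x) = ind_pt G H \<psi> g (f x)" if "x \<in> verts L" for g x
  proof -
    have "?F (ind_pt G H \<phi> g x) = (\<lambda>h. (g \<otimes> h, f (\<phi> (inv h) x))) ` H"
      unfolding ind_pt_def by auto
    also have "\<dots> = (\<lambda>h. (g \<otimes> h, \<psi> (inv h) (f x))) ` H"
      by (rule image_cong[OF refl]) (use fD(5)[OF _ that] H_closed in simp)
    also have "\<dots> = ind_pt G H \<psi> g (f x)" unfolding ind_pt_def by blast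
    finally show ?thesis .
  qed
  have root: "?F ` ind_root G H \<phi> R = ind_root G H \<psi> (f ` R)" if "R \<subseteq> verts L" for R
  proof
    show "?F ` ind_root G H \<phi> R \<subseteq> ind_root G H \<psi> (f ` R)"
    proof
      fix Y assume "Y \<in> ?F ` ind_root G H \<phi> R"
      then obtain g x where x: "g \<in> carrier G" "x \<in> R" "Y = ?F (ind_pt G H \<phi> g x)"
        unfolding ind_root_def by blast
      have xv: "x \<in> verts L" using x(2) \<open>R \<subseteq> verts L\<close> by blast
      show "Y \<in> ind_root G H \<psi> (f ` R)" unfolding x(3) F[OF xv] by (intro ind_rootI x imageI)
    qed
    show "ind_root G H \<psi> (f ` R) \<subseteq> ?F ` ind_root G H \<phi> R"
    proof
      fix Y assume "Y \<in> ind_root G H \<psi> (f ` R)"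
      then obtain g x where x: "g \<in> carrier G" "x \<in> R" "Y = ind_pt G H \<psi> g (f x)"
        unfolding ind_root_def by blast
      have "x \<in> verts L" using x(2) \<open>R \<subseteq> verts L\<close> by blast
      hence "Y = ?F (ind_pt G H \<phi> g x)" unfolding x(3) by (rule F[symmetric])
      thus "Y \<in> ?F ` ind_root G H \<phi> R" using ind_rootI[OF x(1,2)] by blast
    qed
  qed
  show "?F ` verts (ind_complex G H L \<phi>) = verts (ind_complex G H M \<psi>)"
    unfolding verts_ind_complex root[OF subset_refl] fD(2) ..
  show "inj_on ?F (verts (ind_complex G H L \<phi>))"
  proof (rule inj_onI)
    fix X Y assume XY: "X \<in> verts (ind_complex G H L \<phi>)" "Y \<in> verts (ind_complex G H L \<phi>)" "?F X = ?F Y"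
    obtain g x where x: "g \<in> carrier G" "x \<in> verts L" "X = ind_pt G H \<phi> g x"
      using XY(1) unfolding verts_ind_complex ind_root_def by blast
    obtain k y where y: "k \<in> carrier G" "y \<in> verts L" "Y = ind_pt G H \<phi> k y"
      using XY(2) unfolding verts_ind_complex ind_root_def by blast
    have "ind_pt G H \<psi> g (f x) = ind_pt G H \<psi> k (f y)"
      using XY(3) unfolding x(3) y(3) F[OF x(2)] F[OF y(2)] .
    then obtain h where h: "h \<in> H" "g = k \<otimes> h" "f y = \<psi> h (f x)"
      by (rule ind_pt_eqD[OF M fv[OF x(2)] fv[OF y(2)] x(1) y(1)])
    \<comment> \<open>The element of \<open>H\<close> that identifies the two images already
      identifies the classes upstairs, since \<open>f\<close> is injective.\<close>
    have "f y = f (\<phi> h x)" using h(1,3) fD(5)[OF _ x(2), of h] by simp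
    hence "y = \<phi> h x" by (rule inj_onD[OF fD(1) _ y(2) action(1)[OF L x(2) h(1)]])
    thus "X = Y" unfolding x(3) y(3) using ind_pt_shift[OF L x(2) y(1) h(1)] h(2) by simp
  qed
  have simplex: "?F ` ind_pt G H \<phi> g ` \<sigma> = ind_pt G H \<psi> g ` f ` \<sigma>" if "\<sigma> \<in> L" for g \<sigma>
    unfolding image_image[of ?F] image_image[of _ f]
    by (rule image_cong[OF refl]) (rule F[OF verts_insert[OF that]])
  show "(`) ?F ` ind_complex G H L \<phi> = ind_complex G H M \<psi>"
  proof
    show "(`) ?F ` ind_complex G H L \<phi> \<subseteq> ind_complex G H M \<psi>"
    proof
      fix \<tau> assume "\<tau> \<in> (`) ?F ` ind_complex G H L \<phi>"
      then obtain g \<sigma> where \<sigma>: "g \<in> carrier G" "\<sigma> \<in> L" "\<tau> = ?F ` ind_pt G H \<phi> g ` \<sigma>"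
        unfolding ind_complex_def by blast
      have "f ` \<sigma> \<in> M" unfolding fD(3)[symmetric] by (rule imageI[OF \<sigma>(2)])
      thus "\<tau> \<in> ind_complex G H M \<psi>" unfolding \<sigma>(3) simplex[OF \<sigma>(2)] by (rule ind_complexI[OF \<sigma>(1)])
    qed
    show "ind_complex G H M \<psi> \<subseteq> (`) ?F ` ind_complex G H L \<phi>"
    proof
      fix \<tau> assume "\<tau> \<in> ind_complex G H M \<psi>"
      then obtain g \<rho> where \<rho>: "g \<in> carrier G" "\<rho> \<in> M" "\<tau> = ind_pt G H \<psi> g ` \<rho>"
        unfolding ind_complex_def by blast
      obtain \<sigma> where \<sigma>: "\<sigma> \<in> L" "\<rho> = f ` \<sigma>" using \<rho>(2) unfolding fD(3)[symmetric] by blast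
      have "\<tau> = ?F ` ind_pt G H \<phi> g ` \<sigma>" unfolding \<rho>(3) \<sigma>(2) by (rule simplex[OF \<sigma>(1), symmetric])
      thus "\<tau> \<in> (`) ?F ` ind_complex G H L \<phi>" using ind_complexI[OF \<rho>(1) \<sigma>(1)] by blast
    qed
  qed
  have "map ((`) ?F) (map (ind_root G H \<phi>) Rs) = map (ind_root G H \<psi>) (map ((`) f) Rs)"
    unfolding map_map by (rule map_cong[OF refl]) (use root Rs in simp)
  thus "map ((`) ?F) (map (ind_root G H \<phi>) Rs) = map (ind_root G H \<psi>) Ss" unfolding fD(4) .
  fix k X assume k: "k \<in> carrier G" and "X \<in> verts (ind_complex G H L \<phi>)"
  then obtain g x where x: "g \<in> carrier G" "x \<in> verts L" "X = ind_pt G H \<phi> g x"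
    unfolding verts_ind_complex ind_root_def by blast
  show "?F (ind_action G H L \<phi> k X) = ind_action G H M \<psi> k (?F X)"
    unfolding x(3) F[OF x(2)] ind_action_pt[OF x(2,1) k] ind_action_pt[OF fv[OF x(2)] x(1) k] ..
qed

text \<open>\<open>ind_class\<close> is computed at a chosen representative; functoriality makes the
  choice immaterial, so any convenient model may be used.\<close>

lemma ind_class_eq:
  assumes L: "orbit_rooted GH D L \<phi> Rs" "countable (verts L)"
  shows "ind_class G H (iso_class GH L \<phi> Rs) =
    iso_class G (ind_complex G H L \<phi>) (ind_action G H L \<phi>) (map (ind_root G H \<phi>) Rs)"
proof -
  note LD = orbit_rootedD[OF L(1)]
  obtain M \<psi> Ss where R: "representative (iso_class GH L \<phi> Rs) = (M, \<psi>, Ss)"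
    by (cases "representative (iso_class GH L \<phi> Rs)")
  obtain M' \<psi>' Ss' where "(M', \<psi>', Ss') \<in> iso_class GH L \<phi> Rs" by (rule nat_model[OF LD(1) L(2)])
  hence "iso_class GH L \<phi> Rs \<noteq> {}" by blast
  hence "(M, \<psi>, Ss) \<in> iso_class GH L \<phi> Rs" using representative_in R by metis
  then obtain f where f: "rooted_isomorphism f GH L \<phi> Rs M \<psi> Ss"
    unfolding iso_class_iff rooted_iso_iff by blast
  have "ind_class G H (iso_class GH L \<phi> Rs) =
    iso_class G (ind_complex G H M \<psi>) (ind_action G H M \<psi>) (map (ind_root G H \<psi>) Ss)"
    unfolding ind_class_def R ind_root_def by simp
  also have "\<dots> = iso_class G (ind_complex G H L \<phi>) (ind_action G H L \<phi>) (map (ind_root G H \<phi>) Rs)"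
  proof (rule iso_class_eqI[symmetric])
    note I = orbit_rootedD[OF orbit_rooted_ind[OF L(1)]]
    show "simplicial_action G (ind_complex G H L \<phi>) (ind_action G H L \<phi>)" by (rule I(1))
    show "\<forall>R\<in>set (map (ind_root G H \<phi>) Rs). R \<subseteq> verts (ind_complex G H L \<phi>)" by (rule I(3))
    show "rooted_iso G (ind_complex G H L \<phi>) (ind_action G H L \<phi>) (map (ind_root G H \<phi>) Rs)
      (ind_complex G H M \<psi>) (ind_action G H M \<psi>) (map (ind_root G H \<psi>) Ss)"
      unfolding rooted_iso_iff using ind_isomorphism[OF LD(1,3) f] by blast
  qed
  finally show ?thesis .
qed

section \<open>Continuity of induction and integrals over induced complexes\<close>

context
  assumes fin: "finite (carrier G)"
begin

lemma finite_H: "finite (carrier GH)"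
  using fin finite_subset[OF subgroup.subset[OF subgroup]] by simp

lemma ind_class_in_SC:
  assumes "C \<in> SC GH D k" "k > 0"
  shows "ind_class G H C \<in> SC G D k"
proof -
  obtain L \<phi> Rs where L: "(L, \<phi>, Rs) \<in> C" using SC_nonempty[OF assms(1)] by auto
  note LD = SC_model[OF assms(1) L]
  have Rs: "Rs \<noteq> []" using LD(3) assms(2) by auto
  note c = countable_verts[OF LD(2) Rs finite_H]
  show ?thesis
    unfolding LD(4) ind_class_eq[OF LD(2) c]
    by (rule iso_class_in_SC[OF orbit_rooted_ind[OF LD(2)]
      countable_verts[OF orbit_rooted_ind[OF LD(2)] _ fin]]) (use Rs LD(3) in simp_all)
qed

text \<open>Induction commutes with balls about the roots, so an isomorphism of balls induces one
  between balls of the same radius.\<close>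

lemma SC_dist_ind_class_le:
  assumes C: "C \<in> SC GH D k" and C': "C' \<in> SC GH D k" and "k > 0"
  shows "SC_dist G (ind_class G H C) (ind_class G H C') \<le> SC_dist GH C C'"
  unfolding SC_dist_def[of GH]
proof (rule Inf_greatest, clarify)
  fix r K \<phi> Rs L \<psi> Ss
  assume r: "(0::real) < r" and K: "(K, \<phi>, Rs) \<in> C" and L: "(L, \<psi>, Ss) \<in> C'"
    and iso: "rooted_iso GH (ball_complex r K (\<Union>(set Rs))) \<phi> Rs (ball_complex r L (\<Union>(set Ss))) \<psi> Ss"
  note KD = SC_model[OF C K] and LD = SC_model[OF C' L]
  have ne: "Rs \<noteq> []" "Ss \<noteq> []" using KD(3) LD(3) assms(3) by auto
  note cK = countable_verts[OF KD(2) ne(1) finite_H] and cL = countable_verts[OF LD(2) ne(2) finite_H]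
  note IK = orbit_rooted_ind[OF KD(2)] and IL = orbit_rooted_ind[OF LD(2)]
  \<comment> \<open>The complexes on the two sides coincide, but \<open>ind_action\<close> cuts the
    actions off at different vertex sets; the identity map compares them.\<close>
  have ball: "rooted_isomorphism (\<lambda>X. X) G
      (ball_complex r (ind_complex G H M \<xi>) (\<Union>(set (map (ind_root G H \<xi>) Ts)))) (ind_action G H M \<xi>)
        (map (ind_root G H \<xi>) Ts)
      (ind_complex G H (ball_complex r M (\<Union>(set Ts))) \<xi>) (ind_action G H (ball_complex r M (\<Union>(set Ts))) \<xi>)
        (map (ind_root G H \<xi>) Ts)" (is "rooted_isomorphism _ G ?A _ _ ?B _ _")
    if M: "orbit_rooted GH D M \<xi> Ts" and "Ts \<noteq> []" for M :: "nat set set" and \<xi> Ts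
  proof -
    note MD = orbit_rootedD[OF M]
    have V: "\<Union>(set Ts) \<subseteq> verts M" using MD(3) by blast
    have inv: "\<xi> h x \<in> \<Union>(set Ts)" if "h \<in> H" "x \<in> \<Union>(set Ts)" for h x
      by (rule roots_invariant[OF M]) (use that in simp_all)
    have AB: "?A = ?B" unfolding Union_map_ind_root by (rule ind_ball_complex[OF MD(1) V inv])
    have r0: "r \<ge> 0" using r by simp
    note vb = simplicial_action_ball(3)[OF M that(2) r0]
    have "ind_action G H M \<xi> k X = ind_action G H (ball_complex r M (\<Union>(set Ts))) \<xi> k X"
      if k: "k \<in> carrier G" "X \<in> verts ?B" for k X
    proof -
      obtain g x where x: "g \<in> carrier G" "x \<in> verts (ball_complex r M (\<Union>(set Ts)))" "X = ind_pt G H \<xi> g x"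
        using \<open>X \<in> verts ?B\<close> unfolding verts_ind_complex ind_root_def by blast
      have "x \<in> verts M" using x(2) ball_verts_subset[OF V] unfolding vb by blast
      thus ?thesis unfolding x(3) using ind_action_pt[OF _ x(1) k(1)] x(2) by metis
    qed
    thus ?thesis unfolding AB by (rule rooted_isomorphism_id)
  qed
  have r0: "0 \<le> r" using r by simp
  obtain f where f: "rooted_isomorphism f GH (ball_complex r K (\<Union>(set Rs))) \<phi> Rs
      (ball_complex r L (\<Union>(set Ss))) \<psi> Ss" using iso unfolding rooted_iso_iff by blast
  note bK = ball[OF KD(2) ne(1)] and bL = ball[OF LD(2) ne(2)]
  have neK: "map (ind_root G H \<phi>) Rs \<noteq> []" using ne(1) by simp
  have ne': "map (ind_root G H \<psi>) Ss \<noteq> []" using ne(2) by simp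
  note bL' = rooted_isomorphism_sym[OF simplicial_action_ball(1,2)[OF IL ne' r0] bL]
  note b = ind_isomorphism[OF simplicial_action_ball(1,2)[OF KD(2) ne(1) r0] f]
  have "rooted_iso G
      (ball_complex r (ind_complex G H K \<phi>) (\<Union>(set (map (ind_root G H \<phi>) Rs)))) (ind_action G H K \<phi>)
        (map (ind_root G H \<phi>) Rs)
      (ball_complex r (ind_complex G H L \<psi>) (\<Union>(set (map (ind_root G H \<psi>) Ss)))) (ind_action G H L \<psi>)
        (map (ind_root G H \<psi>) Ss)"
    unfolding rooted_iso_iff
    by (rule exI, rule rooted_isomorphism_trans[OF rooted_isomorphism_trans[OF bK b] bL'])
  thus "SC_dist G (ind_class G H C) (ind_class G H C') \<le> ennreal (2 powr - r)"
    unfolding KD(4) LD(4) ind_class_eq[OF KD(2) cK] ind_class_eq[OF LD(2) cL]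
    by (rule SC_dist_le[OF IK countable_verts[OF IK neK fin] IL countable_verts[OF IL ne' fin] r])
qed

text \<open>A map that does not increase distances is continuous, and the open sets generate the
  target.\<close>

lemma ind_class_measurable:
  assumes "k > 0"
  shows "ind_class G H \<in> measurable (SC_borel GH D k) (SC_borel G D k)"
  unfolding borel_of_topology_def[of "SC_topology G D k"]
proof (rule measurable_sigma_sets)
  show "sets (sigma (topspace (SC_topology G D k)) {U. openin (SC_topology G D k) U}) =
    sigma_sets (topspace (SC_topology G D k)) {U. openin (SC_topology G D k) U}"
    by (rule sets_measure_of) (use openin_subset[of "SC_topology G D k"] in blast)
  show "{U. openin (SC_topology G D k) U} \<subseteq> Pow (topspace (SC_topology G D k))"
    by (use openin_subset[of "SC_topology G D k"] in blast)
  show "ind_class G H \<in> space (SC_borel GH D k) \<rightarrow> topspace (SC_topology G D k)"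
    using ind_class_in_SC[OF _ assms] by simp
  fix U assume "U \<in> {U. openin (SC_topology G D k) U}"
  hence U: "\<forall>C\<in>U. \<exists>e>0. \<forall>C'\<in>SC G D k. SC_dist G C C' < e \<longrightarrow> C' \<in> U"
    unfolding SC_topology_def mem_Collect_eq openin_emetric_topology by blast
  have "openin (SC_topology GH D k) (ind_class G H -` U \<inter> SC GH D k)"
    unfolding SC_topology_def openin_emetric_topology
  proof (intro conjI ballI Int_lower2)
    fix C assume C: "C \<in> ind_class G H -` U \<inter> SC GH D k"
    then obtain e where e: "e > 0" "\<forall>C'\<in>SC G D k. SC_dist G (ind_class G H C) C' < e \<longrightarrow> C' \<in> U"
      using U by blast
    have "C' \<in> ind_class G H -` U \<inter> SC GH D k" if "C' \<in> SC GH D k" "SC_dist GH C C' < e" for C'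
    proof -
      have "SC_dist G (ind_class G H C) (ind_class G H C') < e"
        using SC_dist_ind_class_le[OF _ that(1) assms, of C] C that(2) by (auto intro: le_less_trans)
      thus ?thesis using e(2) ind_class_in_SC[OF that(1) assms] that(1) by blast
    qed
    thus "\<exists>e>0. \<forall>C'\<in>SC GH D k. SC_dist GH C C' < e \<longrightarrow> C' \<in> ind_class G H -` U \<inter> SC GH D k"
      using e(1) by blast
  qed
  thus "ind_class G H -` U \<inter> space (SC_borel GH D k) \<in> sets (SC_borel GH D k)"
    using openin_borel by fastforce
qed

text \<open>One element is chosen from each left coset of \<open>H\<close>, so that each induced
  vertex has exactly one presentation with first entry in this set. Its cardinality is the index of
  \<open>H\<close> in \<open>G\<close>.\<close>

definition left_reps :: "'a set" where
  "left_reps = (\<lambda>g. SOME k. k \<in> g <# H) ` carrier G"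

lemma left_repsE:
  assumes "g \<in> carrier G"
  obtains t h where "t \<in> left_reps" "h \<in> H" "g = t \<otimes> h"
proof -
  define t where "t = (SOME k. k \<in> g <# H)"
  have "g \<otimes> \<one> \<in> g <# H" unfolding l_coset_def using H_closed(3) by blast
  hence "t \<in> g <# H" unfolding t_def by (rule someI)
  then obtain k where k: "k \<in> H" "t = g \<otimes> k" unfolding l_coset_def by blast
  have "g = t \<otimes> inv k" using k assms H_carrier[OF k(1)] by (simp add: m_assoc)
  moreover have "t \<in> left_reps" unfolding left_reps_def t_def using assms by blast
  ultimately show thesis using that H_closed(2)[OF k(1)] by blast
qed

lemma left_reps_carrier: "t \<in> left_reps \<Longrightarrow> t \<in> carrier G"
proof -
  assume "t \<in> left_reps"
  then obtain g where g: "g \<in> carrier G" "t = (SOME k. k \<in> g <# H)" unfolding left_reps_def by blast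
  have "g \<otimes> \<one> \<in> g <# H" unfolding l_coset_def using H_closed(3) by blast
  hence "t \<in> g <# H" unfolding g(2) by (rule someI)
  thus "t \<in> carrier G" using g(1) H_carrier unfolding l_coset_def by auto
qed

lemma left_reps_unique:
  assumes "s \<in> left_reps" "t \<in> left_reps" "h \<in> H" "s = t \<otimes> h"
  shows "s = t"
proof -
  have *: "\<exists>g\<in>carrier G. s = (SOME k. k \<in> g <# H) \<and> s <# H = g <# H" if "s \<in> left_reps" for s
  proof -
    obtain g where g: "g \<in> carrier G" "s = (SOME k. k \<in> g <# H)"
      using \<open>s \<in> left_reps\<close> unfolding left_reps_def by blast
    have "g \<otimes> \<one> \<in> g <# H" unfolding l_coset_def using H_closed(3) by blast
    hence "s \<in> g <# H" unfolding g(2) by (rule someI)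
    hence "g <# H = s <# H" by (rule l_repr_independence[OF _ g(1) subgroup])
    thus ?thesis using g by blast
  qed
  have tc: "t \<in> carrier G" by (rule left_reps_carrier[OF assms(2)])
  have "s \<in> t <# H" unfolding l_coset_def using assms(3,4) by blast
  hence "t <# H = s <# H" by (rule l_repr_independence[OF _ tc subgroup])
  thus ?thesis using *[OF assms(1)] *[OF assms(2)] by force
qed

text \<open>The induced complex consists of copies of \<open>L\<close>, one for each left coset of
  \<open>H\<close>; an integrand that does not see the copy collects the same from each.\<close>

lemma nn_integral_ind:
  assumes L: "simplicial_action GH L \<phi>" and c: "countable (verts L)"
    and u: "\<And>g x. g \<in> carrier G \<Longrightarrow> x \<in> verts L \<Longrightarrow> F (ind_pt G H \<phi> g x) = u x"
  shows "(\<integral>\<^sup>+ X. F X \<partial>count_space (verts (ind_complex G H L \<phi>))) =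
    of_nat (card left_reps) * (\<integral>\<^sup>+ x. u x \<partial>count_space (verts L))"
proof -
  have fT: "finite left_reps" unfolding left_reps_def using fin by simp
  let ?p = "\<lambda>(g, x). ind_pt G H \<phi> g x"
  have bij: "bij_betw ?p (left_reps \<times> verts L) (verts (ind_complex G H L \<phi>))"
    unfolding bij_betw_def
  proof (intro conjI inj_onI)
    fix p q assume p: "p \<in> left_reps \<times> verts L" and q: "q \<in> left_reps \<times> verts L" and pq: "?p p = ?p q"
    obtain s x where sx: "p = (s, x)" "s \<in> left_reps" "x \<in> verts L" using p by blast
    obtain t y where ty: "q = (t, y)" "t \<in> left_reps" "y \<in> verts L" using q by blast
    have c: "s \<in> carrier G" "t \<in> carrier G" using sx ty left_reps_carrier by blast+
    have eq: "ind_pt G H \<phi> s x = ind_pt G H \<phi> t y" using pq sx ty by simp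
    obtain h where h: "h \<in> H" "s = t \<otimes> h" by (rule ind_pt_eqD[OF L sx(3) ty(3) c eq])
    have "s = t" by (rule left_reps_unique[OF sx(2) ty(2) h])
    moreover have "x = y" using inj_onD[OF ind_pt_inj[OF L c(2)] _ sx(3) ty(3)] eq \<open>s = t\<close> by simp
    ultimately show "p = q" using sx ty by simp
  next
    show "?p ` (left_reps \<times> verts L) = verts (ind_complex G H L \<phi>)"
    proof
      show "?p ` (left_reps \<times> verts L) \<subseteq> verts (ind_complex G H L \<phi>)"
        unfolding verts_ind_complex using ind_rootI left_reps_carrier by fastforce
      show "verts (ind_complex G H L \<phi>) \<subseteq> ?p ` (left_reps \<times> verts L)"
      proof
        fix X assume "X \<in> verts (ind_complex G H L \<phi>)"
        then obtain g x where x: "g \<in> carrier G" "x \<in> verts L" "X = ind_pt G H \<phi> g x"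
          unfolding verts_ind_complex ind_root_def by blast
        obtain t h where t: "t \<in> left_reps" "h \<in> H" "g = t \<otimes> h" by (rule left_repsE[OF x(1)])
        have "X = ?p (t, \<phi> h x)"
          using ind_pt_shift[OF L x(2) left_reps_carrier[OF t(1)] t(2)] t(3) x(3) by simp
        thus "X \<in> ?p ` (left_reps \<times> verts L)" using t(1) action(1)[OF L x(2) t(2)] by blast
      qed
    qed
  qed
  interpret sigma_finite_measure "count_space (verts L)" by (rule sigma_finite_measure_count_space_countable[OF c])
  have "(\<integral>\<^sup>+ X. F X \<partial>count_space (verts (ind_complex G H L \<phi>))) =
      (\<integral>\<^sup>+ p. F (?p p) \<partial>count_space (left_reps \<times> verts L))"
    by (rule nn_integral_bij_count_space[OF bij, symmetric])
  also have "\<dots> = (\<integral>\<^sup>+ p. F (?p p) \<partial>(count_space left_reps \<Otimes>\<^sub>M count_space (verts L)))"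
    using pair_measure_countable[OF countable_finite[OF fT] c] by simp
  also have "\<dots> = (\<integral>\<^sup>+ t. \<integral>\<^sup>+ x. F (?p (t, x)) \<partial>count_space (verts L) \<partial>count_space left_reps)"
    by (rule nn_integral_fst[symmetric])
      (simp add: pair_measure_countable[OF countable_finite[OF fT] c])
  also have "\<dots> = (\<integral>\<^sup>+ t. \<integral>\<^sup>+ x. u x \<partial>count_space (verts L) \<partial>count_space left_reps)"
    by (intro nn_integral_cong) (use u left_reps_carrier in auto)
  also have "\<dots> = of_nat (card left_reps) * (\<integral>\<^sup>+ x. u x \<partial>count_space (verts L))"
    using fT by (simp add: nn_integral_count_space_finite mult.commute)
  finally show ?thesis .
qed

end

end

section \<open>Quotients\<close>

text \<open>After \<open>m_assoc\<close> has bracketed products to the right, inverse pairs cancel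
  only in this nested form.\<close>

lemma (in group) cancel_inv:
  assumes "x \<in> carrier G" "y \<in> carrier G"
  shows "x \<otimes> (inv x \<otimes> y) = y" "inv x \<otimes> (x \<otimes> y) = y"
  using assms by (simp_all add: m_assoc[symmetric])

lemma simplicial_action_subgroup:
  assumes K: "simplicial_action G K \<phi>" and H: "subgroup H G"
  shows "simplicial_action (G\<lparr>carrier := H\<rparr>) K \<phi>"
proof -
  interpret group G using K by (rule simplicial_actionD)
  have "h \<in> carrier G" if "h \<in> H" for h using subgroup.mem_carrier[OF H that] .
  thus ?thesis
    using simplicial_actionD(1-4)[OF K] subgroup.subgroup_is_group[OF H is_group]
    by (intro simplicial_actionI) simp_all
qed

lemma orbit_rooted_components:
  assumes K: "simplicial_action G K \<phi>" and deg: "vertex_degree K \<le> ennreal D" and x: "x \<in> verts K"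
  shows "orbit_rooted G D (components_meeting K (orbit G \<phi> x)) \<phi> [orbit G \<phi> x]"
    and "verts (components_meeting K (orbit G \<phi> x)) = component_verts K (orbit G \<phi> x)"
proof -
  let ?V = "orbit G \<phi> x" and ?C = "component_verts K (orbit G \<phi> x)"
  have V: "?V \<subseteq> verts K" by (rule orbit_subset_verts[OF K x])
  have C: "?C \<subseteq> verts K" by (rule component_verts_subset[OF V])
  have VC: "?V \<subseteq> ?C" by (rule component_verts_center)
  have xV: "x \<in> ?V" by (rule orbit_self[OF K x])
  show vv: "verts (components_meeting K ?V) = ?C"
    unfolding components_meeting_eq by (rule verts_full[OF simplicial_actionD(1)[OF K] C])
  show "orbit_rooted G D (components_meeting K ?V) \<phi> [?V]"
    unfolding orbit_rooted_def
  proof (intro conjI ballI)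
    show "simplicial_action G (components_meeting K ?V) \<phi>"
      unfolding components_meeting_eq
    proof (rule simplicial_action_full[OF K C])
      show "?C \<noteq> {}" using VC xV by blast
      show "\<phi> g y \<in> ?C" if "g \<in> carrier G" "y \<in> ?C" for g y
        by (rule component_verts_invariant[OF K that(1) orbit_closed[OF K x _ that(1)] that(2)])
    qed
    have "components_meeting K ?V \<subseteq> K" unfolding components_meeting_eq by (rule full_subcomplex_subset)
    thus "vertex_degree (components_meeting K ?V) \<le> ennreal D"
      by (rule order_trans[OF vertex_degree_subcomplex deg])
    fix R assume "R \<in> set [?V]"
    hence R: "R = ?V" by simp
    show "R \<in> orbits G (verts (components_meeting K ?V)) \<phi>"
      unfolding R vv orbits_def using xV VC by blast
    fix y assume "y \<in> verts (components_meeting K ?V)"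
    hence "y \<in> ?C" unfolding vv .
    then obtain v where v: "v \<in> ?V" "(v, y) \<in> (adj K)\<^sup>*" unfolding component_verts_def by blast
    have "(v, y) \<in> (adj (components_meeting K ?V))\<^sup>*" using rtrancl_components[OF v(2)] v(1) VC by blast
    hence "(y, v) \<in> (adj (components_meeting K ?V))\<^sup>*" by (rule adj_rtrancl_sym)
    thus "\<exists>z\<in>R. (y, z) \<in> (adj (components_meeting K ?V))\<^sup>*" unfolding R using v(1) by blast
  qed
qed

lemma class_at_in_SC:
  assumes "simplicial_action G K \<phi>" "vertex_degree K \<le> ennreal D" "x \<in> verts K" "finite (carrier G)"
  shows "class_at G K \<phi> x \<in> SC G D 1"
  unfolding class_at_def
  by (rule iso_class_in_SC[OF orbit_rooted_components(1)[OF assms(1-3)]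
    countable_verts[OF orbit_rooted_components(1)[OF assms(1-3)] _ assms(4)]]) simp_all

text \<open>The point to check is that the inverse of the group with carrier \<open>A\<close>, a
  priori a different operation, agrees on \<open>H\<close> with that of the ambient group.\<close>

lemma (in group) subgroup_induction_restrict:
  assumes A: "subgroup A G" and H: "subgroup H G" "H \<subseteq> A"
  shows "subgroup_induction (G\<lparr>carrier := A\<rparr>) H"
proof -
  interpret A: group "G\<lparr>carrier := A\<rparr>" by (rule subgroup.subgroup_is_group[OF A is_group])
  show ?thesis
  proof
    show "H \<subseteq> carrier (G\<lparr>carrier := A\<rparr>)" using H(2) by simp
    show "x \<otimes>\<^bsub>G\<lparr>carrier := A\<rparr>\<^esub> y \<in> H" if "x \<in> H" "y \<in> H" for x y
      using subgroup.m_closed[OF H(1) that] by simp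
    show "\<one>\<^bsub>G\<lparr>carrier := A\<rparr>\<^esub> \<in> H" using subgroup.one_closed[OF H(1)] by simp
    show "inv\<^bsub>G\<lparr>carrier := A\<rparr>\<^esub> x \<in> H" if "x \<in> H" for x
      using subgroup.m_inv_closed[OF H(1) that] m_inv_consistent[OF A, of x] H(2) that by auto
  qed
qed

locale normal_quotient = normal N \<Gamma> for N and \<Gamma> (structure) +
  fixes K :: "'v set set" and \<phi> :: "'a \<Rightarrow> 'v \<Rightarrow> 'v"
  assumes act: "simplicial_action \<Gamma> K \<phi>"
begin

abbreviation "q \<equiv> orbit (\<Gamma>\<lparr>carrier := N\<rparr>) \<phi>"
abbreviation "Q \<equiv> quotient_complex \<Gamma> K \<phi> N"
abbreviation "qact \<equiv> quotient_action \<Gamma> K \<phi> N"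

lemma N_sub: "subgroup N \<Gamma>" by (rule subgroup_axioms)

lemma N_act: "simplicial_action (\<Gamma>\<lparr>carrier := N\<rparr>) K \<phi>"
  by (rule simplicial_action_subgroup[OF act N_sub])

lemmas actD = simplicial_actionD[OF act] simplicial_action_inv[OF act]

lemma q_translate: "n \<in> N \<Longrightarrow> x \<in> verts K \<Longrightarrow> q (\<phi> n x) = q x"
  using orbit_translate[OF N_act] by simp

lemma q_eqE:
  assumes "x \<in> verts K" "q x = q y"
  obtains n where "n \<in> N" "x = \<phi> n y"
proof -
  have "x \<in> q y" using orbit_self[OF N_act assms(1)] assms(2) by simp
  thus thesis using that unfolding orbit_def by auto
qed

lemma verts_Q: "verts Q = q ` verts K"
  unfolding quotient_complex_def verts_def by blast

lemma QI: "\<sigma> \<in> K \<Longrightarrow> q ` \<sigma> \<in> Q"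
  unfolding quotient_complex_def by blast

lemma qact_q:
  assumes "g \<in> carrier \<Gamma>" "x \<in> verts K"
  shows "qact g (q x) = q (\<phi> g x)"
proof -
  have "q x \<in> verts Q" unfolding verts_Q using assms(2) by blast
  hence "qact g (q x) = \<phi> g ` q x" unfolding quotient_action_def by simp
  moreover have "\<phi> g ` q x = q (\<phi> g x)"
  proof
    show "\<phi> g ` q x \<subseteq> q (\<phi> g x)"
    proof
      fix y assume "y \<in> \<phi> g ` q x"
      then obtain n where n: "n \<in> N" "y = \<phi> g (\<phi> n x)" unfolding orbit_def by auto
      have "y = \<phi> (g \<otimes> n) x" using n actD(4)[OF assms(1) _ assms(2), of n] by simp
      \<comment> \<open>Normality moves the element of \<open>N\<close> to the left of
        \<open>g\<close>, at the cost of conjugating it.\<close>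
      also have "g \<otimes> n = (g \<otimes> n \<otimes> inv g) \<otimes> g" using assms(1) n(1) by (simp add: m_assoc)
      also have "\<phi> \<dots> x = \<phi> (g \<otimes> n \<otimes> inv g) (\<phi> g x)"
        using actD(4)[of "g \<otimes> n \<otimes> inv g" g x] assms n(1) by simp
      finally show "y \<in> q (\<phi> g x)" using inv_op_closed2[OF assms(1) n(1)] unfolding orbit_def by auto
    qed
    show "q (\<phi> g x) \<subseteq> \<phi> g ` q x"
    proof
      fix y assume "y \<in> q (\<phi> g x)"
      then obtain n where n: "n \<in> N" "y = \<phi> n (\<phi> g x)" unfolding orbit_def by auto
      have "y = \<phi> (n \<otimes> g) x" using n actD(4)[OF _ assms, of n] by simp
      also have "n \<otimes> g = g \<otimes> (inv g \<otimes> n \<otimes> g)" using assms(1) n(1) by (simp add: m_assoc[symmetric])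
      also have "\<phi> \<dots> x = \<phi> g (\<phi> (inv g \<otimes> n \<otimes> g) x)"
        using actD(4)[of g "inv g \<otimes> n \<otimes> g" x] assms n(1) by simp
      finally show "y \<in> \<phi> g ` q x" using inv_op_closed1[OF assms(1) n(1)] unfolding orbit_def by auto
    qed
  qed
  ultimately show ?thesis by simp
qed

lemma simplicial_action_Q: "simplicial_action \<Gamma> Q qact"
proof (rule simplicial_actionI)
  note sc = simplicial_actionD(1)[OF act]
  show "group \<Gamma>" by (rule is_group)
  show "simplicial_complex Q"
  proof (rule simplicial_complexI)
    obtain \<sigma> where "\<sigma> \<in> K" using sc unfolding simplicial_complex_def by blast
    thus "Q \<noteq> {}" using QI by blast
    fix \<tau> assume "\<tau> \<in> Q"
    then obtain \<sigma> where \<sigma>: "\<sigma> \<in> K" "\<tau> = q ` \<sigma>" unfolding quotient_complex_def by blast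
    show "finite \<tau> \<and> \<tau> \<noteq> {}" using simplicial_complexD(1,2)[OF sc \<sigma>(1)] \<sigma>(2) by simp
    fix \<rho> assume \<rho>: "\<rho> \<noteq> {}" "\<rho> \<subseteq> \<tau>"
    then obtain \<sigma>' where \<sigma>': "\<sigma>' \<subseteq> \<sigma>" "\<rho> = q ` \<sigma>'" using subset_image_iff[of \<rho> q \<sigma>] \<sigma>(2) by blast
    hence "\<sigma>' \<in> K" using simplicial_complexD(4)[OF sc \<sigma>(1) _ \<sigma>'(1)] \<rho>(1) by blast
    thus "\<rho> \<in> Q" using QI \<sigma>'(2) by simp
  qed
  fix g assume g: "g \<in> carrier \<Gamma>"
  show "qact g ` \<tau> \<in> Q" if "\<tau> \<in> Q" for \<tau>
  proof -
    obtain \<sigma> where \<sigma>: "\<sigma> \<in> K" "\<tau> = q ` \<sigma>" using \<open>\<tau> \<in> Q\<close> unfolding quotient_complex_def by blast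
    have "qact g ` \<tau> = q ` \<phi> g ` \<sigma>" unfolding \<sigma>(2) image_image
      by (rule image_cong[OF refl]) (rule qact_q[OF g verts_insert[OF \<sigma>(1)]])
    thus ?thesis using QI[OF actD(2)[OF g \<sigma>(1)]] by simp
  qed
  fix X assume "X \<in> verts Q"
  then obtain x where x: "x \<in> verts K" "X = q x" unfolding verts_Q by blast
  show "qact (g \<otimes> h) X = qact g (qact h X)" if "h \<in> carrier \<Gamma>" for h
    unfolding x(2) using qact_q[OF _ x(1)] qact_q[OF g actD(5)[OF that x(1)]] actD(4)[OF g that x(1)] g that
    by simp
next
  fix X assume "X \<in> verts Q"
  then obtain x where x: "x \<in> verts K" "X = q x" unfolding verts_Q by blast
  show "qact \<one> X = X" unfolding x(2) using qact_q[OF one_closed x(1)] actD(3)[OF x(1)] by simp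
qed

text \<open>Any lift of the simplex contains a point of the orbit of \<open>x\<close>, and an
  element of \<open>N\<close> moves that point to \<open>x\<close>. Paths in the quotient therefore
  lift from any chosen starting point.\<close>

lemma Q_liftE:
  assumes "\<tau> \<in> Q" "q x \<in> \<tau>" "x \<in> verts K"
  obtains \<sigma> where "\<sigma> \<in> K" "x \<in> \<sigma>" "\<tau> = q ` \<sigma>"
proof -
  obtain \<rho> where \<rho>: "\<rho> \<in> K" "\<tau> = q ` \<rho>" using assms(1) unfolding quotient_complex_def by blast
  then obtain y where y: "y \<in> \<rho>" "q x = q y" using assms(2) by blast
  obtain n where n: "n \<in> N" "x = \<phi> n y" by (rule q_eqE[OF assms(3) y(2)])
  have "q (\<phi> n z) = q z" if "z \<in> \<rho>" for z by (rule q_translate[OF n(1) verts_insert[OF \<rho>(1) that]])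
  hence "q ` \<phi> n ` \<rho> = \<tau>" unfolding \<rho>(2) image_image by (rule image_cong[OF refl])
  moreover have "\<phi> n ` \<rho> \<in> K" using actD(2)[OF _ \<rho>(1)] n(1) by simp
  moreover have "x \<in> \<phi> n ` \<rho>" using n(2) y(1) by blast
  ultimately show thesis using that by blast
qed

lemma Q_adjE:
  assumes "x \<in> verts K" "(q x, Y) \<in> adj Q"
  obtains y where "Y = q y" "(x, y) \<in> adj K"
proof -
  have Y: "{q x, Y} \<in> Q" "q x \<noteq> Y" using assms(2) by (simp_all add: adj_def)
  obtain \<sigma> where \<sigma>: "\<sigma> \<in> K" "x \<in> \<sigma>" "{q x, Y} = q ` \<sigma>" by (rule Q_liftE[OF Y(1) _ assms(1)]) simp
  then obtain y where y: "y \<in> \<sigma>" "Y = q y" by blast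
  have "{x, y} \<in> K"
    by (rule simplicial_complexD(4)[OF actD(1) \<sigma>(1)]) (use y \<sigma>(2) in auto)
  thus thesis using that y(2) Y(2) by (auto simp: adj_def)
qed

lemma Q_relpowE:
  assumes "x \<in> verts K" "(q x, Y) \<in> adj Q ^^ n"
  shows "\<exists>y. Y = q y \<and> (x, y) \<in> adj K ^^ n"
  using assms(2)
proof (induction n arbitrary: Y)
  case (Suc n)
  then obtain Z where Z: "(q x, Z) \<in> adj Q ^^ n" "(Z, Y) \<in> adj Q" by auto
  from Suc.IH[OF Z(1)] obtain z where z: "Z = q z" "(x, z) \<in> adj K ^^ n" by blast
  obtain y where "Y = q y" "(z, y) \<in> adj K"
    by (rule Q_adjE[OF adj_relpow_verts[OF z(2) assms(1)] Z(2)[unfolded z(1)]])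
  thus ?case using z(2) by auto
qed auto

text \<open>Edges between points of one \<open>N\<close>-orbit collapse, so a path may become
  shorter in the quotient.\<close>

lemma Q_relpowI:
  assumes "(x, y) \<in> adj K ^^ n"
  shows "\<exists>m\<le>n. (q x, q y) \<in> adj Q ^^ m"
  using assms
proof (induction n arbitrary: y)
  case (Suc n)
  then obtain z where z: "(x, z) \<in> adj K ^^ n" "(z, y) \<in> adj K" by auto
  from Suc.IH[OF z(1)] obtain m where m: "m \<le> n" "(q x, q z) \<in> adj Q ^^ m" by blast
  show ?case
  proof (cases "q z = q y")
    case True
    thus ?thesis using m by (intro exI[of _ m]) simp
  next
    case False
    have "{z, y} \<in> K" using z(2) by (simp add: adj_def)
    from QI[OF this] have "(q z, q y) \<in> adj Q" using False by (simp add: adj_def)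
    hence "(q x, q y) \<in> adj Q ^^ Suc m" using m(2) by auto
    thus ?thesis using m(1) by (intro exI[of _ "Suc m"]) simp
  qed
qed auto

text \<open>Edges at \<open>q x\<close> lift to edges at \<open>x\<close>; edges that collapse or
  become equal can only lower the degree.\<close>

lemma Q_vertex_degree: "vertex_degree Q \<le> vertex_degree K"
proof (rule vertex_degree_le)
  fix X assume "X \<in> verts Q"
  then obtain x where x: "x \<in> verts K" "X = q x" unfolding verts_Q by blast
  have "edges_at Q X \<subseteq> (`) q ` edges_at K x"
  proof
    fix \<tau> assume "\<tau> \<in> edges_at Q X"
    hence \<tau>: "\<tau> \<in> Q" "q x \<in> \<tau>" "card \<tau> = 2" by (simp_all add: edges_at_def x(2))
    obtain a b where ab: "\<tau> = {a, b}" "a \<noteq> b" using \<tau>(3) card_2_iff[of \<tau>] by blast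
    have "\<exists>Y. \<tau> = {q x, Y} \<and> q x \<noteq> Y"
    proof (cases "q x = a")
      case True
      thus ?thesis using ab by (intro exI[of _ b]) simp
    next
      case False
      hence "q x = b" using \<tau>(2) ab(1) by simp
      thus ?thesis using ab by (intro exI[of _ a]) (simp add: insert_commute)
    qed
    then obtain Y where Y: "\<tau> = {q x, Y}" "q x \<noteq> Y" by blast
    hence "(q x, Y) \<in> adj Q" using \<tau>(1) by (simp add: adj_def)
    then obtain y where y: "Y = q y" "(x, y) \<in> adj K" by (rule Q_adjE[OF x(1)])
    hence "{x, y} \<in> edges_at K x" by (simp add: edges_at_def adj_def)
    moreover have "\<tau> = q ` {x, y}" using Y(1) y(1) by simp
    ultimately show "\<tau> \<in> (`) q ` edges_at K x" by blast
  qed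
  thus "\<exists>v\<in>verts K. \<exists>f. edges_at Q X \<subseteq> f ` edges_at K v" using x(1) by blast
qed

end

text \<open>The vertices around which the quotient by \<open>N\<close> looks like the complex induced from \<open>H\<close>
  to \<open>G\<close> up to distance about \<open>R / 2\<close>.\<close>

definition separated ::
    "('g, 'b) monoid_scheme \<Rightarrow> 'v set set \<Rightarrow> ('g \<Rightarrow> 'v \<Rightarrow> 'v) \<Rightarrow> 'g set \<Rightarrow> 'g set \<Rightarrow> 'g set \<Rightarrow> nat \<Rightarrow> 'v \<Rightarrow> bool" where
  "separated \<Gamma> K \<phi> G H N R x \<longleftrightarrow> (\<forall>n\<in>N. \<forall>g\<in>G. \<forall>j\<le>R.
     (x, \<phi> (n \<otimes>\<^bsub>\<Gamma>\<^esub> g) x) \<in> adj K ^^ j \<longrightarrow> n = \<one>\<^bsub>\<Gamma>\<^esub> \<and> g \<in> H)"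

section \<open>Balls of the quotient around separated vertices\<close>

context normal_quotient
begin

text \<open>A point \<open>y\<close> and its translate are both near the \<open>H\<close>-orbit of
  \<open>x\<close>. Joining the two paths and undoing \<open>h'\<close> gives an element of
  \<open>N\<close> times an element of \<open>G\<close> that displaces \<open>x\<close> itself by at
  most \<open>i + i'\<close>, which is what \<open>separated\<close> controls.\<close>

lemma separatedD:
  assumes sep: "separated \<Gamma> K \<phi> G H N R x" and G: "subgroup G \<Gamma>" and H: "subgroup H \<Gamma>" "H \<subseteq> G"
    and x: "x \<in> verts K" and n: "n \<in> N" and g: "g \<in> G" and h: "h \<in> H" "h' \<in> H"
    and y: "(\<phi> h x, y) \<in> adj K ^^ i" "(\<phi> h' x, \<phi> (n \<otimes> g) y) \<in> adj K ^^ i'" "i + i' \<le> R"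
  shows "n = \<one> \<and> g \<in> H"
proof -
  have c: "n \<in> carrier \<Gamma>" "g \<in> carrier \<Gamma>" "h \<in> carrier \<Gamma>" "h' \<in> carrier \<Gamma>"
    using n g h subgroup.mem_carrier[OF G] subgroup.mem_carrier[OF H(1)] by auto
  have hx: "\<phi> h x \<in> verts K" by (rule actD(5)[OF c(3) x])
  have ng: "n \<otimes> g \<in> carrier \<Gamma>" using c by simp
  have "(\<phi> (n \<otimes> g) (\<phi> h x), \<phi> (n \<otimes> g) y) \<in> adj K ^^ i"
    by (rule relpow_image[of "adj K", OF simplicial_action_adj[OF act ng] y(1)])
  hence "(\<phi> (n \<otimes> g) y, \<phi> (n \<otimes> g) (\<phi> h x)) \<in> adj K ^^ i" by (rule relpow_sym[OF sym_adj])
  hence "(\<phi> h' x, \<phi> (n \<otimes> g) (\<phi> h x)) \<in> adj K ^^ (i' + i)"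
    using y(2) unfolding relpow_add by blast
  from relpow_image[of "adj K", OF simplicial_action_adj[OF act inv_closed[OF c(4)]] this]
  have "(\<phi> (inv h') (\<phi> h' x), \<phi> (inv h') (\<phi> (n \<otimes> g) (\<phi> h x))) \<in> adj K ^^ (i' + i)" .
  moreover have "\<phi> (inv h') (\<phi> h' x) = x" by (rule actD(7)[OF c(4) x])
  moreover have "\<phi> (inv h') (\<phi> (n \<otimes> g) (\<phi> h x)) = \<phi> (inv h' \<otimes> (n \<otimes> g) \<otimes> h) x"
    using actD(4)[of "inv h'" "n \<otimes> g" "\<phi> h x"] actD(4)[of "inv h' \<otimes> (n \<otimes> g)" h x] c ng hx x by simp
  \<comment> \<open>The first factor is in \<open>N\<close> by normality and the second is in
    \<open>G\<close>, as the definition of \<open>separated\<close> requires.\<close>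
  moreover have "inv h' \<otimes> (n \<otimes> g) \<otimes> h = (inv h' \<otimes> n \<otimes> h') \<otimes> (inv h' \<otimes> g \<otimes> h)"
    using c by (simp add: m_assoc cancel_inv)
  ultimately have p: "(x, \<phi> ((inv h' \<otimes> n \<otimes> h') \<otimes> (inv h' \<otimes> g \<otimes> h)) x) \<in> adj K ^^ (i' + i)" by simp
  have hG: "h \<in> G" "h' \<in> G" using h H(2) by blast+
  have N': "inv h' \<otimes> n \<otimes> h' \<in> N" by (rule inv_op_closed1[OF c(4) n])
  have G': "inv h' \<otimes> g \<otimes> h \<in> G"
    by (intro subgroup.m_closed[OF G] subgroup.m_inv_closed[OF G] g hG)
  have i: "i' + i \<le> R" using y(3) by simp
  note * = sep[unfolded separated_def, rule_format, OF N' G' i p]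
  have "n = h' \<otimes> (inv h' \<otimes> n \<otimes> h') \<otimes> inv h'" using c by (simp add: m_assoc cancel_inv)
  hence "n = \<one>" using conjunct1[OF *] c by simp
  moreover have "g = h' \<otimes> (inv h' \<otimes> g \<otimes> h) \<otimes> inv h"
    using c by (simp add: m_assoc cancel_inv)
  moreover have "h' \<otimes> (inv h' \<otimes> g \<otimes> h) \<otimes> inv h \<in> H"
    by (intro subgroup.m_closed[OF H(1)] subgroup.m_inv_closed[OF H(1)] h conjunct2[OF *])
  ultimately show ?thesis by simp
qed

lemma ball_isomorphism_Q:
  assumes G: "subgroup G \<Gamma>" and H: "subgroup H \<Gamma>" "H \<subseteq> G" and x: "x \<in> verts K"
    and deg: "vertex_degree K \<le> ennreal D"
    and sep: "separated \<Gamma> K \<phi> G H N (2 * r + 1) x"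
  defines "GG \<equiv> \<Gamma>\<lparr>carrier := G\<rparr>" and "HH \<equiv> \<Gamma>\<lparr>carrier := H\<rparr>"
  defines "L \<equiv> components_meeting K (orbit HH \<phi> x)"
  shows "rooted_iso GG
    (ball_complex (real r) (ind_complex GG H L \<phi>) (ind_root GG H \<phi> (orbit HH \<phi> x)))
      (ind_action GG H L \<phi>) [ind_root GG H \<phi> (orbit HH \<phi> x)]
    (ball_complex (real r) Q (orbit GG qact (q x))) qact [orbit GG qact (q x)]"
proof -
  let ?R = "orbit HH \<phi> x" and ?S = "orbit GG qact (q x)"
  have cG: "carrier GG = G" and cH: "carrier HH = H" unfolding GG_def HH_def by simp_all
  have Gc: "g \<in> carrier \<Gamma>" if "g \<in> G" for g using subgroup.mem_carrier[OF G that] .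
  interpret GG: group GG unfolding GG_def by (rule subgroup.subgroup_is_group[OF G is_group])
  interpret I: subgroup_induction GG H unfolding GG_def by (rule subgroup_induction_restrict[OF G H])
  have invG: "inv\<^bsub>GG\<^esub> g = inv g" if "g \<in> G" for g
    unfolding GG_def by (rule m_inv_consistent[OF G that])
  have multG: "g \<otimes>\<^bsub>GG\<^esub> k = g \<otimes> k" for g k by (simp add: GG_def)
  have GH: "I.GH = HH" unfolding GG_def HH_def by simp
  have actH: "simplicial_action HH K \<phi>" unfolding HH_def by (rule simplicial_action_subgroup[OF act H(1)])
  note OR = orbit_rooted_components[OF actH deg x, folded L_def]
  have actL: "simplicial_action I.GH L \<phi>" unfolding GH by (rule orbit_rootedD(1)[OF OR(1)])
  have RL: "?R \<subseteq> verts L" unfolding OR(2) by (rule component_verts_center)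
  have RK: "?R \<subseteq> verts K" by (rule orbit_subset_verts[OF actH x])
  have Rinv: "\<phi> h y \<in> ?R" if "h \<in> H" "y \<in> ?R" for h y
    using orbit_closed[OF actH x that(2), of h] that(1) cH by simp
  have xR: "x \<in> ?R" by (rule orbit_self[OF actH x])
  define V where "V = ball_verts (real r) K ?R"
  define W where "W = ball_verts (real r) Q ?S"
  define B where "B = full_subcomplex K V"
  have VK: "V \<subseteq> verts K" unfolding V_def by (rule ball_verts_subset[OF RK])
  have Vinv: "\<phi> h y \<in> V" if "h \<in> H" "y \<in> V" for h y
    unfolding V_def by (rule ball_verts_invariant[OF actH _ Rinv]) (use that cH V_def in simp_all)
  have RV: "?R \<subseteq> V" unfolding V_def by (rule ball_verts_center) simp
  have vB: "verts B = V" unfolding B_def by (rule verts_full[OF actD(1) VK])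
  have actB: "simplicial_action I.GH B \<phi>"
    unfolding B_def GH by (rule simplicial_action_full[OF actH VK]) (use RV xR Vinv cH in auto)
  have VL: "V \<subseteq> verts L" unfolding OR(2) V_def by (rule ball_verts_component)
  have ballL: "ball_complex (real r) (ind_complex GG H L \<phi>) (ind_root GG H \<phi> ?R) = ind_complex GG H B \<phi>"
  proof -
    have "ball_complex (real r) L ?R = B"
      unfolding L_def ball_complex_components B_def V_def by (rule ball_complex_eq)
    thus ?thesis using I.ind_ball_complex[OF actL RL Rinv] by simp
  qed
  have Sverts: "?S \<subseteq> verts Q"
  proof -
    have "q x \<in> verts Q" unfolding verts_Q using x by blast
    thus ?thesis
      unfolding GG_def by (rule orbit_subset_verts[OF simplicial_action_subgroup[OF simplicial_action_Q G]])
  qed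
  have WQ: "W \<subseteq> verts Q" unfolding W_def by (rule ball_verts_subset[OF Sverts])
  have ballQ: "ball_complex (real r) Q ?S = full_subcomplex Q W" unfolding W_def by (rule ball_complex_eq)
  have vW: "verts (full_subcomplex Q W) = W"
    by (rule verts_full[OF simplicial_actionD(1)[OF simplicial_action_Q] WQ])
  have S_eq: "?S = {q (\<phi> g x) | g. g \<in> G}"
    unfolding orbit_def[of GG qact] cG using qact_q[OF Gc x] by auto
  have VE: "\<exists>h i. h \<in> H \<and> i \<le> r \<and> (\<phi> h x, y) \<in> adj K ^^ i" if "y \<in> V" for y
    using that unfolding V_def ball_verts_def orbit_def cH by auto
  have VI: "y \<in> V" if "h \<in> H" "i \<le> r" "(\<phi> h x, y) \<in> adj K ^^ i" for h i y
    using that unfolding V_def ball_verts_def orbit_def cH by auto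
  \<comment> \<open>The union over all pairs of a class avoids a choice: every pair contributes the
    same orbit.\<close>
  define F where "F X = (\<Union>(g, y)\<in>X. q (\<phi> g y))" for X
  have F: "F (ind_pt GG H \<phi> g y) = q (\<phi> g y)" if "g \<in> G" "y \<in> verts K" for g y
  proof -
    have "\<phi> (g \<otimes> h) (\<phi> (inv h) y) = \<phi> g y" if h: "h \<in> H" for h
    proof -
      have hG: "h \<in> carrier \<Gamma>" using h H(2) Gc by blast
      show ?thesis
        using actD(4)[OF Gc[OF \<open>g \<in> G\<close>] hG actD(5)[OF inv_closed[OF hG] \<open>y \<in> verts K\<close>]]
          actD(8)[OF hG \<open>y \<in> verts K\<close>] by simp
    qed
    moreover have "inv\<^bsub>GG\<^esub> h = inv h" if "h \<in> H" for h using invG H(2) that by blast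
    ultimately have "q (\<phi> (g \<otimes>\<^bsub>GG\<^esub> h) (\<phi> (inv\<^bsub>GG\<^esub> h) y)) = q (\<phi> g y)" if "h \<in> H" for h
      using that multG by simp
    moreover have "F (ind_pt GG H \<phi> g y) = (\<Union>h\<in>H. q (\<phi> (g \<otimes>\<^bsub>GG\<^esub> h) (\<phi> (inv\<^bsub>GG\<^esub> h) y)))"
      unfolding F_def ind_pt_def by auto
    ultimately show ?thesis using subgroup.one_closed[OF H(1)] by auto
  qed
  have img: "F ` verts (ind_complex GG H B \<phi>) = W"
  proof
    show "F ` verts (ind_complex GG H B \<phi>) \<subseteq> W"
    proof
      fix Y assume "Y \<in> F ` verts (ind_complex GG H B \<phi>)"
      then obtain g y where y: "g \<in> G" "y \<in> V" "Y = F (ind_pt GG H \<phi> g y)"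
        unfolding verts_ind_complex vB ind_root_def cG by blast
      have yK: "y \<in> verts K" using y(2) VK by blast
      obtain h i where h: "h \<in> H" "i \<le> r" "(\<phi> h x, y) \<in> adj K ^^ i" using VE[OF y(2)] by blast
      have hG: "h \<in> G" using h(1) H(2) by blast
      have "(\<phi> g (\<phi> h x), \<phi> g y) \<in> adj K ^^ i"
        by (rule relpow_image[of "adj K", OF simplicial_action_adj[OF act Gc[OF y(1)]] h(3)])
      hence "(\<phi> (g \<otimes> h) x, \<phi> g y) \<in> adj K ^^ i" using actD(4)[OF Gc[OF y(1)] Gc[OF hG] x] by simp
      from Q_relpowI[OF this] obtain m where m: "m \<le> i" "(q (\<phi> (g \<otimes> h) x), q (\<phi> g y)) \<in> adj Q ^^ m" by blast
      have "g \<otimes> h \<in> G" by (rule subgroup.m_closed[OF G y(1) hG])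
      hence "q (\<phi> (g \<otimes> h) x) \<in> ?S" unfolding S_eq by blast
      moreover have "real m \<le> real r" using m(1) h(2) by simp
      ultimately show "Y \<in> W" unfolding W_def ball_verts_def y(3) F[OF y(1) yK] using m(2) by blast
    qed
    show "W \<subseteq> F ` verts (ind_complex GG H B \<phi>)"
    proof
      fix Y assume "Y \<in> W"
      then obtain g i where g: "g \<in> G" "real i \<le> real r" "(q (\<phi> g x), Y) \<in> adj Q ^^ i"
        unfolding W_def ball_verts_def S_eq by blast
      have gx: "\<phi> g x \<in> verts K" by (rule actD(5)[OF Gc[OF g(1)] x])
      obtain y where y: "Y = q y" "(\<phi> g x, y) \<in> adj K ^^ i" using Q_relpowE[OF gx g(3)] by blast
      have yK: "y \<in> verts K" by (rule adj_relpow_verts[OF y(2) gx])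
      have "(\<phi> (inv g) (\<phi> g x), \<phi> (inv g) y) \<in> adj K ^^ i"
        by (rule relpow_image[of "adj K", OF simplicial_action_adj[OF act inv_closed[OF Gc[OF g(1)]]] y(2)])
      hence "(x, \<phi> (inv g) y) \<in> adj K ^^ i" using actD(7)[OF Gc[OF g(1)] x] by simp
      hence "\<phi> (inv g) y \<in> V" unfolding V_def ball_verts_def using xR g(2) by blast
      hence "ind_pt GG H \<phi> g (\<phi> (inv g) y) \<in> verts (ind_complex GG H B \<phi>)"
        unfolding verts_ind_complex vB by (intro ind_rootI) (use g(1) cG in simp_all)
      moreover have "Y = F (ind_pt GG H \<phi> g (\<phi> (inv g) y))"
        using F[OF g(1) actD(5)[OF inv_closed[OF Gc[OF g(1)]] yK]] actD(8)[OF Gc[OF g(1)] yK] y(1) by simp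
      ultimately show "Y \<in> F ` verts (ind_complex GG H B \<phi>)"
        by blast
    qed
  qed
  \<comment> \<open>Two classes with one image differ by some \<open>n' g'\<close>. Both points are
    within \<open>r\<close> of the \<open>H\<close>-orbit of \<open>x\<close>, so only an element of
    \<open>H\<close> remains, and the class absorbs it.\<close>
  have inj: "inj_on F (verts (ind_complex GG H B \<phi>))"
  proof (rule inj_onI)
    fix X Y assume XY: "X \<in> verts (ind_complex GG H B \<phi>)" "Y \<in> verts (ind_complex GG H B \<phi>)" "F X = F Y"
    obtain g y where y: "g \<in> G" "y \<in> V" "X = ind_pt GG H \<phi> g y"
      using XY(1) unfolding verts_ind_complex vB ind_root_def cG by blast
    obtain k z where z: "k \<in> G" "z \<in> V" "Y = ind_pt GG H \<phi> k z"
      using XY(2) unfolding verts_ind_complex vB ind_root_def cG by blast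
    have yK: "y \<in> verts K" and zK: "z \<in> verts K" using y(2) z(2) VK by blast+
    note gc = Gc[OF y(1)] and kc = Gc[OF z(1)]
    have "q (\<phi> k z) = q (\<phi> g y)" using XY(3) unfolding y(3) z(3) F[OF y(1) yK] F[OF z(1) zK] by simp
    then obtain n where n: "n \<in> N" "\<phi> k z = \<phi> n (\<phi> g y)" by (rule q_eqE[OF actD(5)[OF kc zK]])
    define n' where "n' = inv k \<otimes> n \<otimes> k"
    define g' where "g' = inv k \<otimes> g"
    have n': "n' \<in> N" unfolding n'_def by (rule inv_op_closed1[OF kc n(1)])
    have g': "g' \<in> G" unfolding g'_def by (rule subgroup.m_closed[OF G subgroup.m_inv_closed[OF G z(1)] y(1)])
    have nc: "n \<in> carrier \<Gamma>" using n(1) by simp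
    have "z = \<phi> (inv k) (\<phi> n (\<phi> g y))" using actD(7)[OF kc zK] n(2) by simp
    also have "\<dots> = \<phi> (inv k \<otimes> (n \<otimes> g)) y"
      using actD(4)[OF nc gc yK] actD(4)[of "inv k" "n \<otimes> g" y] kc nc gc yK by simp
    also have "inv k \<otimes> (n \<otimes> g) = n' \<otimes> g'"
    proof -
      show ?thesis unfolding n'_def g'_def using kc nc gc by (simp add: m_assoc cancel_inv)
    qed
    finally have z': "z = \<phi> (n' \<otimes> g') y" .
    obtain h i where h: "h \<in> H" "i \<le> r" "(\<phi> h x, y) \<in> adj K ^^ i" using VE[OF y(2)] by blast
    obtain h' i' where h': "h' \<in> H" "i' \<le> r" "(\<phi> h' x, z) \<in> adj K ^^ i'" using VE[OF z(2)] by blast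
    have "n' = \<one> \<and> g' \<in> H"
      by (rule separatedD[OF sep G H x n' g' h(1) h'(1) h(3) h'(3)[unfolded z']]) (use h(2) h'(2) in simp)
    hence g'H: "g' \<in> H" and "z = \<phi> g' y" using z' Gc[OF g'] by simp_all
    moreover have "g = k \<otimes>\<^bsub>GG\<^esub> g'" unfolding g'_def multG using kc gc by (simp add: m_assoc[symmetric])
    moreover have yB: "y \<in> verts B" unfolding vB by (rule y(2))
    ultimately show "X = Y"
      unfolding y(3) z(3) using I.ind_pt_shift[OF actB yB _ g'H, of k] z(1) cG by simp
  qed
  have simp_img: "F ` ind_pt GG H \<phi> g ` \<sigma> = q ` \<phi> g ` \<sigma>" if "g \<in> G" "\<sigma> \<in> K" for g \<sigma>
    unfolding image_image by (rule image_cong[OF refl]) (rule F[OF that(1) verts_insert[OF that(2)]])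
  have simps: "(`) F ` ind_complex GG H B \<phi> = full_subcomplex Q W"
  proof
    show "(`) F ` ind_complex GG H B \<phi> \<subseteq> full_subcomplex Q W"
    proof
      fix \<tau> assume "\<tau> \<in> (`) F ` ind_complex GG H B \<phi>"
      then obtain \<rho> where \<rho>: "\<rho> \<in> ind_complex GG H B \<phi>" "\<tau> = F ` \<rho>" by blast
      then obtain g \<sigma> where \<sigma>: "g \<in> G" "\<sigma> \<in> B" "\<rho> = ind_pt GG H \<phi> g ` \<sigma>"
        unfolding ind_complex_def cG by blast
      have \<sigma>K: "\<sigma> \<in> K" using \<sigma>(2) unfolding B_def full_subcomplex_def by blast
      have "\<tau> = q ` \<phi> g ` \<sigma>" unfolding \<rho>(2) \<sigma>(3) by (rule simp_img[OF \<sigma>(1) \<sigma>K])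
      hence "\<tau> \<in> Q" using QI[OF actD(2)[OF Gc[OF \<sigma>(1)] \<sigma>K]] by simp
      moreover have "\<rho> \<subseteq> verts (ind_complex GG H B \<phi>)" using \<rho>(1) by (auto intro: verts_insert)
      hence "\<tau> \<subseteq> W" unfolding \<rho>(2) img[symmetric] by (rule image_mono)
      ultimately show "\<tau> \<in> full_subcomplex Q W" unfolding full_subcomplex_def by blast
    qed
    show "full_subcomplex Q W \<subseteq> (`) F ` ind_complex GG H B \<phi>"
    proof
      fix \<tau> assume "\<tau> \<in> full_subcomplex Q W"
      hence \<tau>: "\<tau> \<in> Q" "\<tau> \<subseteq> W" unfolding full_subcomplex_def by blast+
      have WE: "\<exists>g y. g \<in> G \<and> y \<in> V \<and> Y = q (\<phi> g y)" if "Y \<in> W" for Y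
      proof -
        obtain g y where "g \<in> G" "y \<in> V" "Y = F (ind_pt GG H \<phi> g y)"
          using \<open>Y \<in> W\<close> unfolding img[symmetric] verts_ind_complex vB ind_root_def cG by blast
        thus ?thesis using F VK by blast
      qed
      have "\<tau> \<noteq> {}" by (rule simplicial_complexD(2)[OF simplicial_actionD(1)[OF simplicial_action_Q] \<tau>(1)])
      then obtain Y where "Y \<in> \<tau>" by blast
      moreover obtain g y where y: "g \<in> G" "y \<in> V" "Y = q (\<phi> g y)" using WE \<tau>(2) \<open>Y \<in> \<tau>\<close> by blast
      ultimately have Y\<tau>: "q (\<phi> g y) \<in> \<tau>" by simp
      note gc = Gc[OF y(1)]
      have yK: "y \<in> verts K" using y(2) VK by blast
      \<comment> \<open>The simplex is lifted through a vertex that comes from the ball; it remains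
        to see that the other vertices of the lift, moved back by \<open>g\<close>, lie in the ball
        too.\<close>
      obtain \<sigma> where \<sigma>: "\<sigma> \<in> K" "\<phi> g y \<in> \<sigma>" "\<tau> = q ` \<sigma>"
        by (rule Q_liftE[OF \<tau>(1) Y\<tau> actD(5)[OF gc yK]])
      define \<sigma>' where "\<sigma>' = \<phi> (inv g) ` \<sigma>"
      have \<sigma>'K: "\<sigma>' \<in> K" unfolding \<sigma>'_def by (rule actD(2)[OF inv_closed[OF gc] \<sigma>(1)])
      have y\<sigma>': "y \<in> \<sigma>'" unfolding \<sigma>'_def using \<sigma>(2) actD(7)[OF gc yK] by force
      have "\<phi> g ` \<sigma>' = (\<lambda>z. z) ` \<sigma>"
        unfolding \<sigma>'_def image_image by (rule image_cong[OF refl]) (rule actD(8)[OF gc verts_insert[OF \<sigma>(1)]])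
      hence g\<sigma>': "\<phi> g ` \<sigma>' = \<sigma>" by simp
      obtain h i where h: "h \<in> H" "i \<le> r" "(\<phi> h x, y) \<in> adj K ^^ i" using VE[OF y(2)] by blast
      have "w \<in> V" if w: "w \<in> \<sigma>'" for w
      proof -
        have wK: "w \<in> verts K" by (rule verts_insert[OF \<sigma>'K w])
        have "q (\<phi> g w) \<in> W" using w g\<sigma>' \<sigma>(3) \<tau>(2) by blast
        then obtain k z where z: "k \<in> G" "z \<in> V" "q (\<phi> g w) = q (\<phi> k z)" using WE by blast
        note kc = Gc[OF z(1)]
        have zK: "z \<in> verts K" using z(2) VK by blast
        obtain n where n: "n \<in> N" "\<phi> g w = \<phi> n (\<phi> k z)" by (rule q_eqE[OF actD(5)[OF gc wK] z(3)])
        define n' where "n' = inv g \<otimes> n \<otimes> g"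
        define k' where "k' = inv g \<otimes> k"
        have n': "n' \<in> N" unfolding n'_def by (rule inv_op_closed1[OF gc n(1)])
        have k': "k' \<in> G" unfolding k'_def by (rule subgroup.m_closed[OF G subgroup.m_inv_closed[OF G y(1)] z(1)])
        have nc: "n \<in> carrier \<Gamma>" using n(1) by simp
        have "w = \<phi> (inv g) (\<phi> n (\<phi> k z))" using actD(7)[OF gc wK] n(2) by simp
        also have "\<dots> = \<phi> (inv g \<otimes> (n \<otimes> k)) z"
          using actD(4)[OF nc kc zK] actD(4)[of "inv g" "n \<otimes> k" z] kc nc gc zK by simp
        also have "inv g \<otimes> (n \<otimes> k) = n' \<otimes> k'"
        proof -
          show ?thesis unfolding n'_def k'_def using kc nc gc by (simp add: m_assoc cancel_inv)
        qed
        finally have w': "w = \<phi> (n' \<otimes> k') z" .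
        obtain h' i' where h': "h' \<in> H" "i' \<le> r" "(\<phi> h' x, z) \<in> adj K ^^ i'" using VE[OF z(2)] by blast
        \<comment> \<open>Only the image of \<open>w\<close> is known to lie in the ball, but
          \<open>w\<close> equals \<open>y\<close> or is adjacent to it, so it is within
          \<open>r + 1\<close> of the \<open>H\<close>-orbit. Together with the radius
          \<open>r\<close> for \<open>z\<close> this is where \<open>2 r + 1\<close> is used
          up.\<close>
        have "\<exists>j\<le>Suc i. (\<phi> h x, w) \<in> adj K ^^ j"
        proof (cases "w = y")
          case True
          thus ?thesis using h(3) by (intro exI[of _ i]) simp
        next
          case False
          have "{y, w} \<in> K"
            by (rule simplicial_complexD(4)[OF actD(1) \<sigma>'K]) (use w y\<sigma>' in auto)
          hence "(y, w) \<in> adj K" using False by (simp add: adj_def)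
          hence "(\<phi> h x, w) \<in> adj K ^^ Suc i" using h(3) by auto
          thus ?thesis by blast
        qed
        then obtain j where j: "j \<le> Suc i" "(\<phi> h x, \<phi> (n' \<otimes> k') z) \<in> adj K ^^ j" unfolding w' by blast
        have "n' = \<one> \<and> k' \<in> H"
          by (rule separatedD[OF sep G H x n' k' h'(1) h(1) h'(3) j(2)]) (use j(1) h(2) h'(2) in simp)
        hence "k' \<in> H" "w = \<phi> k' z" using w' Gc[OF k'] by simp_all
        thus "w \<in> V" using Vinv z(2) by simp
      qed
      hence "\<sigma>' \<in> B" unfolding B_def full_subcomplex_def using \<sigma>'K by blast
      hence "ind_pt GG H \<phi> g ` \<sigma>' \<in> ind_complex GG H B \<phi>"
        by (intro ind_complexI) (use y(1) cG in simp)
      moreover have "\<tau> = F ` ind_pt GG H \<phi> g ` \<sigma>'" unfolding simp_img[OF y(1) \<sigma>'K] g\<sigma>' by (rule \<sigma>(3))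
      ultimately show "\<tau> \<in> (`) F ` ind_complex GG H B \<phi>"
        by blast
    qed
  qed
  have "rooted_isomorphism F GG (ind_complex GG H B \<phi>) (ind_action GG H L \<phi>) [ind_root GG H \<phi> ?R]
    (full_subcomplex Q W) qact [?S]"
  proof (rule rooted_isomorphismI)
    show "inj_on F (verts (ind_complex GG H B \<phi>))" by (rule inj)
    show "F ` verts (ind_complex GG H B \<phi>) = verts (full_subcomplex Q W)" unfolding vW by (rule img)
    show "(`) F ` ind_complex GG H B \<phi> = full_subcomplex Q W" by (rule simps)
    have "ind_root GG H \<phi> ?R = (\<lambda>g. ind_pt GG H \<phi> g x) ` G"
    proof -
      have "x \<in> verts L" using xR RL by blast
      from I.ind_root_orbit[OF actL this]
      show ?thesis unfolding GH orbit_image[of GG] cG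
        using I.ind_action_pt[OF \<open>x \<in> verts L\<close> GG.one_closed] cG by (auto simp: image_iff)
    qed
    moreover have "F ` (\<lambda>g. ind_pt GG H \<phi> g x) ` G = ?S"
      unfolding S_eq image_image using F[OF _ x] by auto
    ultimately show "map ((`) F) [ind_root GG H \<phi> ?R] = [?S]" by simp
    fix k X assume k: "k \<in> carrier GG" and X: "X \<in> verts (ind_complex GG H B \<phi>)"
    obtain g y where y: "g \<in> G" "y \<in> V" "X = ind_pt GG H \<phi> g y"
      using X unfolding verts_ind_complex vB ind_root_def cG by blast
    have kG: "k \<in> G" using k cG by simp
    have yK: "y \<in> verts K" and yL: "y \<in> verts L" using y(2) VK VL by blast+
    have kg: "k \<otimes> g \<in> G" by (rule subgroup.m_closed[OF G kG y(1)])
    have "F (ind_action GG H L \<phi> k X) = q (\<phi> (k \<otimes> g) y)"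
      unfolding y(3) using I.ind_action_pt[OF yL _ k, of g \<phi>] y(1) cG F[OF kg yK] multG by simp
    also have "\<dots> = qact k (F X)"
      unfolding y(3) F[OF y(1) yK]
      using qact_q[OF Gc[OF kG] actD(5)[OF Gc[OF y(1)] yK]] actD(4)[OF Gc[OF kG] Gc[OF y(1)] yK] by simp
    finally show "F (ind_action GG H L \<phi> k X) = qact k (F X)" .
  qed
  thus ?thesis unfolding ballL ballQ rooted_iso_iff by blast
qed

end

section \<open>Averages over cosets\<close>

definition coset_rep :: "'a set \<Rightarrow> 'a" where
  "coset_rep C = (SOME g. g \<in> C)"

text \<open>A mean over the set of right cosets. For functions invariant under left multiplication
  by \<open>M\<close> it does not depend on the choice made by \<open>coset_rep\<close>.\<close>

definition coset_mean :: "('a, 'b) monoid_scheme \<Rightarrow> 'a set \<Rightarrow> ('a \<Rightarrow> real) \<Rightarrow> real" where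
  "coset_mean G M u = (\<Sum>C\<in>rcosets\<^bsub>G\<^esub> M. u (coset_rep C)) / real (card (rcosets\<^bsub>G\<^esub> M))"

definition left_invariant :: "('a, 'b) monoid_scheme \<Rightarrow> 'a set \<Rightarrow> ('a \<Rightarrow> 'c) \<Rightarrow> bool" where
  "left_invariant G M u \<longleftrightarrow> (\<forall>m\<in>M. \<forall>g\<in>carrier G. u (m \<otimes>\<^bsub>G\<^esub> g) = u g)"

lemma fundamental_domainE:
  assumes "fundamental_domain G (verts K) \<phi> F" "simplicial_action G K \<phi>" "y \<in> verts K"
  obtains x where "x \<in> F" "y \<in> orbit G \<phi> x" "x \<in> orbit G \<phi> y"
    "\<And>z. z \<in> F \<Longrightarrow> y \<in> orbit G \<phi> z \<Longrightarrow> z = x"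
proof -
  have F: "F \<subseteq> verts K" and R: "\<And>R. R \<in> orbits G (verts K) \<phi> \<Longrightarrow> \<exists>!x. x \<in> F \<and> x \<in> R"
    using assms(1) unfolding fundamental_domain_def by blast+
  have sym: "a \<in> orbit G \<phi> b" if "a \<in> verts K" "b \<in> verts K" "b \<in> orbit G \<phi> a" for a b
  proof -
    obtain g where "g \<in> carrier G" "b = \<phi> g a" using \<open>b \<in> orbit G \<phi> a\<close> unfolding orbit_def by blast
    thus ?thesis using orbit_translate[OF assms(2) that(1)] orbit_self[OF assms(2) that(1)] by simp
  qed
  have "orbit G \<phi> y \<in> orbits G (verts K) \<phi>" unfolding orbits_def using assms(3) by blast
  from R[OF this] obtain x where x: "x \<in> F" "x \<in> orbit G \<phi> y"
    and uniq: "\<And>z. z \<in> F \<Longrightarrow> z \<in> orbit G \<phi> y \<Longrightarrow> z = x" by blast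
  show thesis
  proof (rule that[OF x(1) _ x(2)])
    show "y \<in> orbit G \<phi> x" by (rule sym[OF assms(3) _ x(2)]) (use x(1) F in blast)
    show "z = x" if "z \<in> F" "y \<in> orbit G \<phi> z" for z
      by (rule uniq[OF that(1) sym[OF _ assms(3) that(2)]]) (use that(1) F in blast)
  qed
qed

lemma fundamental_domain_exists:
  assumes K: "simplicial_action G K \<phi>"
  obtains F where "fundamental_domain G (verts K) \<phi> F"
proof -
  define F where "F = (\<lambda>R. SOME x. x \<in> R) ` orbits G (verts K) \<phi>"
  have mem: "(SOME x. x \<in> R) \<in> R" if "R \<in> orbits G (verts K) \<phi>" for R
  proof -
    obtain y where y: "y \<in> verts K" "R = orbit G \<phi> y"
      using \<open>R \<in> orbits G (verts K) \<phi>\<close> unfolding orbits_def by blast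
    show ?thesis unfolding y(2) by (rule someI) (rule orbit_self[OF K y(1)])
  qed
  have eq: "R = R'" if R: "R \<in> orbits G (verts K) \<phi>" "R' \<in> orbits G (verts K) \<phi>" and z: "z \<in> R" "z \<in> R'" for R R' z
  proof -
    have "R = orbit G \<phi> z" if R: "R \<in> orbits G (verts K) \<phi>" "z \<in> R" for R
    proof -
      obtain y where y: "y \<in> verts K" "R = orbit G \<phi> y" using R(1) unfolding orbits_def by blast
      obtain g where "g \<in> carrier G" "z = \<phi> g y" using R(2) y(2) unfolding orbit_def by blast
      thus ?thesis using orbit_translate[OF K y(1)] y(2) by simp
    qed
    thus ?thesis using R z by blast
  qed
  have "F \<subseteq> verts K"
  proof
    fix x assume "x \<in> F"
    then obtain R where R: "R \<in> orbits G (verts K) \<phi>" "x = (SOME x. x \<in> R)" unfolding F_def by blast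
    obtain y where y: "y \<in> verts K" "R = orbit G \<phi> y" using R(1) unfolding orbits_def by blast
    thus "x \<in> verts K" using mem[OF R(1)] R(2) orbit_subset_verts[OF K y(1)] by auto
  qed
  moreover have "\<exists>!x. x \<in> F \<and> x \<in> R" if R: "R \<in> orbits G (verts K) \<phi>" for R
  proof (rule ex1I[of _ "SOME x. x \<in> R"])
    show "(SOME x. x \<in> R) \<in> F \<and> (SOME x. x \<in> R) \<in> R" using mem[OF R] R unfolding F_def by blast
    fix x assume x: "x \<in> F \<and> x \<in> R"
    then obtain R' where R': "R' \<in> orbits G (verts K) \<phi>" "x = (SOME x. x \<in> R')" unfolding F_def by blast
    have "R' = R" by (rule eq[OF R'(1) R, of x]) (use mem[OF R'(1)] R'(2) x in auto)
    thus "x = (SOME x. x \<in> R)" using R'(2) by simp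
  qed
  ultimately have "fundamental_domain G (verts K) \<phi> F" unfolding fundamental_domain_def by blast
  thus thesis by (rule that)
qed

lemma finite_fundamental_domain:
  assumes "fundamental_domain G (verts K) \<phi> F" "simplicial_action G K \<phi>" "finite (orbits G (verts K) \<phi>)"
  shows "finite F"
proof -
  have F: "F \<subseteq> verts K" and R: "\<And>R. R \<in> orbits G (verts K) \<phi> \<Longrightarrow> \<exists>!x. x \<in> F \<and> x \<in> R"
    using assms(1) unfolding fundamental_domain_def by blast+
  have "inj_on (orbit G \<phi>) F"
  proof (rule inj_onI)
    fix x y assume xy: "x \<in> F" "y \<in> F" "orbit G \<phi> x = orbit G \<phi> y"
    have v: "x \<in> verts K" "y \<in> verts K" using xy F by blast+
    have "orbit G \<phi> x \<in> orbits G (verts K) \<phi>" unfolding orbits_def using v(1) by blast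
    moreover have "x \<in> orbit G \<phi> x" by (rule orbit_self[OF assms(2) v(1)])
    moreover have "y \<in> orbit G \<phi> x" using orbit_self[OF assms(2) v(2)] xy(3) by simp
    ultimately show "x = y" using R xy(1,2) by blast
  qed
  moreover have "orbit G \<phi> ` F \<subseteq> orbits G (verts K) \<phi>" unfolding orbits_def using F by blast
  ultimately show ?thesis using assms(3) inj_on_finite by blast
qed

section \<open>Refining means to subgroups of finite index\<close>

context group
begin

lemma rcosetsE:
  assumes "C \<in> rcosets M"
  obtains g where "g \<in> carrier G" "C = M #> g"
  using assms unfolding RCOSETS_def by blast

lemma coset_rep:
  assumes M: "subgroup M G" and C: "C \<in> rcosets M"
  shows "coset_rep C \<in> C" "coset_rep C \<in> carrier G" "M #> coset_rep C = C"
proof -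
  obtain g where g: "g \<in> carrier G" "C = M #> g" by (rule rcosetsE[OF C])
  have "g \<in> C" unfolding g(2) by (rule rcos_self[OF g(1) M])
  thus in_C: "coset_rep C \<in> C" unfolding coset_rep_def by (rule someI)
  show "coset_rep C \<in> carrier G" using in_C r_coset_subset_G[OF subgroup.subset[OF M] g(1)] g(2) by blast
  show "M #> coset_rep C = C" using repr_independence[OF in_C[unfolded g(2)] g(1) M] g(2) by simp
qed

lemma left_invariant_coset:
  assumes u: "left_invariant G M u" and M: "subgroup M G" and "a \<in> carrier G" "b \<in> carrier G" "M #> a = M #> b"
  shows "u a = u b"
proof -
  have "a \<in> M #> b" using rcos_self[OF assms(3) M] assms(5) by simp
  then obtain m where "m \<in> M" "a = m \<otimes> b" unfolding r_coset_def by blast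
  thus ?thesis using u assms(4) unfolding left_invariant_def by simp
qed

lemma left_invariant_rep:
  assumes "left_invariant G M u" "subgroup M G" "a \<in> carrier G"
  shows "u (coset_rep (M #> a)) = u a"
proof -
  note C = rcosetsI[OF subgroup.subset[OF assms(2)] assms(3)]
  show ?thesis by (rule left_invariant_coset[OF assms(1,2) coset_rep(2)[OF assms(2) C] assms(3) coset_rep(3)[OF assms(2) C]])
qed

lemma rcosets_subset_eq:
  assumes "subgroup M G" "subgroup M' G" "M' \<subseteq> M" "C \<in> rcosets M'" "D \<in> rcosets M"
  shows "C \<subseteq> D \<longleftrightarrow> M #> coset_rep C = D"
proof -
  note c = coset_rep[OF assms(2,4)]
  obtain d where d: "d \<in> carrier G" "D = M #> d" by (rule rcosetsE[OF assms(5)])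
  show ?thesis
  proof
    assume "C \<subseteq> D"
    hence "coset_rep C \<in> M #> d" using c(1) d(2) by blast
    thus "M #> coset_rep C = D" using repr_independence[OF _ d(1) assms(1)] d(2) by simp
  next
    assume "M #> coset_rep C = D"
    moreover have "M' #> coset_rep C \<subseteq> M #> coset_rep C" unfolding r_coset_def using assms(3) by blast
    ultimately show "C \<subseteq> D" using c(3) by simp
  qed
qed

lemma rcoset_translate:
  assumes "subgroup M G" "t \<in> carrier G" "C \<in> rcosets M"
  shows "C #> t \<in> rcosets M" "C #> t #> inv t = C" "C #> t = M #> (coset_rep C \<otimes> t)"
proof -
  note c = coset_rep[OF assms(1,3)]
  have Mc: "M \<subseteq> carrier G" by (rule subgroup.subset[OF assms(1)])
  show eq: "C #> t = M #> (coset_rep C \<otimes> t)" using coset_mult_assoc[OF Mc c(2) assms(2)] c(3) by simp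
  show "C #> t \<in> rcosets M" unfolding eq by (rule rcosetsI[OF Mc]) (use c(2) assms(2) in simp)
  have "C #> t #> inv t = M #> (coset_rep C \<otimes> t \<otimes> inv t)"
    unfolding eq by (rule coset_mult_assoc[OF Mc]) (use c(2) assms(2) in simp_all)
  also have "coset_rep C \<otimes> t \<otimes> inv t = coset_rep C" using c(2) assms(2) by (simp add: m_assoc)
  finally show "C #> t #> inv t = C" using c(3) by simp
qed

text \<open>Right translation carries the subcosets of one coset to those of another, so all cosets
  of \<open>M\<close> split into equally many cosets of \<open>M'\<close>. Coset counts take the
  place of orders, as the groups may be infinite.\<close>

lemma card_subcosets:
  assumes M: "subgroup M G" and M': "subgroup M' G" "M' \<subseteq> M" and "D \<in> rcosets M"
  shows "card {C \<in> rcosets M'. C \<subseteq> D} = card {C \<in> rcosets M'. C \<subseteq> M}"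
proof -
  let ?d = "coset_rep D"
  note d = coset_rep[OF M assms(4)]
  have Mc: "M \<subseteq> carrier G" by (rule subgroup.subset[OF M])
  have mono: "A #> t \<subseteq> B #> t" if "A \<subseteq> B" for A B t using that unfolding r_coset_def by blast
  have "M \<in> rcosets M" using rcosetsI[OF Mc one_closed] Mc by simp
  from rcoset_translate(2)[OF M d(2) this] have M2: "D #> inv ?d = M" using d(3) by simp
  have idc: "inv ?d \<in> carrier G" using d(2) by simp
  have "bij_betw (\<lambda>C. C #> inv ?d) {C \<in> rcosets M'. C \<subseteq> D} {C \<in> rcosets M'. C \<subseteq> M}"
  proof (rule bij_betw_byWitness[where f' = "\<lambda>C. C #> ?d"])
    show "\<forall>C\<in>{C \<in> rcosets M'. C \<subseteq> D}. C #> inv ?d #> ?d = C"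
      using rcoset_translate(2)[OF M'(1) idc] d(2) by simp
    show "\<forall>C\<in>{C \<in> rcosets M'. C \<subseteq> M}. C #> ?d #> inv ?d = C"
      using rcoset_translate(2)[OF M'(1) d(2)] by simp
    show "(\<lambda>C. C #> inv ?d) ` {C \<in> rcosets M'. C \<subseteq> D} \<subseteq> {C \<in> rcosets M'. C \<subseteq> M}"
      using rcoset_translate(1)[OF M'(1) idc] mono[of _ D "inv ?d"] unfolding M2 by blast
    show "(\<lambda>C. C #> ?d) ` {C \<in> rcosets M'. C \<subseteq> M} \<subseteq> {C \<in> rcosets M'. C \<subseteq> D}"
      using rcoset_translate(1)[OF M'(1) d(2)] mono[of _ M ?d] unfolding d(3) by blast
  qed
  thus ?thesis by (rule bij_betw_same_card)
qed

lemma sum_rcosets_refine: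
  fixes u :: "'a \<Rightarrow> real"
  assumes M: "subgroup M G" "finite (rcosets M)" and M': "subgroup M' G" "M' \<subseteq> M" "finite (rcosets M')"
    and u: "left_invariant G M u"
  shows "(\<Sum>C\<in>rcosets M'. u (coset_rep C)) =
    real (card {C \<in> rcosets M'. C \<subseteq> M}) * (\<Sum>D\<in>rcosets M. u (coset_rep D))"
proof -
  let ?p = "\<lambda>C. M #> coset_rep C"
  have p: "?p ` (rcosets M') \<subseteq> rcosets M"
    using rcosetsI[OF subgroup.subset[OF M(1)]] coset_rep(2)[OF M'(1)] by blast
  have "(\<Sum>C\<in>rcosets M'. u (coset_rep C)) = (\<Sum>D\<in>rcosets M. \<Sum>C\<in>{C \<in> rcosets M'. ?p C = D}. u (coset_rep C))"
    by (rule sum.group[OF M'(3) M(2) p, symmetric])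
  also have "\<dots> = (\<Sum>D\<in>rcosets M. real (card {C \<in> rcosets M'. C \<subseteq> M}) * u (coset_rep D))"
  proof (rule sum.cong[OF refl])
    fix D assume D: "D \<in> rcosets M"
    have set_eq: "{C \<in> rcosets M'. ?p C = D} = {C \<in> rcosets M'. C \<subseteq> D}"
      using rcosets_subset_eq[OF M(1) M'(1,2) _ D] by blast
    have "u (coset_rep C) = u (coset_rep D)" if "C \<in> {C \<in> rcosets M'. ?p C = D}" for C
    proof -
      have C: "C \<in> rcosets M'" "?p C = D" using that by blast+
      show ?thesis
        by (rule left_invariant_coset[OF u M(1) coset_rep(2)[OF M'(1) C(1)] coset_rep(2)[OF M(1) D]])
          (simp add: C(2) coset_rep(3)[OF M(1) D])
    qed
    hence "(\<Sum>C\<in>{C \<in> rcosets M'. ?p C = D}. u (coset_rep C)) = real (card {C \<in> rcosets M'. ?p C = D}) * u (coset_rep D)"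
      by simp
    thus "(\<Sum>C\<in>{C \<in> rcosets M'. ?p C = D}. u (coset_rep C)) = real (card {C \<in> rcosets M'. C \<subseteq> M}) * u (coset_rep D)"
      unfolding set_eq card_subcosets[OF M(1) M'(1,2) D] .
  qed
  finally show ?thesis by (simp add: sum_distrib_left)
qed

lemma card_rcosets_pos:
  assumes "subgroup M G" "finite (rcosets M)"
  shows "card (rcosets M) > 0"
  using rcosetsI[OF subgroup.subset[OF assms(1)] one_closed] assms(2) by (auto simp: card_gt_0_iff)

text \<open>The function is constant on each coset of \<open>M\<close>, and the number of cosets of
  \<open>M'\<close> in it cancels from the quotient. So means over unrelated subgroups can be
  compared on their intersection.\<close>

lemma coset_mean_refine:
  assumes M: "subgroup M G" "finite (rcosets M)" and M': "subgroup M' G" "M' \<subseteq> M" "finite (rcosets M')"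
    and u: "left_invariant G M u"
  shows "coset_mean G M' u = coset_mean G M u"
proof -
  let ?k = "card {C \<in> rcosets M'. C \<subseteq> M}"
  have "left_invariant G M (\<lambda>_. 1::real)" unfolding left_invariant_def by simp
  from sum_rcosets_refine[OF M M' this] have c: "real (card (rcosets M')) = real ?k * real (card (rcosets M))" by simp
  have "real (card (rcosets M')) > 0" using card_rcosets_pos[OF M'(1,3)] by simp
  hence "?k \<noteq> 0" using c by (metis mult_zero_left of_nat_0 less_irrefl)
  thus ?thesis unfolding coset_mean_def sum_rcosets_refine[OF assms] c by simp
qed

text \<open>A coset of the intersection is the intersection of two cosets, so there are at most as
  many as pairs.\<close>

lemma finite_rcosets_Int:
  assumes A: "subgroup A G" "finite (rcosets A)" and B: "subgroup B G" "finite (rcosets B)"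
  shows "finite (rcosets (A \<inter> B))"
proof -
  have "rcosets (A \<inter> B) \<subseteq> (\<lambda>(X, Y). X \<inter> Y) ` ((rcosets A) \<times> (rcosets B))"
  proof
    fix C assume "C \<in> rcosets (A \<inter> B)"
    then obtain g where g: "g \<in> carrier G" "C = (A \<inter> B) #> g" by (rule rcosetsE)
    have "C = (A #> g) \<inter> (B #> g)"
    proof
      show "C \<subseteq> (A #> g) \<inter> (B #> g)" unfolding g(2) r_coset_def by blast
      show "(A #> g) \<inter> (B #> g) \<subseteq> C"
      proof
        fix x assume "x \<in> (A #> g) \<inter> (B #> g)"
        then obtain a b where ab: "a \<in> A" "x = a \<otimes> g" "b \<in> B" "x = b \<otimes> g" unfolding r_coset_def by blast
        have "a = b" using ab g(1) subgroup.mem_carrier[OF A(1)] subgroup.mem_carrier[OF B(1)]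
          by (metis right_cancel)
        thus "x \<in> C" unfolding g(2) r_coset_def using ab by blast
      qed
    qed
    moreover have "A #> g \<in> rcosets A" "B #> g \<in> rcosets B"
      using rcosetsI[OF subgroup.subset g(1)] A(1) B(1) by blast+
    ultimately show "C \<in> (\<lambda>(X, Y). X \<inter> Y) ` ((rcosets A) \<times> (rcosets B))" by blast
  qed
  thus ?thesis by (rule finite_subset) (use A(2) B(2) in simp)
qed

section \<open>Orbit sums\<close>

text \<open>The transporter from \<open>x\<close> to \<open>\<phi> d x\<close> is a left coset of
  the stabilizer; through this, stabilizer orders enter all the counts below.\<close>

lemma bij_betw_transporter:
  assumes K: "simplicial_action G K \<phi>" and x: "x \<in> verts K" and d: "d \<in> carrier G"
  shows "bij_betw (\<lambda>s. d \<otimes> s) (stabilizer G \<phi> x) {g \<in> carrier G. \<phi> g x = \<phi> d x}"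
proof (rule bij_betw_byWitness[where f' = "\<lambda>g. inv d \<otimes> g"])
  note act = simplicial_actionD[OF K] simplicial_action_inv[OF K]
  show "\<forall>s\<in>stabilizer G \<phi> x. inv d \<otimes> (d \<otimes> s) = s"
    "\<forall>g\<in>{g \<in> carrier G. \<phi> g x = \<phi> d x}. d \<otimes> (inv d \<otimes> g) = g"
    unfolding stabilizer_def using d by (auto simp: cancel_inv)
  show "(\<otimes>) d ` stabilizer G \<phi> x \<subseteq> {g \<in> carrier G. \<phi> g x = \<phi> d x}"
    unfolding stabilizer_def using act(4)[OF d _ x] d by auto
  show "(\<otimes>) (inv d) ` {g \<in> carrier G. \<phi> g x = \<phi> d x} \<subseteq> stabilizer G \<phi> x"
    unfolding stabilizer_def using act(4)[OF inv_closed[OF d] _ x] act(7)[OF d x] d by auto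
qed

text \<open>Double counting of the elements that move \<open>x0\<close> to \<open>x\<close>: there
  are as many as in the stabilizer of \<open>x0\<close>, and those in one right coset of
  \<open>M\<close> form a copy of the stabilizer of \<open>x\<close> in \<open>M\<close>.\<close>

lemma card_cosets_to:
  assumes K: "simplicial_action G K \<phi>" and M: "subgroup M G" "finite (rcosets M)"
    and x0: "x0 \<in> verts K" and fin: "finite (stabilizer G \<phi> x0)" and d: "d \<in> carrier G"
  defines "x \<equiv> \<phi> d x0" and "MM \<equiv> G\<lparr>carrier := M\<rparr>"
  shows "card {C \<in> rcosets M. \<phi> (coset_rep C) x0 \<in> orbit MM \<phi> x} * card (stabilizer MM \<phi> x)
    = card (stabilizer G \<phi> x0)"
    and "finite (stabilizer MM \<phi> x)" "card (stabilizer MM \<phi> x) > 0"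
proof -
  note act = simplicial_actionD[OF K] simplicial_action_inv[OF K]
  have Mc: "m \<in> carrier G" if "m \<in> M" for m using subgroup.mem_carrier[OF M(1) that] .
  have xv: "x \<in> verts K" unfolding x_def by (rule act(5)[OF d x0])
  define T where "T = {g \<in> carrier G. \<phi> g x0 = x}"
  define A where "A = {C \<in> rcosets M. \<phi> (coset_rep C) x0 \<in> orbit MM \<phi> x}"
  have cT: "bij_betw (\<lambda>s. d \<otimes> s) (stabilizer G \<phi> x0) T"
    unfolding T_def x_def by (rule bij_betw_transporter[OF K x0 d])
  have finT: "finite T" using bij_betw_finite[OF cT] fin by simp
  have fiber: "bij_betw (\<lambda>m. m \<otimes> g) (stabilizer MM \<phi> x) {g' \<in> T. M #> g' = M #> g}" if g: "g \<in> T" for g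
  proof (rule bij_betw_byWitness[where f' = "\<lambda>g'. g' \<otimes> inv g"])
    have gc: "g \<in> carrier G" "\<phi> g x0 = x" using g unfolding T_def by blast+
    show "\<forall>m\<in>stabilizer MM \<phi> x. m \<otimes> g \<otimes> inv g = m"
      unfolding stabilizer_def MM_def using gc Mc by (auto simp: m_assoc)
    show "\<forall>g'\<in>{g' \<in> T. M #> g' = M #> g}. g' \<otimes> inv g \<otimes> g = g'"
      unfolding T_def using gc by (auto simp: m_assoc)
    show "(\<lambda>m. m \<otimes> g) ` stabilizer MM \<phi> x \<subseteq> {g' \<in> T. M #> g' = M #> g}"
    proof
      fix g' assume "g' \<in> (\<lambda>m. m \<otimes> g) ` stabilizer MM \<phi> x"
      then obtain m where m: "m \<in> M" "\<phi> m x = x" "g' = m \<otimes> g" unfolding stabilizer_def MM_def by auto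
      have "\<phi> g' x0 = x" using act(4)[OF Mc[OF m(1)] gc(1) x0] m gc(2) by simp
      hence "g' \<in> T" unfolding T_def using m Mc gc(1) by simp
      moreover have "g' \<in> M #> g" unfolding m(3) by (rule rcosI[OF m(1) subgroup.subset[OF M(1)] gc(1)])
      hence "M #> g' = M #> g" using repr_independence[OF _ gc(1) M(1)] by simp
      ultimately show "g' \<in> {g' \<in> T. M #> g' = M #> g}" by blast
    qed
    show "(\<lambda>g'. g' \<otimes> inv g) ` {g' \<in> T. M #> g' = M #> g} \<subseteq> stabilizer MM \<phi> x"
    proof
      fix m assume "m \<in> (\<lambda>g'. g' \<otimes> inv g) ` {g' \<in> T. M #> g' = M #> g}"
      then obtain g' where g': "g' \<in> carrier G" "\<phi> g' x0 = x" "M #> g' = M #> g" "m = g' \<otimes> inv g"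
        unfolding T_def by blast
      have "g' \<in> M #> g" using rcos_self[OF g'(1) M(1)] g'(3) by simp
      then obtain k where "k \<in> M" "g' = k \<otimes> g" unfolding r_coset_def by blast
      hence "m \<in> M" using g'(4) gc(1) Mc by (simp add: m_assoc)
      moreover have "\<phi> m x = x"
      proof -
        have "\<phi> m x = \<phi> g' (\<phi> (inv g) x)" unfolding g'(4) by (rule act(4)[OF g'(1) inv_closed[OF gc(1)] xv])
        also have "\<phi> (inv g) x = x0" using act(7)[OF gc(1) x0] gc(2) by simp
        finally show ?thesis using g'(2) by simp
      qed
      ultimately show "m \<in> stabilizer MM \<phi> x" unfolding stabilizer_def MM_def by simp
    qed
  qed
  have dT: "d \<in> T" unfolding T_def x_def using d by simp
  show finS: "finite (stabilizer MM \<phi> x)"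
    using bij_betw_finite[OF fiber[OF dT]] finT by simp
  have "\<one> \<in> stabilizer MM \<phi> x"
    unfolding stabilizer_def MM_def using subgroup.one_closed[OF M(1)] act(3)[OF xv] by simp
  thus "card (stabilizer MM \<phi> x) > 0" using finS by (auto simp: card_gt_0_iff)
  \<comment> \<open>The cosets counted are those that meet \<open>T\<close>. The chosen
    \<open>coset_rep C\<close> need not lie in \<open>T\<close> itself, but it differs from an
    element of \<open>T\<close> by a left factor in \<open>M\<close>.\<close>
  have TA: "(\<lambda>g. M #> g) ` T = A"
  proof
    show "(\<lambda>g. M #> g) ` T \<subseteq> A"
    proof
      fix C assume "C \<in> (\<lambda>g. M #> g) ` T"
      then obtain g where g: "g \<in> carrier G" "\<phi> g x0 = x" "C = M #> g" unfolding T_def by blast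
      have C: "C \<in> rcosets M" unfolding g(3) by (rule rcosetsI[OF subgroup.subset[OF M(1)] g(1)])
      have "coset_rep C \<in> M #> g" using coset_rep(1)[OF M(1) C] g(3) by simp
      then obtain m where m: "m \<in> M" "coset_rep C = m \<otimes> g" unfolding r_coset_def by blast
      have "\<phi> (coset_rep C) x0 = \<phi> m x" using act(4)[OF Mc[OF m(1)] g(1) x0] m(2) g(2) by simp
      hence "\<phi> (coset_rep C) x0 \<in> orbit MM \<phi> x" unfolding orbit_def MM_def using m(1) by auto
      thus "C \<in> A" unfolding A_def using C by blast
    qed
    show "A \<subseteq> (\<lambda>g. M #> g) ` T"
    proof
      fix C assume "C \<in> A"
      hence C: "C \<in> rcosets M" "\<phi> (coset_rep C) x0 \<in> orbit MM \<phi> x" unfolding A_def by blast+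
      then obtain m where m: "m \<in> M" "\<phi> (coset_rep C) x0 = \<phi> m x" unfolding orbit_def MM_def by auto
      note c = coset_rep[OF M(1) C(1)]
      define g where "g = inv m \<otimes> coset_rep C"
      have gc: "g \<in> carrier G" unfolding g_def using Mc[OF m(1)] c(2) by simp
      have "\<phi> g x0 = \<phi> (inv m) (\<phi> m x)"
        unfolding g_def using act(4)[OF inv_closed[OF Mc[OF m(1)]] c(2) x0] m(2) by simp
      hence "g \<in> T" unfolding T_def using gc act(7)[OF Mc[OF m(1)] xv] by simp
      moreover have "g \<in> M #> coset_rep C"
        unfolding g_def by (rule rcosI[OF subgroup.m_inv_closed[OF M(1) m(1)] subgroup.subset[OF M(1)] c(2)])
      hence "M #> g = C" using repr_independence[OF _ c(2) M(1)] c(3) by simp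
      ultimately show "C \<in> (\<lambda>g. M #> g) ` T" by blast
    qed
  qed
  have "card T = (\<Sum>C\<in>A. card {g \<in> T. M #> g = C})"
  proof -
    have finA: "finite A" unfolding A_def using M(2) by simp
    have "(\<Sum>C\<in>A. \<Sum>g\<in>{g \<in> T. M #> g = C}. 1) = (\<Sum>g\<in>T. 1::nat)"
      by (rule sum.group[OF finT finA]) (use TA in blast)
    thus ?thesis by simp
  qed
  also have "\<dots> = (\<Sum>C\<in>A. card (stabilizer MM \<phi> x))"
  proof (rule sum.cong[OF refl])
    fix C assume "C \<in> A"
    then obtain g where "g \<in> T" "C = M #> g" using TA by blast
    thus "card {g \<in> T. M #> g = C} = card (stabilizer MM \<phi> x)"
      using bij_betw_same_card[OF fiber] by simp
  qed
  finally have "card T = card A * card (stabilizer MM \<phi> x)" by simp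
  thus "card {C \<in> rcosets M. \<phi> (coset_rep C) x0 \<in> orbit MM \<phi> x} * card (stabilizer MM \<phi> x)
    = card (stabilizer G \<phi> x0)"
    using bij_betw_same_card[OF cT] unfolding A_def by simp
qed

text \<open>The pairs of a representative \<open>i\<close> and a coset of \<open>M\<close> are
  grouped by the \<open>M\<close>-orbit to which the coset moves \<open>i\<close>. The number of
  cosets that reach the orbit of \<open>x\<close> is the quotient of the two stabilizer orders, so
  the weights on the two sides match.\<close>

lemma orbit_sum:
  fixes \<psi> :: "'v \<Rightarrow> real"
  assumes K: "simplicial_action G K \<phi>" and M: "subgroup M G" "finite (rcosets M)"
    and fin: "\<And>x. x \<in> verts K \<Longrightarrow> finite (stabilizer G \<phi> x)"
    and I: "fundamental_domain G (verts K) \<phi> I" "finite I"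
    and F: "fundamental_domain (G\<lparr>carrier := M\<rparr>) (verts K) \<phi> F"
    and \<psi>: "\<And>m x. m \<in> M \<Longrightarrow> x \<in> verts K \<Longrightarrow> \<psi> (\<phi> m x) = \<psi> x"
  shows "(\<Sum>x\<in>F. \<psi> x / real (card (stabilizer (G\<lparr>carrier := M\<rparr>) \<phi> x))) =
    (\<Sum>i\<in>I. (\<Sum>C\<in>rcosets M. \<psi> (\<phi> (coset_rep C) i)) / real (card (stabilizer G \<phi> i)))"
    and "finite F"
proof -
  let ?MM = "G\<lparr>carrier := M\<rparr>"
  note act = simplicial_actionD[OF K]
  have KM: "simplicial_action ?MM K \<phi>" by (rule simplicial_action_subgroup[OF K M(1)])
  have FK: "F \<subseteq> verts K" using F unfolding fundamental_domain_def by blast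
  have IK: "I \<subseteq> verts K" using I(1) unfolding fundamental_domain_def by blast
  have "\<exists>x. x \<in> F \<and> y \<in> orbit ?MM \<phi> x" if "y \<in> verts K" for y
    by (rule fundamental_domainE[OF F KM that]) blast
  then obtain rep where rep: "\<And>y. y \<in> verts K \<Longrightarrow> rep y \<in> F \<and> y \<in> orbit ?MM \<phi> (rep y)" by metis
  have rep_eq: "rep y = x" if "y \<in> verts K" "x \<in> F" "y \<in> orbit ?MM \<phi> x" for x y
    by (rule fundamental_domainE[OF F KM that(1)]) (use rep[OF that(1)] that in metis)
  have inv_orbit: "\<psi> y = \<psi> x" if "x \<in> verts K" "y \<in> orbit ?MM \<phi> x" for x y
    using \<psi>[OF _ that(1)] that(2) unfolding orbit_def by auto
  let ?p = "\<lambda>(i, C). rep (\<phi> (coset_rep C) i)"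
  have v: "\<phi> (coset_rep C) i \<in> verts K" if "i \<in> I" "C \<in> rcosets M" for i C
    using act(5)[OF coset_rep(2)[OF M(1) that(2)]] IK that(1) by blast
  have pF: "?p ` (I \<times> (rcosets M)) \<subseteq> F" using rep v by fastforce
  have cov: "\<exists>i\<in>I. \<exists>g\<in>carrier G. x = \<phi> g i \<and> (\<forall>j\<in>I. \<forall>g\<in>carrier G. x = \<phi> g j \<longrightarrow> j = i)" if "x \<in> F" for x
  proof -
    have xv: "x \<in> verts K" using that FK by blast
    obtain i where i: "i \<in> I" "x \<in> orbit G \<phi> i" "\<And>z. z \<in> I \<Longrightarrow> x \<in> orbit G \<phi> z \<Longrightarrow> z = i"
      by (rule fundamental_domainE[OF I(1) K xv]) blast
    have "\<forall>j\<in>I. \<forall>g\<in>carrier G. x = \<phi> g j \<longrightarrow> j = i" using i(3) unfolding orbit_def by blast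
    thus ?thesis using i(1,2) unfolding orbit_def by blast
  qed
  have fiber: "{p \<in> I \<times> (rcosets M). ?p p = x} = {i} \<times> {C \<in> rcosets M. \<phi> (coset_rep C) i \<in> orbit ?MM \<phi> x}"
    if x: "x \<in> F" and i: "i \<in> I" "g \<in> carrier G" "x = \<phi> g i"
      and uniq: "\<forall>j\<in>I. \<forall>g\<in>carrier G. x = \<phi> g j \<longrightarrow> j = i" for x i g
  proof
    show "{i} \<times> {C \<in> rcosets M. \<phi> (coset_rep C) i \<in> orbit ?MM \<phi> x} \<subseteq> {p \<in> I \<times> (rcosets M). ?p p = x}"
      using rep_eq[OF v[OF i(1)] x] i(1) by auto
    show "{p \<in> I \<times> (rcosets M). ?p p = x} \<subseteq> {i} \<times> {C \<in> rcosets M. \<phi> (coset_rep C) i \<in> orbit ?MM \<phi> x}"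
    proof
      fix p assume "p \<in> {p \<in> I \<times> (rcosets M). ?p p = x}"
      then obtain j C where p: "p = (j, C)" "j \<in> I" "C \<in> rcosets M" "rep (\<phi> (coset_rep C) j) = x" by auto
      note c = coset_rep(2)[OF M(1) p(3)]
      have jv: "j \<in> verts K" using p(2) IK by blast
      have o: "\<phi> (coset_rep C) j \<in> orbit ?MM \<phi> x" using rep[OF v[OF p(2,3)]] p(4) by simp
      then obtain m where m: "m \<in> M" "\<phi> (coset_rep C) j = \<phi> m x" unfolding orbit_def by auto
      have mc: "m \<in> carrier G" using subgroup.mem_carrier[OF M(1) m(1)] .
      have "x = \<phi> (inv m) (\<phi> (coset_rep C) j)"
        using m(2) simplicial_action_inv(1)[OF K mc] x FK by auto
      also have "\<dots> = \<phi> (inv m \<otimes> coset_rep C) j" using act(4)[OF inv_closed[OF mc] c jv] by simp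
      finally have "j = i" using uniq p(2) mc c by blast
      thus "p \<in> {i} \<times> {C \<in> rcosets M. \<phi> (coset_rep C) i \<in> orbit ?MM \<phi> x}" using p o by simp
    qed
  qed
  have count: "card {p \<in> I \<times> (rcosets M). ?p p = x} * card (stabilizer ?MM \<phi> x) = card (stabilizer G \<phi> i) \<and>
      card (stabilizer ?MM \<phi> x) > 0 \<and> {p \<in> I \<times> (rcosets M). ?p p = x} \<noteq> {}"
    if x: "x \<in> F" and i: "i \<in> I" "g \<in> carrier G" "x = \<phi> g i"
      and uniq: "\<forall>j\<in>I. \<forall>g\<in>carrier G. x = \<phi> g j \<longrightarrow> j = i" for x i g
  proof -
    have iv: "i \<in> verts K" using i(1) IK by blast
    note c = card_cosets_to[OF K M iv fin[OF iv] i(2), folded i(3)]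
    have "\<one> \<in> stabilizer G \<phi> i" unfolding stabilizer_def using act(3)[OF iv] by simp
    hence pos: "card (stabilizer G \<phi> i) > 0" using fin[OF iv] by (auto simp: card_gt_0_iff)
    have cc: "card {p \<in> I \<times> (rcosets M). ?p p = x} = card {C \<in> rcosets M. \<phi> (coset_rep C) i \<in> orbit ?MM \<phi> x}"
      unfolding fiber[OF x i uniq] by (simp add: card_cartesian_product)
    have eq: "card {p \<in> I \<times> (rcosets M). ?p p = x} * card (stabilizer ?MM \<phi> x) = card (stabilizer G \<phi> i)"
      unfolding cc by (rule c(1))
    have "{p \<in> I \<times> (rcosets M). ?p p = x} \<noteq> {}"
    proof
      assume "{p \<in> I \<times> (rcosets M). ?p p = x} = {}"
      from eq[unfolded this] pos show False by simp
    qed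
    with eq c(3) show ?thesis by blast
  qed
  \<comment> \<open>Every orbit is reached by some pair, so the finiteness of \<open>F\<close> comes
    out as well.\<close>
  have "F \<subseteq> ?p ` (I \<times> (rcosets M))"
  proof
    fix x assume x: "x \<in> F"
    obtain i g where i: "i \<in> I" "g \<in> carrier G" "x = \<phi> g i" "\<forall>j\<in>I. \<forall>g\<in>carrier G. x = \<phi> g j \<longrightarrow> j = i"
      using cov[OF x] by blast
    from count[OF x i] show "x \<in> ?p ` (I \<times> (rcosets M))" by blast
  qed
  moreover have finP: "finite (I \<times> (rcosets M))" using I(2) M(2) by simp
  ultimately show finF: "finite F" using finite_surj by blast
  let ?h = "\<lambda>(i, C). \<psi> (\<phi> (coset_rep C) i) / real (card (stabilizer G \<phi> i))"
  have "(\<Sum>i\<in>I. (\<Sum>C\<in>rcosets M. \<psi> (\<phi> (coset_rep C) i)) / real (card (stabilizer G \<phi> i))) = (\<Sum>p\<in>I \<times> (rcosets M). ?h p)"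
    unfolding sum_divide_distrib sum.cartesian_product ..
  also have "\<dots> = (\<Sum>x\<in>F. \<Sum>p\<in>{p \<in> I \<times> (rcosets M). ?p p = x}. ?h p)"
    by (rule sum.group[OF finP finF pF, symmetric])
  also have "\<dots> = (\<Sum>x\<in>F. \<psi> x / real (card (stabilizer ?MM \<phi> x)))"
  proof (rule sum.cong[OF refl])
    fix x assume x: "x \<in> F"
    have xv: "x \<in> verts K" using x FK by blast
    obtain i g where i: "i \<in> I" "g \<in> carrier G" "x = \<phi> g i" "\<forall>j\<in>I. \<forall>g\<in>carrier G. x = \<phi> g j \<longrightarrow> j = i"
      using cov[OF x] by blast
    define P where "P = {p \<in> I \<times> (rcosets M). ?p p = x}"
    let ?s = "card (stabilizer ?MM \<phi> x)" and ?S = "card (stabilizer G \<phi> i)"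
    note c = count[OF x i, folded P_def]
    have "?h p = \<psi> x / real ?S" if "p \<in> P" for p
    proof -
      obtain C where C: "p = (i, C)" "\<phi> (coset_rep C) i \<in> orbit ?MM \<phi> x"
        using \<open>p \<in> P\<close> unfolding P_def fiber[OF x i] by blast
      show ?thesis unfolding C(1) using inv_orbit[OF xv C(2)] by simp
    qed
    hence "(\<Sum>p\<in>P. ?h p) = real (card P) * (\<psi> x / real ?S)" by simp
    moreover have S: "real ?S = real (card P) * real ?s" unfolding conjunct1[OF c, symmetric] by (rule of_nat_mult)
    moreover have "finite P" unfolding P_def using finP by simp
    hence "card P \<noteq> 0" using c by simp
    moreover have "?s \<noteq> 0" using c by simp
    ultimately have "(\<Sum>p\<in>P. ?h p) = \<psi> x / real ?s" by (simp add: field_simps)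
    thus "(\<Sum>p\<in>{p \<in> I \<times> (rcosets M). ?p p = x}. ?h p) = \<psi> x / real ?s" unfolding P_def .
  qed
  finally show "(\<Sum>x\<in>F. \<psi> x / real (card (stabilizer ?MM \<phi> x))) =
    (\<Sum>i\<in>I. (\<Sum>C\<in>rcosets M. \<psi> (\<phi> (coset_rep C) i)) / real (card (stabilizer G \<phi> i)))" by simp
qed

end

section \<open>Conjugates modulo a residual chain\<close>

context group
begin

text \<open>A factor from a normal subgroup can be conjugated to the left end of a product, where
  the coset absorbs it.\<close>

lemma normal_absorb:
  assumes N: "N \<lhd> G" and "a \<in> carrier G" "b \<in> carrier G" "n \<in> N"
  shows "N #> (a \<otimes> n \<otimes> b) = N #> (a \<otimes> b)"
proof -
  interpret normal N G by fact
  have nc: "n \<in> carrier G" using assms(4) by simp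
  have "a \<otimes> n \<otimes> b = (a \<otimes> n \<otimes> inv a) \<otimes> (a \<otimes> b)" using assms(2,3) nc by (simp add: m_assoc cancel_inv)
  moreover have "a \<otimes> n \<otimes> inv a \<in> N" by (rule inv_op_closed2[OF assms(2,4)])
  ultimately have "a \<otimes> n \<otimes> b \<in> N #> (a \<otimes> b)" using rcosI[of _ N "a \<otimes> b"] subset assms(2,3) by simp
  thus ?thesis using repr_independence[OF _ _ is_subgroup] assms(2,3) by simp
qed

lemma normal_coset_cong:
  assumes N: "N \<lhd> G" and "a \<in> carrier G" "b \<in> carrier G" "x \<in> carrier G" "y \<in> carrier G" "N #> x = N #> y"
  shows "N #> (a \<otimes> x \<otimes> b) = N #> (a \<otimes> y \<otimes> b)"
proof -
  interpret normal N G by fact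
  have "x \<in> N #> y" using rcos_self[OF assms(4) is_subgroup] assms(6) by simp
  then obtain n where n: "n \<in> N" "x = n \<otimes> y" unfolding r_coset_def by blast
  have nc: "n \<in> carrier G" using n(1) by simp
  have "N #> (a \<otimes> n \<otimes> (y \<otimes> b)) = N #> (a \<otimes> (y \<otimes> b))"
    by (rule normal_absorb[OF N assms(2) _ n(1)]) (use assms(3,5) in simp)
  thus ?thesis unfolding n(2) using assms(2,3,5) nc by (simp add: m_assoc)
qed

text \<open>Replacing \<open>t\<close> by the product of \<open>m\<close> and \<open>t\<close>
  inserts \<open>m\<close> and its inverse around \<open>g\<close>, and both are absorbed modulo
  \<open>N\<close>. So the conjugate modulo \<open>N\<close> is a function on the cosets of
  \<open>N\<close>.\<close>

lemma conj_coset_invariant: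
  assumes N: "N \<lhd> G" and g: "g \<in> carrier G"
  shows "left_invariant G N (\<lambda>t. N #> (inv t \<otimes> g \<otimes> t))"
  unfolding left_invariant_def
proof (intro ballI)
  interpret normal N G by fact
  fix m t assume m: "m \<in> N" and t: "t \<in> carrier G"
  have mc: "m \<in> carrier G" using m by simp
  have "inv (m \<otimes> t) \<otimes> g \<otimes> (m \<otimes> t) = inv t \<otimes> inv m \<otimes> (g \<otimes> m \<otimes> t)"
    using mc t g by (simp add: inv_mult_group m_assoc)
  also have "N #> \<dots> = N #> (inv t \<otimes> (g \<otimes> m \<otimes> t))"
    by (rule normal_absorb[OF N]) (use mc t g m in simp_all)
  also have "inv t \<otimes> (g \<otimes> m \<otimes> t) = inv t \<otimes> g \<otimes> m \<otimes> t" using mc t g by (simp add: m_assoc)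
  also have "N #> \<dots> = N #> (inv t \<otimes> g \<otimes> t)"
    by (rule normal_absorb[OF N]) (use t g m in simp_all)
  finally show "N #> (inv (m \<otimes> t) \<otimes> g \<otimes> (m \<otimes> t)) = N #> (inv t \<otimes> g \<otimes> t)" .
qed

text \<open>The cosets of the elements conjugating \<open>g\<close> into \<open>N s\<close> have disjoint translates, one for each
  conjugate of \<open>g\<close> modulo \<open>N\<close>.\<close>

lemma card_conjugating_cosets:
  assumes N: "N \<lhd> G" and fin: "finite (rcosets N)" and g: "g \<in> carrier G"
    and T: "T \<subseteq> carrier G" "inj_on (\<lambda>t. N #> (inv t \<otimes> g \<otimes> t)) T"
  shows "card T * card {C \<in> rcosets N. N #> (inv (coset_rep C) \<otimes> g \<otimes> coset_rep C) = N #> s} \<le> card (rcosets N)"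
proof -
  interpret normal N G by fact
  note N_sub = is_subgroup
  let ?c = "\<lambda>t. N #> (inv t \<otimes> g \<otimes> t)"
  define A where "A = {C \<in> rcosets N. ?c (coset_rep C) = N #> s}"
  show ?thesis
  proof (cases "A = {}")
    case True
    thus ?thesis unfolding A_def[symmetric] by simp
  next
    case False
    then obtain C0 where C0: "C0 \<in> rcosets N" "?c (coset_rep C0) = N #> s" unfolding A_def by blast
    define d where "d = coset_rep C0"
    have dc: "d \<in> carrier G" unfolding d_def by (rule coset_rep(2)[OF N_sub C0(1)])
    have Tc: "t \<in> carrier G" if "t \<in> T" for t using T(1) that by blast
    \<comment> \<open>If \<open>e\<close> represents \<open>C\<close>, then \<open>e\<close> and
      \<open>d\<close> both conjugate \<open>g\<close> into \<open>N s\<close>, so the product of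
      \<open>e\<close>, \<open>inv d\<close> and \<open>t\<close> conjugates \<open>g\<close> to the
      same class modulo \<open>N\<close> as \<open>t\<close> does. As \<open>T\<close> separates
      these classes, \<open>t\<close> and then \<open>C\<close> can be read off from the translated
      coset.\<close>
    define p where "p = (\<lambda>(t, C). C #> (inv d \<otimes> t))"
    have p_in: "p (t, C) \<in> rcosets N" if "t \<in> T" "C \<in> A" for t C
      unfolding p_def using rcoset_translate(1)[OF N_sub, of "inv d \<otimes> t" C] Tc[OF that(1)] dc that(2)
      by (simp add: A_def)
    have key: "?c (coset_rep (p (t, C))) = ?c t" if t: "t \<in> T" and C: "C \<in> A" for t C
    proof -
      have C': "C \<in> rcosets N" "?c (coset_rep C) = N #> s" using C unfolding A_def by blast+
      define e where "e = coset_rep C"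
      have ec: "e \<in> carrier G" unfolding e_def by (rule coset_rep(2)[OF N_sub C'(1)])
      note tc = Tc[OF t]
      have dt: "inv d \<otimes> t \<in> carrier G" using dc tc by simp
      have "p (t, C) = N #> (e \<otimes> (inv d \<otimes> t))"
        unfolding p_def e_def using rcoset_translate(3)[OF N_sub dt C'(1)] by simp
      hence "?c (coset_rep (p (t, C))) = ?c (e \<otimes> (inv d \<otimes> t))"
        using left_invariant_rep[OF conj_coset_invariant[OF N g] N_sub, of "e \<otimes> (inv d \<otimes> t)"] ec dt by simp
      also have "inv (e \<otimes> (inv d \<otimes> t)) \<otimes> g \<otimes> (e \<otimes> (inv d \<otimes> t)) = (inv t \<otimes> d) \<otimes> (inv e \<otimes> g \<otimes> e) \<otimes> (inv d \<otimes> t)"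
        using ec dc tc g by (simp add: inv_mult_group m_assoc)
      also have "N #> \<dots> = N #> ((inv t \<otimes> d) \<otimes> (inv d \<otimes> g \<otimes> d) \<otimes> (inv d \<otimes> t))"
        by (rule normal_coset_cong[OF N])
          (use ec dc tc g C'(2) C0(2) in \<open>simp_all add: e_def[symmetric] d_def[symmetric]\<close>)
      also have "(inv t \<otimes> d) \<otimes> (inv d \<otimes> g \<otimes> d) \<otimes> (inv d \<otimes> t) = inv t \<otimes> g \<otimes> t"
        using dc tc g by (simp add: m_assoc cancel_inv)
      finally show ?thesis .
    qed
    have "inj_on p (T \<times> A)"
    proof (rule inj_onI)
      fix x y assume x: "x \<in> T \<times> A" and y: "y \<in> T \<times> A" and xy: "p x = p y"
      obtain t C where tC: "x = (t, C)" "t \<in> T" "C \<in> A" using x by blast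
      obtain t' C' where tC': "y = (t', C')" "t' \<in> T" "C' \<in> A" using y by blast
      have "?c t = ?c t'" using key[OF tC(2,3)] key[OF tC'(2,3)] xy tC(1) tC'(1) by simp
      hence tt: "t = t'" by (rule inj_onD[OF T(2) _ tC(2) tC'(2)])
      have dt: "inv d \<otimes> t \<in> carrier G" using dc Tc[OF tC(2)] by simp
      have "C #> (inv d \<otimes> t) = C' #> (inv d \<otimes> t)" using xy tt unfolding tC(1) tC'(1) p_def by simp
      hence "C = C'" using rcoset_translate(2)[OF N_sub dt] tC(3) tC'(3) unfolding A_def by (metis (mono_tags, lifting) mem_Collect_eq)
      thus "x = y" using tt tC(1) tC'(1) by simp
    qed
    moreover have "p ` (T \<times> A) \<subseteq> rcosets N" using p_in by auto
    ultimately have "card (T \<times> A) \<le> card (rcosets N)" by (rule card_inj_on_le[OF _ _ fin])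
    thus ?thesis unfolding A_def by (simp add: card_cartesian_product)
  qed
qed

text \<open>Each nontrivial element of \<open>E\<close> leaves the decreasing chain at some stage,
  and finitely many stages have a maximum. All uses of the chain condition go through this.\<close>

lemma residual_chain_avoids:
  fixes N :: "nat \<Rightarrow> 'a set"
  assumes "\<And>n. N (Suc n) \<subseteq> N n" "(\<Inter>n. N n) = {\<one>}" "finite E"
  shows "\<exists>n0. \<forall>n\<ge>n0. N n \<inter> E \<subseteq> {\<one>}"
proof -
  have dec: "N n \<subseteq> N m" if "m \<le> n" for m n
    using that by (rule lift_Suc_antimono_le[of N, OF assms(1)])
  have "\<exists>m. e \<notin> N m" if "e \<noteq> \<one>" for e using assms(2) that by blast
  then obtain m where m: "\<And>e. e \<noteq> \<one> \<Longrightarrow> e \<notin> N (m e)" by metis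
  define n0 where "n0 = Max (insert 0 (m ` E))"
  have "N n \<inter> E \<subseteq> {\<one>}" if "n \<ge> n0" for n
  proof
    fix e assume e: "e \<in> N n \<inter> E"
    have "m e \<le> n0" unfolding n0_def using e assms(3) by (intro Max_ge) auto
    hence "N n \<subseteq> N (m e)" using that by (intro dec) simp
    thus "e \<in> {\<one>}" using m[of e] e by blast
  qed
  thus ?thesis by blast
qed

text \<open>The event that will dominate the failure of \<open>separated\<close>. Phrasing it modulo
  \<open>N\<close> makes it a property of the coset of \<open>t\<close>, so that its frequency is a
  \<open>coset_mean\<close>.\<close>

definition conjugates_into :: "'a set \<Rightarrow> 'a set \<Rightarrow> 'a set \<Rightarrow> 'a \<Rightarrow> bool" where
  "conjugates_into N A S t \<longleftrightarrow> (\<exists>g\<in>A. \<exists>s\<in>S. N #> (inv t \<otimes> g \<otimes> t) = N #> s)"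

lemma conjugates_into_invariant:
  assumes "N \<lhd> G" "A \<subseteq> carrier G"
  shows "left_invariant G N (conjugates_into N A S)"
proof -
  have "N #> (inv (m \<otimes> t) \<otimes> g \<otimes> (m \<otimes> t)) = N #> (inv t \<otimes> g \<otimes> t)"
    if "m \<in> N" "t \<in> carrier G" "g \<in> A" for m t g
    using conj_coset_invariant[OF assms(1), of g] assms(2) that unfolding left_invariant_def by blast
  thus ?thesis unfolding left_invariant_def conjugates_into_def by simp
qed

text \<open>For each \<open>g\<close> in \<open>A\<close>, fix \<open>k\<close> distinct conjugates.
  Once the chain avoids their finitely many quotients they stay distinct modulo \<open>N n\<close>,
  and then each target class is attained by at most a fraction \<open>1 / k\<close> of the cosets.
  The union bound over \<open>A\<close> and \<open>S\<close> costs the factor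
  \<open>card A * card S\<close>.\<close>

lemma conjugates_into_rare:
  fixes N :: "nat \<Rightarrow> 'a set"
  assumes N: "\<And>n. N n \<lhd> G" and fin: "\<And>n. finite (rcosets (N n))"
    and chain: "\<And>n. N (Suc n) \<subseteq> N n" "(\<Inter>n. N n) = {\<one>}"
    and A: "finite A" "A \<subseteq> carrier G" "\<And>g. g \<in> A \<Longrightarrow> infinite {t \<otimes> g \<otimes> inv t | t. t \<in> carrier G}"
    and S: "finite S" and e: "e > 0"
  shows "\<exists>n0. \<forall>n\<ge>n0. coset_mean G (N n) (\<lambda>t. of_bool (conjugates_into (N n) A S t)) < e"
proof -
  \<comment> \<open>The number of conjugates is fixed before \<open>n\<close>, large enough for the
    union bound to fall below \<open>e\<close>.\<close>
  obtain k :: nat where k: "k > 0" "real (card A * card S) / real k < e"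
  proof -
    obtain k :: nat where "real (card A * card S) / e < real k" using reals_Archimedean2 by blast
    hence less: "real (card A * card S) < real k * e" by (subst (asm) pos_divide_less_eq[OF e])
    have "0 \<le> real (card A * card S)" by (rule of_nat_0_le_iff)
    hence "0 < real k * e" using less by linarith
    hence k: "0 < real k" using e by (simp add: zero_less_mult_iff)
    have "real (card A * card S) / real k < e" by (subst pos_divide_less_eq[OF k]) (use less in \<open>simp only: mult.commute\<close>)
    thus thesis using k that by simp
  qed
  have ex: "\<exists>T. T \<subseteq> carrier G \<and> finite T \<and> card T = k \<and> inj_on (\<lambda>t. inv t \<otimes> g \<otimes> t) T" if "g \<in> A" for g
  proof -
    obtain X where X: "X \<subseteq> {t \<otimes> g \<otimes> inv t | t. t \<in> carrier G}" "finite X" "card X = k"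
      using infinite_arbitrarily_large[OF A(3)[OF \<open>g \<in> A\<close>]] by blast
    have "\<forall>x\<in>X. \<exists>t. t \<in> carrier G \<and> inv t \<otimes> g \<otimes> t = x"
    proof
      fix x assume "x \<in> X"
      then obtain t where "t \<in> carrier G" "x = t \<otimes> g \<otimes> inv t" using X(1) by blast
      \<comment> \<open>The inverse passes from conjugates with \<open>inv t\<close> on the right,
        as in the hypothesis on \<open>A\<close>, to the form with \<open>inv t\<close> on the
        left.\<close>
      thus "\<exists>t. t \<in> carrier G \<and> inv t \<otimes> g \<otimes> t = x" by (intro exI[of _ "inv t"]) simp
    qed
    then obtain h where h: "\<And>x. x \<in> X \<Longrightarrow> h x \<in> carrier G \<and> inv (h x) \<otimes> g \<otimes> h x = x" by metis
    have "inj_on h X" by (rule inj_onI) (metis h)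
    hence "card (h ` X) = k" using X(3) by (simp add: card_image)
    moreover have "inj_on (\<lambda>t. inv t \<otimes> g \<otimes> t) (h ` X)" by (rule inj_onI) (use h in auto)
    moreover have "h ` X \<subseteq> carrier G" using h by blast
    ultimately show ?thesis using X(2) by (intro exI[of _ "h ` X"]) simp
  qed
  then obtain T where T: "\<And>g. g \<in> A \<Longrightarrow> T g \<subseteq> carrier G \<and> finite (T g) \<and> card (T g) = k \<and>
      inj_on (\<lambda>t. inv t \<otimes> g \<otimes> t) (T g)" by metis
  \<comment> \<open>If \<open>N n\<close> meets this set only in the identity, then chosen
    conjugates of one \<open>g\<close> that agree modulo \<open>N n\<close> are equal.\<close>
  define E where "E = (\<Union>g\<in>A. (\<lambda>(s, t). (inv s \<otimes> g \<otimes> s) \<otimes> inv (inv t \<otimes> g \<otimes> t)) ` (T g \<times> T g))"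
  have "finite E" unfolding E_def using A(1) T by (intro finite_UN_I finite_imageI) auto
  then obtain n0 where n0: "\<And>n. n \<ge> n0 \<Longrightarrow> N n \<inter> E \<subseteq> {\<one>}"
    using residual_chain_avoids[OF chain] by blast
  have "coset_mean G (N n) (\<lambda>t. of_bool (conjugates_into (N n) A S t)) < e" if n: "n \<ge> n0" for n
  proof -
    interpret normal "N n" G by (rule N)
    let ?r = "card (rcosets (N n))"
    let ?B = "\<lambda>g s. {C \<in> rcosets (N n). N n #> (inv (coset_rep C) \<otimes> g \<otimes> coset_rep C) = N n #> s}"
    have rpos: "real ?r > 0" using card_rcosets_pos[OF is_subgroup fin] by simp
    have B: "real (card (?B g s)) \<le> real ?r / real k" if g: "g \<in> A" for g s
    proof -
      have gc: "g \<in> carrier G" using g A(2) by blast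
      have "inj_on (\<lambda>t. N n #> (inv t \<otimes> g \<otimes> t)) (T g)"
      proof (rule inj_onI)
        fix t s assume ts: "t \<in> T g" "s \<in> T g" "N n #> (inv t \<otimes> g \<otimes> t) = N n #> (inv s \<otimes> g \<otimes> s)"
        have tc: "t \<in> carrier G" and sc: "s \<in> carrier G" using ts T[OF g] by blast+
        let ?x = "inv t \<otimes> g \<otimes> t" and ?y = "inv s \<otimes> g \<otimes> s"
        have xc: "?x \<in> carrier G" and yc: "?y \<in> carrier G" using tc sc gc by simp_all
        have "?x \<in> N n #> ?y" using rcos_self[OF xc is_subgroup] ts(3) by simp
        then obtain m where m: "m \<in> N n" "?x = m \<otimes> ?y" unfolding r_coset_def by blast
        have mc: "m \<in> carrier G" using m(1) by simp
        have "?x \<otimes> inv ?y = m" unfolding m(2) using mc yc by (simp add: m_assoc del: inv_mult_group)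
        moreover have "?x \<otimes> inv ?y \<in> E" unfolding E_def using g ts(1,2) by force
        ultimately have "m = \<one>" using n0[OF n] m(1) by blast
        hence "?x = ?y" using m(2) yc by simp
        thus "t = s" using T[OF g] ts(1,2) by (auto dest: inj_onD)
      qed
      hence "card (T g) * card (?B g s) \<le> ?r"
        using card_conjugating_cosets[OF N fin gc, of "T g" n s] T[OF g] by simp
      hence "k * card (?B g s) \<le> ?r" using T[OF g] by simp
      hence "real k * real (card (?B g s)) \<le> real ?r" unfolding of_nat_mult[symmetric] of_nat_le_iff .
      moreover have "0 < real k" using k(1) by simp
      ultimately show ?thesis by (simp only: pos_le_divide_eq mult.commute[of "real k"])
    qed
    have "(\<Sum>C\<in>rcosets (N n). of_bool (conjugates_into (N n) A S (coset_rep C))) =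
        real (card {C \<in> rcosets (N n). conjugates_into (N n) A S (coset_rep C)})"
      using fin[of n] by (simp add: of_bool_def sum.If_cases Int_def)
    also have "{C \<in> rcosets (N n). conjugates_into (N n) A S (coset_rep C)} = (\<Union>(g, s)\<in>A \<times> S. ?B g s)"
      unfolding conjugates_into_def by auto
    also have "real (card \<dots>) \<le> (\<Sum>(g, s)\<in>A \<times> S. real (card (?B g s)))"
    proof -
      have "card (\<Union>p\<in>A \<times> S. ?B (fst p) (snd p)) \<le> (\<Sum>p\<in>A \<times> S. card (?B (fst p) (snd p)))"
        using A(1) S by (intro card_UN_le) simp
      hence "real (card (\<Union>p\<in>A \<times> S. ?B (fst p) (snd p))) \<le> (\<Sum>p\<in>A \<times> S. real (card (?B (fst p) (snd p))))"
        unfolding of_nat_sum[symmetric] of_nat_le_iff .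
      thus ?thesis by (simp add: case_prod_beta)
    qed
    also have "\<dots> \<le> (\<Sum>(g, s)\<in>A \<times> S. real ?r / real k)" by (intro sum_mono) (auto intro: B)
    also have "\<dots> = real (card A * card S) * (real ?r / real k)" by (simp add: case_prod_beta card_cartesian_product)
    also have "\<dots> = real ?r * (real (card A * card S) / real k)" by simp
    also have "\<dots> < real ?r * e" using rpos k(2) by (intro mult_strict_left_mono)
    finally show ?thesis unfolding coset_mean_def using rpos by (simp add: field_simps)
  qed
  thus ?thesis by blast
qed

text \<open>Conjugates of a product are products of conjugates, and conjugates of an inverse are
  inverses of conjugates, so finiteness persists.\<close>

lemma finite_conjugates_subgroup:
  assumes G': "subgroup G' G"
  shows "subgroup {g \<in> G'. finite {t \<otimes> g \<otimes> inv t | t. t \<in> carrier G}} G"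
proof (rule subgroupI)
  let ?c = "\<lambda>g. {t \<otimes> g \<otimes> inv t | t. t \<in> carrier G}"
  let ?H = "{g \<in> G'. finite (?c g)}"
  note Gc = subgroup.mem_carrier[OF G']
  show "?H \<subseteq> carrier G" using Gc by blast
  have "?c \<one> \<subseteq> {\<one>}" by auto
  hence "\<one> \<in> ?H" using subgroup.one_closed[OF G'] by (auto intro: finite_subset)
  thus "?H \<noteq> {}" by blast
  fix a assume a: "a \<in> ?H"
  have "?c (inv a) \<subseteq> (\<lambda>x. inv x) ` ?c a"
  proof
    fix x assume "x \<in> ?c (inv a)"
    then obtain t where t: "t \<in> carrier G" "x = t \<otimes> inv a \<otimes> inv t" by blast
    hence "x = inv (t \<otimes> a \<otimes> inv t)" using a Gc by (simp add: inv_mult_group m_assoc)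
    thus "x \<in> (\<lambda>x. inv x) ` ?c a" using t(1) by blast
  qed
  hence "finite (?c (inv a))" using a by (auto intro: finite_subset)
  thus "inv a \<in> ?H" using a subgroup.m_inv_closed[OF G'] by blast
  fix b assume b: "b \<in> ?H"
  have "?c (a \<otimes> b) \<subseteq> (\<lambda>(x, y). x \<otimes> y) ` (?c a \<times> ?c b)"
  proof
    fix x assume "x \<in> ?c (a \<otimes> b)"
    then obtain t where t: "t \<in> carrier G" "x = t \<otimes> (a \<otimes> b) \<otimes> inv t" by blast
    have "x = (t \<otimes> a \<otimes> inv t) \<otimes> (t \<otimes> b \<otimes> inv t)"
      unfolding t(2) using t(1) a b Gc by (simp add: m_assoc cancel_inv)
    thus "x \<in> (\<lambda>(x, y). x \<otimes> y) ` (?c a \<times> ?c b)" using t(1) by blast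
  qed
  moreover have "finite ((\<lambda>(x, y). x \<otimes> y) ` (?c a \<times> ?c b))" using a b by simp
  ultimately have "finite (?c (a \<otimes> b))" by (rule finite_subset)
  thus "a \<otimes> b \<in> ?H" using a b subgroup.m_closed[OF G'] by blast
qed

text \<open>Bounded degree leaves finitely many targets for \<open>x\<close>, and the transporter to
  each of them is empty or a coset of a finite stabilizer.\<close>

lemma finite_displacements:
  assumes K: "simplicial_action G K \<phi>" and deg: "vertex_degree K \<le> ennreal D"
    and x: "x \<in> verts K" and fin: "finite (stabilizer G \<phi> x)"
  shows "finite {s \<in> carrier G. \<exists>j\<le>R. (x, \<phi> s x) \<in> adj K ^^ j}"
proof -
  note act = simplicial_actionD[OF K]
  have "{s \<in> carrier G. \<exists>j\<le>R. (x, \<phi> s x) \<in> adj K ^^ j} \<subseteq>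
      (\<Union>y\<in>ball_verts (real R) K {x}. {s \<in> carrier G. \<phi> s x = y})"
    unfolding ball_verts_def by auto
  moreover have "finite {s \<in> carrier G. \<phi> s x = y}" for y
  proof (cases "{s \<in> carrier G. \<phi> s x = y} = {}")
    case False
    then obtain d where d: "d \<in> carrier G" "\<phi> d x = y" by blast
    show ?thesis
      using bij_betw_finite[OF bij_betw_transporter[OF K x d(1)]] fin unfolding d(2) by simp
  qed (metis finite.emptyI)
  moreover have "finite (ball_verts (real R) K {x})" by (rule finite_ball_verts[OF deg]) simp
  ultimately show ?thesis by (meson finite_UN_I finite_subset)
qed

text \<open>Conjugation by \<open>t\<close> turns a short displacement of \<open>\<phi> t x\<close>
  into a short displacement of \<open>x\<close>, so that the one finite set \<open>S\<close> serves
  for all \<open>t\<close>.\<close>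

lemma separated_if_not_conjugates_into:
  fixes R :: nat
  assumes K: "simplicial_action G K \<phi>" and x: "x \<in> verts K" and N: "N \<lhd> G"
    and A: "A \<subseteq> carrier G" and t: "t \<in> carrier G"
  defines "S \<equiv> {s \<in> carrier G. \<exists>j\<le>R. (x, \<phi> s x) \<in> adj K ^^ j}"
  assumes avoid: "N \<inter> (\<lambda>(s, c). s \<otimes> inv c) ` (S \<times> (\<Union>h\<in>H. {t \<otimes> h \<otimes> inv t | t. t \<in> carrier G})) \<subseteq> {\<one>}"
    and not: "\<not> conjugates_into N (A - H) S t"
  shows "separated G K \<phi> A H N R (\<phi> t x)"
  unfolding separated_def
proof (intro ballI allI impI)
  interpret normal N G by fact
  note act = simplicial_actionD[OF K]
  fix n g j assume n: "n \<in> N" and g: "g \<in> A" and j: "j \<le> R"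
    and path: "(\<phi> t x, \<phi> (n \<otimes> g) (\<phi> t x)) \<in> adj K ^^ j"
  have nc: "n \<in> carrier G" and gc: "g \<in> carrier G" using n g A by auto
  define s where "s = inv t \<otimes> (n \<otimes> g) \<otimes> t"
  have sc: "s \<in> carrier G" unfolding s_def using nc gc t by simp
  have tx: "\<phi> t x \<in> verts K" by (rule act(5)[OF t x])
  from relpow_image[of "adj K", OF simplicial_action_adj[OF K inv_closed[OF t]] path]
  have "(\<phi> (inv t) (\<phi> t x), \<phi> (inv t) (\<phi> (n \<otimes> g) (\<phi> t x))) \<in> adj K ^^ j" .
  moreover have "\<phi> (inv t) (\<phi> t x) = x" by (rule simplicial_action_inv(1)[OF K t x])
  moreover have "\<phi> (inv t) (\<phi> (n \<otimes> g) (\<phi> t x)) = \<phi> s x"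
    unfolding s_def using act(4)[of "inv t" "n \<otimes> g" "\<phi> t x"] act(4)[of "inv t \<otimes> (n \<otimes> g)" t x] nc gc t x tx by simp
  ultimately have sS: "s \<in> S" unfolding S_def using sc j by auto
  define c where "c = inv t \<otimes> g \<otimes> t"
  have cc: "c \<in> carrier G" unfolding c_def using gc t by simp
  have s_eq: "s = (inv t \<otimes> n \<otimes> t) \<otimes> c" unfolding s_def c_def using nc gc t by (simp add: m_assoc cancel_inv)
  have nN: "inv t \<otimes> n \<otimes> t \<in> N" by (rule inv_op_closed1[OF t n])
  show "n = \<one> \<and> g \<in> H"
  proof (cases "g \<in> H")
    case True
    \<comment> \<open>The quotient of \<open>s\<close> by \<open>c\<close> lies in \<open>N\<close>
      and in the set that \<open>N\<close> avoids, so it is trivial, and with it its conjugate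
      \<open>n\<close>.\<close>
    have "c = inv t \<otimes> g \<otimes> inv (inv t)" unfolding c_def using t by simp
    hence "c \<in> (\<Union>h\<in>H. {t \<otimes> h \<otimes> inv t | t. t \<in> carrier G})" using True inv_closed[OF t] by blast
    hence sc': "(s, c) \<in> S \<times> (\<Union>h\<in>H. {t \<otimes> h \<otimes> inv t | t. t \<in> carrier G})" using sS by (rule SigmaI[rotated])
    have "inv t \<otimes> n \<otimes> t = s \<otimes> inv c"
      unfolding s_eq using nN cc by (simp add: m_assoc mem_carrier)
    hence "inv t \<otimes> n \<otimes> t = (\<lambda>(s, c). s \<otimes> inv c) (s, c)" by simp
    hence "inv t \<otimes> n \<otimes> t \<in> (\<lambda>(s, c). s \<otimes> inv c) ` (S \<times> (\<Union>h\<in>H. {t \<otimes> h \<otimes> inv t | t. t \<in> carrier G}))"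
      using sc' by (rule image_eqI)
    hence "inv t \<otimes> n \<otimes> t = \<one>" using avoid nN by blast
    hence "t \<otimes> (inv t \<otimes> n \<otimes> t) \<otimes> inv t = \<one>" using t by simp
    moreover have "t \<otimes> (inv t \<otimes> n \<otimes> t) \<otimes> inv t = n" using t nc by (simp add: m_assoc cancel_inv)
    ultimately show ?thesis using True by simp
  next
    case False
    have "s \<in> N #> c" unfolding s_eq by (rule rcosI[OF nN subset cc])
    hence "N #> c = N #> s" by (rule repr_independence[OF _ cc is_subgroup])
    hence "conjugates_into N (A - H) S t"
      unfolding conjugates_into_def c_def using g False sS by blast
    thus ?thesis using not by blast
  qed
qed

end

section \<open>Mass transport\<close>

text \<open>Tonelli for counting measures, applied to the graph of \<open>p\<close>. The version for
  \<open>count_space\<close> also covers uncountable groups.\<close>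

lemma nn_integral_count_space_fibers:
  "(\<integral>\<^sup>+ a. \<psi> (p a) \<partial>count_space A) =
    (\<integral>\<^sup>+ z. \<psi> z * emeasure (count_space UNIV) {a \<in> A. p a = z} \<partial>count_space UNIV)"
proof -
  let ?f = "\<lambda>(a, z). \<psi> z * indicator {a \<in> A. p a = z} a :: ennreal"
  have "(\<integral>\<^sup>+ z. ?f (a, z) \<partial>count_space UNIV) = \<psi> (p a) * indicator A a" for a
  proof -
    have "(\<integral>\<^sup>+ z. ?f (a, z) \<partial>count_space UNIV) =
        (\<integral>\<^sup>+ z. (\<psi> (p a) * indicator A a) * indicator {p a} z \<partial>count_space UNIV)"
      by (intro nn_integral_cong) (auto simp: indicator_def)
    also have "\<dots> = \<psi> (p a) * indicator A a"
      by (subst nn_integral_cmult_indicator) (simp_all add: one_ennreal_def[symmetric])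
    finally show ?thesis .
  qed
  moreover have "(\<integral>\<^sup>+ a. ?f (a, z) \<partial>count_space UNIV) = \<psi> z * emeasure (count_space UNIV) {a \<in> A. p a = z}" for z
    by (simp add: nn_integral_cmult_indicator)
  moreover have "(\<integral>\<^sup>+ a. \<psi> (p a) \<partial>count_space A) = (\<integral>\<^sup>+ a. \<psi> (p a) * indicator A a \<partial>count_space UNIV)"
    by (rule nn_integral_count_space_indicator) simp
  moreover have "(\<integral>\<^sup>+ a. \<integral>\<^sup>+ z. ?f (a, z) \<partial>count_space UNIV \<partial>count_space UNIV) =
      (\<integral>\<^sup>+ z. \<integral>\<^sup>+ a. ?f (a, z) \<partial>count_space UNIV \<partial>count_space UNIV)"
    unfolding nn_integral_fst_count_space nn_integral_snd_count_space ..
  ultimately show ?thesis by simp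
qed

context group
begin

text \<open>The map from the group to the orbit of \<open>y\<close> takes each value as often as the
  stabilizer of \<open>y\<close> has elements; the weights compensate for this.\<close>

lemma nn_integral_orbits:
  fixes \<psi> :: "'v \<Rightarrow> ennreal"
  assumes K: "simplicial_action G K \<phi>" and F: "fundamental_domain G (verts K) \<phi> F" "finite F"
    and fin: "\<And>x. x \<in> verts K \<Longrightarrow> finite (stabilizer G \<phi> x)"
    and \<psi>: "\<And>z. z \<notin> verts K \<Longrightarrow> \<psi> z = 0"
  shows "(\<integral>\<^sup>+ z. \<psi> z \<partial>count_space UNIV) =
    (\<Sum>y\<in>F. ennreal (1 / real (card (stabilizer G \<phi> y))) * (\<integral>\<^sup>+ g. \<psi> (\<phi> g y) \<partial>count_space (carrier G)))"
proof -
  note act = simplicial_actionD[OF K]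
  have FK: "F \<subseteq> verts K" using F(1) unfolding fundamental_domain_def by blast
  have orb: "ennreal (1 / real (card (stabilizer G \<phi> y))) * (\<integral>\<^sup>+ g. \<psi> (\<phi> g y) \<partial>count_space (carrier G)) =
      (\<integral>\<^sup>+ z. \<psi> z * indicator (orbit G \<phi> y) z \<partial>count_space UNIV)" if "y \<in> F" for y
  proof -
    have y: "y \<in> verts K" using that FK by blast
    let ?s = "card (stabilizer G \<phi> y)"
    have "\<one> \<in> stabilizer G \<phi> y" unfolding stabilizer_def using act(3)[OF y] by simp
    hence s: "?s > 0" using fin[OF y] by (auto simp: card_gt_0_iff)
    have one: "ennreal (1 / real ?s) * of_nat ?s = 1"
      using s by (simp add: ennreal_of_nat_eq_real_of_nat ennreal_mult[symmetric])
    have fib: "emeasure (count_space UNIV) {g \<in> carrier G. \<phi> g y = z} = of_nat ?s * indicator (orbit G \<phi> y) z" for z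
    proof (cases "z \<in> orbit G \<phi> y")
      case True
      then obtain d where d: "d \<in> carrier G" "z = \<phi> d y" unfolding orbit_def by blast
      note b = bij_betw_transporter[OF K y d(1), folded d(2)]
      have "finite {g \<in> carrier G. \<phi> g y = z}" using bij_betw_finite[OF b] fin[OF y] by simp
      thus ?thesis using True bij_betw_same_card[OF b] by (simp add: emeasure_count_space)
    next
      case False
      hence empty: "{g \<in> carrier G. \<phi> g y = z} = {}" unfolding orbit_def by blast
      show ?thesis unfolding empty using False by simp
    qed
    have "(\<integral>\<^sup>+ g. \<psi> (\<phi> g y) \<partial>count_space (carrier G)) =
        (\<integral>\<^sup>+ z. of_nat ?s * (\<psi> z * indicator (orbit G \<phi> y) z) \<partial>count_space UNIV)"
      unfolding nn_integral_count_space_fibers[where \<psi> = \<psi> and p = "\<lambda>g. \<phi> g y"] fib by (simp add: ac_simps)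
    also have "\<dots> = of_nat ?s * (\<integral>\<^sup>+ z. \<psi> z * indicator (orbit G \<phi> y) z \<partial>count_space UNIV)"
      by (rule nn_integral_cmult) simp
    finally show ?thesis using one by (simp add: mult.assoc[symmetric])
  qed
  have "(\<Sum>y\<in>F. \<psi> z * indicator (orbit G \<phi> y) z) = \<psi> z" for z
  proof (cases "z \<in> verts K")
    case True
    obtain x where x: "x \<in> F" "z \<in> orbit G \<phi> x" "\<And>y. y \<in> F \<Longrightarrow> z \<in> orbit G \<phi> y \<Longrightarrow> y = x"
      by (rule fundamental_domainE[OF F(1) K True]) blast
    have "(\<Sum>y\<in>F. \<psi> z * indicator (orbit G \<phi> y) z) = (\<Sum>y\<in>F. if y = x then \<psi> z else 0)"
    proof (rule sum.cong[OF refl])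
      fix y assume y: "y \<in> F"
      show "\<psi> z * indicator (orbit G \<phi> y) z = (if y = x then \<psi> z else 0)"
      proof (cases "y = x")
        case False
        hence "z \<notin> orbit G \<phi> y" using x(3)[OF y] by blast
        thus ?thesis using False by simp
      qed (use x(2) in simp)
    qed
    thus ?thesis using F(2) x(1) by simp
  qed (simp add: \<psi>)
  hence "(\<integral>\<^sup>+ z. \<psi> z \<partial>count_space UNIV) = (\<integral>\<^sup>+ z. (\<Sum>y\<in>F. \<psi> z * indicator (orbit G \<phi> y) z) \<partial>count_space UNIV)"
    by simp
  also have "\<dots> = (\<Sum>y\<in>F. \<integral>\<^sup>+ z. \<psi> z * indicator (orbit G \<phi> y) z \<partial>count_space UNIV)"
    by (rule nn_integral_sum) simp
  also have "\<dots> = (\<Sum>y\<in>F. ennreal (1 / real (card (stabilizer G \<phi> y))) * (\<integral>\<^sup>+ g. \<psi> (\<phi> g y) \<partial>count_space (carrier G)))"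
    by (rule sum.cong[OF refl]) (rule orb[symmetric])
  finally show ?thesis .
qed

text \<open>Both sides unfold to a double sum over \<open>F\<close> of integrals over the group. By
  the diagonal invariance of \<open>\<Phi>\<close>, the exchange of its arguments becomes the
  substitution of \<open>inv g\<close> for \<open>g\<close>.\<close>

lemma mass_transport:
  fixes \<Phi> :: "'v \<Rightarrow> 'v \<Rightarrow> ennreal"
  assumes K: "simplicial_action G K \<phi>" and F: "fundamental_domain G (verts K) \<phi> F" "finite F"
    and fin: "\<And>x. x \<in> verts K \<Longrightarrow> finite (stabilizer G \<phi> x)"
    and \<Phi>0: "\<And>x z. x \<notin> verts K \<or> z \<notin> verts K \<Longrightarrow> \<Phi> x z = 0"
    and inv: "\<And>g x z. g \<in> carrier G \<Longrightarrow> x \<in> verts K \<Longrightarrow> z \<in> verts K \<Longrightarrow> \<Phi> (\<phi> g x) (\<phi> g z) = \<Phi> x z"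
  shows "(\<Sum>x\<in>F. ennreal (1 / real (card (stabilizer G \<phi> x))) * (\<integral>\<^sup>+ z. \<Phi> x z \<partial>count_space UNIV)) =
    (\<Sum>x\<in>F. ennreal (1 / real (card (stabilizer G \<phi> x))) * (\<integral>\<^sup>+ z. \<Phi> z x \<partial>count_space UNIV))"
proof -
  note act = simplicial_actionD[OF K]
  let ?a = "\<lambda>x. ennreal (1 / real (card (stabilizer G \<phi> x)))"
  have FK: "F \<subseteq> verts K" using F(1) unfolding fundamental_domain_def by blast
  have bij: "bij_betw (\<lambda>g. inv g) (carrier G) (carrier G)"
    by (rule bij_betw_byWitness[where f' = "\<lambda>g. inv g"]) auto
  have swap: "(\<integral>\<^sup>+ g. \<Phi> x (\<phi> g y) \<partial>count_space (carrier G)) = (\<integral>\<^sup>+ g. \<Phi> (\<phi> g x) y \<partial>count_space (carrier G))"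
    if "x \<in> F" "y \<in> F" for x y
  proof -
    have v: "x \<in> verts K" "y \<in> verts K" using that FK by blast+
    have "(\<integral>\<^sup>+ g. \<Phi> (\<phi> g x) y \<partial>count_space (carrier G)) = (\<integral>\<^sup>+ g. \<Phi> (\<phi> (inv g) x) y \<partial>count_space (carrier G))"
      by (rule nn_integral_bij_count_space[OF bij, symmetric])
    also have "\<dots> = (\<integral>\<^sup>+ g. \<Phi> x (\<phi> g y) \<partial>count_space (carrier G))"
    proof (rule nn_integral_cong)
      fix g assume "g \<in> space (count_space (carrier G))"
      hence g: "g \<in> carrier G" by simp
      show "\<Phi> (\<phi> (inv g) x) y = \<Phi> x (\<phi> g y)"
        using inv[OF g act(5)[OF inv_closed[OF g] v(1)] v(2)] simplicial_action_inv(2)[OF K g v(1)] by simp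
    qed
    finally show ?thesis by simp
  qed
  have "(\<Sum>x\<in>F. ?a x * (\<integral>\<^sup>+ z. \<Phi> x z \<partial>count_space UNIV)) =
      (\<Sum>x\<in>F. \<Sum>y\<in>F. ?a x * (?a y * (\<integral>\<^sup>+ g. \<Phi> (\<phi> g x) y \<partial>count_space (carrier G))))"
  proof (rule sum.cong[OF refl])
    fix x assume x: "x \<in> F"
    have "(\<integral>\<^sup>+ z. \<Phi> x z \<partial>count_space UNIV) = (\<Sum>y\<in>F. ?a y * (\<integral>\<^sup>+ g. \<Phi> x (\<phi> g y) \<partial>count_space (carrier G)))"
      by (rule nn_integral_orbits[OF K F fin]) (simp_all add: \<Phi>0)
    also have "\<dots> = (\<Sum>y\<in>F. ?a y * (\<integral>\<^sup>+ g. \<Phi> (\<phi> g x) y \<partial>count_space (carrier G)))"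
      by (rule sum.cong[OF refl]) (simp add: swap[OF x])
    finally show "?a x * (\<integral>\<^sup>+ z. \<Phi> x z \<partial>count_space UNIV) =
        (\<Sum>y\<in>F. ?a x * (?a y * (\<integral>\<^sup>+ g. \<Phi> (\<phi> g x) y \<partial>count_space (carrier G))))"
      by (simp add: sum_distrib_left)
  qed
  also have "\<dots> = (\<Sum>y\<in>F. \<Sum>x\<in>F. ?a y * (?a x * (\<integral>\<^sup>+ g. \<Phi> (\<phi> g x) y \<partial>count_space (carrier G))))"
    by (subst sum.swap) (simp add: ac_simps)
  also have "\<dots> = (\<Sum>y\<in>F. ?a y * (\<integral>\<^sup>+ z. \<Phi> z y \<partial>count_space UNIV))"
  proof (rule sum.cong[OF refl])
    fix y assume y: "y \<in> F"
    have "(\<integral>\<^sup>+ z. \<Phi> z y \<partial>count_space UNIV) = (\<Sum>x\<in>F. ?a x * (\<integral>\<^sup>+ g. \<Phi> (\<phi> g x) y \<partial>count_space (carrier G)))"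
      by (rule nn_integral_orbits[OF K F fin]) (simp_all add: \<Phi>0)
    thus "(\<Sum>x\<in>F. ?a y * (?a x * (\<integral>\<^sup>+ g. \<Phi> (\<phi> g x) y \<partial>count_space (carrier G)))) =
        ?a y * (\<integral>\<^sup>+ z. \<Phi> z y \<partial>count_space UNIV)"
      by (simp add: sum_distrib_left)
  qed
  finally show ?thesis .
qed

text \<open>Over the cosets of the intersection both means are averages over the same finite set, so
  the pointwise estimate can be averaged; the frequency of the exceptional event is then expressed
  over \<open>A\<close> again.\<close>

lemma coset_mean_diff_le:
  assumes A: "subgroup A G" "finite (rcosets A)" and B: "subgroup B G" "finite (rcosets B)"
    and u: "left_invariant G A u" and v: "left_invariant G B v" and P: "left_invariant G A P"
    and le: "\<And>t. t \<in> carrier G \<Longrightarrow> \<bar>u t - v t\<bar> \<le> e + c * of_bool (P t)"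
  shows "\<bar>coset_mean G A u - coset_mean G B v\<bar> \<le> e + c * coset_mean G A (\<lambda>t. of_bool (P t))"
proof -
  let ?M = "A \<inter> B"
  have M: "subgroup ?M G" by (rule subgroups_Inter_pair[OF A(1) B(1)])
  have fin: "finite (rcosets ?M)" by (rule finite_rcosets_Int[OF A B])
  have P': "left_invariant G A (\<lambda>t. of_bool (P t) :: real)" using P unfolding left_invariant_def by simp
  note m = coset_mean_refine[OF A M Int_lower1 fin] coset_mean_refine[OF B M Int_lower2 fin]
  define k where "k = real (card (rcosets ?M))"
  have k: "k > 0" unfolding k_def using card_rcosets_pos[OF M fin] by simp
  have "coset_mean G A u - coset_mean G B v =
      (\<Sum>C\<in>rcosets ?M. u (coset_rep C) - v (coset_rep C)) / k"
    unfolding m(1)[OF u, symmetric] m(2)[OF v, symmetric]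
    unfolding coset_mean_def k_def
    by (simp add: sum_subtractf diff_divide_distrib)
  hence "\<bar>coset_mean G A u - coset_mean G B v\<bar> = \<bar>\<Sum>C\<in>rcosets ?M. u (coset_rep C) - v (coset_rep C)\<bar> / k"
    using k by simp
  also have "\<dots> \<le> (\<Sum>C\<in>rcosets ?M. e + c * of_bool (P (coset_rep C))) / k"
  proof (intro divide_right_mono order_trans[OF sum_abs] sum_mono)
    fix C assume "C \<in> rcosets ?M"
    thus "\<bar>u (coset_rep C) - v (coset_rep C)\<bar> \<le> e + c * of_bool (P (coset_rep C))"
      using le[OF coset_rep(2)[OF M]] by blast
  qed (use k in simp)
  also have "\<dots> = e + c * coset_mean G A (\<lambda>t. of_bool (P t))"
    unfolding m(1)[OF P', symmetric]
    unfolding coset_mean_def k_def[symmetric]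
    using k by (simp add: sum.distrib sum_distrib_left[symmetric] add_divide_distrib k_def)
  finally show ?thesis .
qed

text \<open>The bridge between the two kinds of averages: the index of \<open>M\<close> cancels, and
  the right side sees \<open>M\<close> only through \<open>coset_mean\<close>. For
  \<open>\<Gamma>\<^sub>0\<close> the left side is integration against the limit; for
  \<open>N n\<close> acting freely it is the uniform average over the quotient.\<close>

lemma orbit_average:
  fixes \<psi> :: "'v \<Rightarrow> real"
  assumes K: "simplicial_action G K \<phi>" and M: "subgroup M G" "finite (rcosets M)"
    and fin: "\<And>x. x \<in> verts K \<Longrightarrow> finite (stabilizer G \<phi> x)"
    and I: "fundamental_domain G (verts K) \<phi> I" "finite I"
    and F: "fundamental_domain (G\<lparr>carrier := M\<rparr>) (verts K) \<phi> F"
    and \<psi>: "\<And>m x. m \<in> M \<Longrightarrow> x \<in> verts K \<Longrightarrow> \<psi> (\<phi> m x) = \<psi> x"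
  shows "(\<Sum>x\<in>F. \<psi> x / real (card (stabilizer (G\<lparr>carrier := M\<rparr>) \<phi> x))) /
      (\<Sum>x\<in>F. 1 / real (card (stabilizer (G\<lparr>carrier := M\<rparr>) \<phi> x))) =
    (\<Sum>i\<in>I. coset_mean G M (\<lambda>t. \<psi> (\<phi> t i)) / real (card (stabilizer G \<phi> i))) /
      (\<Sum>i\<in>I. 1 / real (card (stabilizer G \<phi> i)))"
proof -
  define k where "k = real (card (rcosets M))"
  have k: "k > 0" unfolding k_def using card_rcosets_pos[OF M] by simp
  have mean: "(\<Sum>C\<in>rcosets M. u (coset_rep C)) = k * coset_mean G M u" for u
    unfolding coset_mean_def k_def[symmetric] using k by simp
  have sum: "(\<Sum>x\<in>F. u x / real (card (stabilizer (G\<lparr>carrier := M\<rparr>) \<phi> x))) =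
      k * (\<Sum>i\<in>I. coset_mean G M (\<lambda>t. u (\<phi> t i)) / real (card (stabilizer G \<phi> i)))"
    if "\<And>m x. m \<in> M \<Longrightarrow> x \<in> verts K \<Longrightarrow> u (\<phi> m x) = u x" for u
    unfolding sum_distrib_left
  proof (rule trans[OF orbit_sum(1)[where \<psi> = u, OF K M fin I F that]])
    show "(\<Sum>i\<in>I. (\<Sum>C\<in>rcosets M. u (\<phi> (coset_rep C) i)) / real (card (stabilizer G \<phi> i))) =
        (\<Sum>i\<in>I. k * (coset_mean G M (\<lambda>t. u (\<phi> t i)) / real (card (stabilizer G \<phi> i))))"
    proof (rule sum.cong[OF refl])
      fix i
      show "(\<Sum>C\<in>rcosets M. u (\<phi> (coset_rep C) i)) / real (card (stabilizer G \<phi> i)) =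
          k * (coset_mean G M (\<lambda>t. u (\<phi> t i)) / real (card (stabilizer G \<phi> i)))"
        unfolding mean[of "\<lambda>t. u (\<phi> t i)"] by (rule times_divide_eq_right[symmetric])
    qed
  qed
  \<comment> \<open>The total weight is the same sum for the constant function 1.\<close>
  have "coset_mean G M (\<lambda>t. 1) = 1" unfolding coset_mean_def k_def[symmetric] using k k_def by simp
  hence 2: "(\<Sum>x\<in>F. 1 / real (card (stabilizer (G\<lparr>carrier := M\<rparr>) \<phi> x))) =
      k * (\<Sum>i\<in>I. 1 / real (card (stabilizer G \<phi> i)))"
    using sum[of "\<lambda>_. 1", OF refl] by (simp only:)
  have 1: "(\<Sum>x\<in>F. \<psi> x / real (card (stabilizer (G\<lparr>carrier := M\<rparr>) \<phi> x))) =
      k * (\<Sum>i\<in>I. coset_mean G M (\<lambda>t. \<psi> (\<phi> t i)) / real (card (stabilizer G \<phi> i)))"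
    by (rule sum) (rule \<psi>)
  show ?thesis unfolding 1 2 by (rule mult_divide_mult_cancel_left) (use k in simp)
qed

end

section \<open>Roots and components under translation\<close>

lemma component_verts_UN: "component_verts K V = (\<Union>n::nat. ball_verts (real n) K V)"
proof
  show "(\<Union>n::nat. ball_verts (real n) K V) \<subseteq> component_verts K V" by (rule UN_least) (rule ball_verts_component)
  show "component_verts K V \<subseteq> (\<Union>n::nat. ball_verts (real n) K V)"
  proof
    fix x assume "x \<in> component_verts K V"
    then obtain v where v: "v \<in> V" "(v, x) \<in> (adj K)\<^sup>*" unfolding component_verts_def by blast
    obtain n where "(v, x) \<in> adj K ^^ n" using rtrancl_imp_relpow[OF v(2)] by blast
    hence "x \<in> ball_verts (real n) K V" unfolding ball_verts_def using v(1) by blast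
    thus "x \<in> (\<Union>n::nat. ball_verts (real n) K V)" by blast
  qed
qed

lemma rooted_isomorphism_component_verts:
  assumes "simplicial_action G K \<phi>" "\<forall>R\<in>set Rs. R \<subseteq> verts K"
    and "rooted_isomorphism f G K \<phi> Rs L \<psi> Ss" and "V \<subseteq> verts K"
  shows "f ` component_verts K V = component_verts L (f ` V)"
  unfolding component_verts_UN image_UN rooted_isomorphism_ball_verts[OF assms] ..

text \<open>The Boolean distinguishes the two sides of the unimodularity equation.\<close>

definition adjoin :: "bool \<Rightarrow> 'a list \<Rightarrow> 'a \<Rightarrow> 'a list" where
  "adjoin b Rs R = (if b then Rs @ [R] else R # Rs)"

lemma map_adjoin: "map f (adjoin b Rs R) = adjoin b (map f Rs) (f R)"
  by (simp add: adjoin_def)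

lemma set_adjoin: "set (adjoin b Rs R) = insert R (set Rs)"
  by (simp add: adjoin_def)

lemma rooted_isomorphism_roots:
  assumes "rooted_isomorphism f G K \<phi> Rs L \<psi> Ss"
  shows "rooted_isomorphism f G K \<phi> Rs' L \<psi> (map ((`) f) Rs')"
  using assms by (simp add: rooted_isomorphism_def)

text \<open>The integrals in \<open>unimodular\<close> run over the vertices of a chosen
  representative; an isomorphism carries them, orbit by orbit, to any other model.\<close>

lemma nn_integral_representative:
  assumes L: "orbit_rooted G D L \<psi> Rs" "countable (verts L)"
  shows "(case representative (iso_class G L \<psi> Rs) of (M, \<xi>, Ts) \<Rightarrow>
      \<integral>\<^sup>+ x. F (iso_class G M \<xi> (adjoin b Ts (orbit G \<xi> x))) \<partial>count_space (verts M)) =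
    (\<integral>\<^sup>+ y. F (iso_class G L \<psi> (adjoin b Rs (orbit G \<psi> y))) \<partial>count_space (verts L))"
proof -
  note LD = orbit_rootedD[OF L(1)]
  obtain M \<xi> Ts where R: "representative (iso_class G L \<psi> Rs) = (M, \<xi>, Ts)"
    by (cases "representative (iso_class G L \<psi> Rs)")
  obtain M' \<xi>' Ts' where "(M', \<xi>', Ts') \<in> iso_class G L \<psi> Rs" by (rule nat_model[OF LD(1) L(2)])
  hence "iso_class G L \<psi> Rs \<noteq> {}" by blast
  from representative_in[OF this] have "(M, \<xi>, Ts) \<in> iso_class G L \<psi> Rs" unfolding R .
  then obtain f where f: "rooted_isomorphism f G L \<psi> Rs M \<xi> Ts" unfolding iso_class_iff rooted_iso_iff by blast
  note fD = rooted_isomorphismD[OF f]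
  have bij: "bij_betw f (verts L) (verts M)" using fD(1,2) by (simp add: bij_betw_def)
  have eq: "iso_class G M \<xi> (adjoin b Ts (orbit G \<xi> (f y))) = iso_class G L \<psi> (adjoin b Rs (orbit G \<psi> y))"
    if y: "y \<in> verts L" for y
  proof (rule iso_class_eqI[symmetric, OF LD(1)])
    show "\<forall>R\<in>set (adjoin b Rs (orbit G \<psi> y)). R \<subseteq> verts L"
      unfolding set_adjoin using LD(3) orbit_subset_verts[OF LD(1) y] by blast
    show "rooted_iso G L \<psi> (adjoin b Rs (orbit G \<psi> y)) M \<xi> (adjoin b Ts (orbit G \<xi> (f y)))"
      unfolding rooted_iso_iff rooted_isomorphism_orbit[OF f y, symmetric] fD(4)[symmetric] map_adjoin[symmetric]
      by (rule exI, rule rooted_isomorphism_roots[OF f])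
  qed
  have "(\<integral>\<^sup>+ x. F (iso_class G M \<xi> (adjoin b Ts (orbit G \<xi> x))) \<partial>count_space (verts M)) =
      (\<integral>\<^sup>+ y. F (iso_class G M \<xi> (adjoin b Ts (orbit G \<xi> (f y)))) \<partial>count_space (verts L))"
    by (rule nn_integral_bij_count_space[OF bij, symmetric])
  also have "\<dots> = (\<integral>\<^sup>+ y. F (iso_class G L \<psi> (adjoin b Rs (orbit G \<psi> y))) \<partial>count_space (verts L))"
    by (intro nn_integral_cong) (simp add: eq)
  finally show ?thesis unfolding R by simp
qed

section \<open>Components for the action of \<open>H\<close> and their induced complexes\<close>

locale proper_cocompact_action = group \<Gamma> for \<Gamma> :: "('g, 'b) monoid_scheme" (structure) +
  fixes K :: "'v set set" and \<phi> :: "'g \<Rightarrow> 'v \<Rightarrow> 'v" and D :: real and G H :: "'g set"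
  assumes act: "simplicial_action \<Gamma> K \<phi>"
    and deg: "vertex_degree K \<le> ennreal D"
    and fin_stab: "v \<in> verts K \<Longrightarrow> finite (stabilizer \<Gamma> \<phi> v)"
    and fin_orbits: "finite (orbits \<Gamma> (verts K) \<phi>)"
    and G_sub: "subgroup G \<Gamma>" and fin_G: "finite G"
    and H_def: "H = {g \<in> G. finite {t \<otimes> g \<otimes> inv t | t. t \<in> carrier \<Gamma>}}"
begin

abbreviation "GG \<equiv> \<Gamma>\<lparr>carrier := G\<rparr>"
abbreviation "HH \<equiv> \<Gamma>\<lparr>carrier := H\<rparr>"

lemma H_sub: "subgroup H \<Gamma>" and H_G: "H \<subseteq> G"
  unfolding H_def by (rule finite_conjugates_subgroup[OF G_sub]) blast

sublocale ind: subgroup_induction GG H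
  by (rule subgroup_induction_restrict[OF G_sub H_sub H_G])

lemma ind_GH: "GG\<lparr>carrier := H\<rparr> = HH"
  by simp

lemma fin_GG: "finite (carrier GG)" and fin_HH: "finite (carrier HH)"
  using fin_G finite_subset[OF H_G] by simp_all

lemma act_H: "simplicial_action HH K \<phi>"
  by (rule simplicial_action_subgroup[OF act H_sub])

lemmas actD = simplicial_actionD[OF act] simplicial_action_inv[OF act]

abbreviation H_orbit :: "'v \<Rightarrow> 'v set" where
  "H_orbit x \<equiv> orbit HH \<phi> x"

definition H_comp :: "'v \<Rightarrow> 'v set set" where
  "H_comp x = components_meeting K (H_orbit x)"

abbreviation ind_comp where "ind_comp x \<equiv> ind_complex GG H (H_comp x) \<phi>"
abbreviation ind_comp_action where "ind_comp_action x \<equiv> ind_action GG H (H_comp x) \<phi>"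
abbreviation G_root where "G_root x \<equiv> ind_root GG H \<phi> (H_orbit x)"

text \<open>The points at which the limit measure is concentrated.\<close>

definition ind_at :: "'v \<Rightarrow> 'g model set" where
  "ind_at x = ind_class GG H (class_at HH K \<phi> x)"

lemma H_comp:
  assumes "x \<in> verts K"
  shows "orbit_rooted HH D (H_comp x) \<phi> [H_orbit x]" "verts (H_comp x) = component_verts K (H_orbit x)"
    "countable (verts (H_comp x))"
proof -
  show 1: "orbit_rooted HH D (H_comp x) \<phi> [H_orbit x]" "verts (H_comp x) = component_verts K (H_orbit x)"
    unfolding H_comp_def by (rule orbit_rooted_components[OF act_H deg assms])+
  show "countable (verts (H_comp x))" by (rule countable_verts[OF 1(1) _ fin_HH]) simp
qed

lemma ind_comp:
  assumes "x \<in> verts K"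
  shows "orbit_rooted GG D (ind_comp x) (ind_comp_action x) [G_root x]" "countable (verts (ind_comp x))"
proof -
  show 1: "orbit_rooted GG D (ind_comp x) (ind_comp_action x) [G_root x]"
    using ind.orbit_rooted_ind[of D "H_comp x" \<phi> "[H_orbit x]"] H_comp(1)[OF assms] unfolding ind_GH by simp
  show "countable (verts (ind_comp x))" by (rule countable_verts[OF 1 _ fin_GG]) simp
qed

lemma ind_at_eq:
  assumes "x \<in> verts K"
  shows "ind_at x = iso_class GG (ind_comp x) (ind_comp_action x) [G_root x]"
  using ind.ind_class_eq[of D "H_comp x" \<phi> "[H_orbit x]"] H_comp(1,3)[OF assms]
  unfolding ind_GH ind_at_def class_at_def H_comp_def by simp

lemma class_at_SC: "x \<in> verts K \<Longrightarrow> class_at HH K \<phi> x \<in> SC HH D 1"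
  by (rule class_at_in_SC[OF act_H deg _ fin_HH])

lemma ind_at_SC: "x \<in> verts K \<Longrightarrow> ind_at x \<in> SC GG D 1"
  unfolding ind_at_def
  using ind.ind_class_in_SC[OF fin_GG, of "class_at HH K \<phi> x" D 1] class_at_SC unfolding ind_GH by simp

text \<open>Commuting with \<open>H\<close> is exactly what makes translation by \<open>t\<close>
  equivariant for \<open>H\<close>. For \<open>G\<close> it would in general fail, which is why
  classes are formed over \<open>H\<close> first and induced afterwards.\<close>

lemma translate_iso:
  assumes t: "t \<in> carrier \<Gamma>" and comm: "\<And>h. h \<in> H \<Longrightarrow> t \<otimes> h = h \<otimes> t"
  shows "rooted_isomorphism (\<phi> t) HH K \<phi> Rs K \<phi> (map ((`) (\<phi> t)) Rs)"
proof (rule rooted_isomorphismI)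
  have it: "inv t \<in> carrier \<Gamma>" using t by simp
  show "inj_on (\<phi> t) (verts K)" by (rule simplicial_action_inj[OF act t])
  show "\<phi> t ` verts K = verts K"
  proof
    show "\<phi> t ` verts K \<subseteq> verts K" using actD(5)[OF t] by blast
    show "verts K \<subseteq> \<phi> t ` verts K"
    proof
      fix x assume x: "x \<in> verts K"
      have "x = \<phi> t (\<phi> (inv t) x)" using actD(8)[OF t x] by simp
      thus "x \<in> \<phi> t ` verts K" using actD(5)[OF it x] by blast
    qed
  qed
  show "(`) (\<phi> t) ` K = K"
  proof
    show "(`) (\<phi> t) ` K \<subseteq> K" using actD(2)[OF t] by blast
    show "K \<subseteq> (`) (\<phi> t) ` K"
    proof
      fix \<sigma> assume \<sigma>: "\<sigma> \<in> K"
      have "\<phi> t ` \<phi> (inv t) ` \<sigma> = (\<lambda>x. x) ` \<sigma>"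
        unfolding image_image by (rule image_cong[OF refl]) (rule actD(8)[OF t verts_insert[OF \<sigma>]])
      hence "\<sigma> = \<phi> t ` \<phi> (inv t) ` \<sigma>" by simp
      thus "\<sigma> \<in> (`) (\<phi> t) ` K" using actD(2)[OF it \<sigma>] by blast
    qed
  qed
  fix h x assume "h \<in> carrier HH" and x: "x \<in> verts K"
  hence h: "h \<in> H" "h \<in> carrier \<Gamma>" using subgroup.mem_carrier[OF H_sub] by simp_all
  show "\<phi> t (\<phi> h x) = \<phi> h (\<phi> t x)"
    using actD(4)[OF t h(2) x] actD(4)[OF h(2) t x] comm[OF h(1)] by simp
qed simp

lemma translate_comp:
  assumes t: "t \<in> carrier \<Gamma>" and comm: "\<And>h. h \<in> H \<Longrightarrow> t \<otimes> h = h \<otimes> t"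
    and x: "x \<in> verts K"
  shows "rooted_isomorphism (\<phi> t) HH (H_comp x) \<phi> Rs (H_comp (\<phi> t x)) \<phi> (map ((`) (\<phi> t)) Rs)"
    and "\<phi> t ` component_verts K (H_orbit x) = component_verts K (H_orbit (\<phi> t x))"
    and "\<And>z. z \<in> verts K \<Longrightarrow> \<phi> t ` H_orbit z = H_orbit (\<phi> t z)"
proof -
  note iso = translate_iso[OF t comm]
  show r: "\<phi> t ` H_orbit z = H_orbit (\<phi> t z)" if "z \<in> verts K" for z
    by (rule rooted_isomorphism_orbit[OF iso[of "[]"] that]) 
  have V: "H_orbit x \<subseteq> verts K" by (rule orbit_subset_verts[OF act_H x])
  show c: "\<phi> t ` component_verts K (H_orbit x) = component_verts K (H_orbit (\<phi> t x))"
    using rooted_isomorphism_component_verts[OF act_H _ iso[of "[]"] V] r[OF x] by simp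
  show "rooted_isomorphism (\<phi> t) HH (H_comp x) \<phi> Rs (H_comp (\<phi> t x)) \<phi> (map ((`) (\<phi> t)) Rs)"
    unfolding H_comp_def components_meeting_eq c[symmetric]
    by (rule rooted_isomorphism_full[OF act_H iso component_verts_subset[OF V]])
qed

lemma ind_at_translate:
  assumes t: "t \<in> carrier \<Gamma>" and comm: "\<And>h. h \<in> H \<Longrightarrow> t \<otimes> h = h \<otimes> t"
    and x: "x \<in> verts K"
  shows "ind_at (\<phi> t x) = ind_at x"
proof -
  note CD = orbit_rootedD[OF H_comp(1)[OF x]]
  have "rooted_iso HH (H_comp x) \<phi> [H_orbit x] (H_comp (\<phi> t x)) \<phi> [H_orbit (\<phi> t x)]"
    unfolding rooted_iso_iff using translate_comp(1)[OF t comm x, of "[H_orbit x]"] translate_comp(3)[OF t comm x x]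
    by (auto intro: exI[of _ "\<phi> t"])
  from iso_class_eqI[OF CD(1,3) this] show ?thesis unfolding ind_at_def class_at_def H_comp_def by simp
qed

text \<open>Being joined by a path up to an element of \<open>H\<close> is an equivalence relation:
  the element can be moved to the other end by its inverse. So the root may be changed without
  changing the complex.\<close>

lemma component_verts_root:
  assumes x: "x \<in> verts K" and z: "z \<in> component_verts K (H_orbit x)"
  shows "x \<in> component_verts K (H_orbit z)" "component_verts K (H_orbit z) = component_verts K (H_orbit x)"
proof -
  have V: "H_orbit x \<subseteq> verts K" by (rule orbit_subset_verts[OF act_H x])
  have zv: "z \<in> verts K" using z component_verts_subset[OF V] by blast
  have sub: "component_verts K (H_orbit b) \<subseteq> component_verts K (H_orbit a)"
    if a: "a \<in> verts K" and b: "b \<in> component_verts K (H_orbit a)" for a b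
  proof
    fix w assume "w \<in> component_verts K (H_orbit b)"
    then obtain v where v: "v \<in> H_orbit b" "(v, w) \<in> (adj K)\<^sup>*" unfolding component_verts_def by blast
    then obtain h where h: "h \<in> H" "v = \<phi> h b" unfolding orbit_def by auto
    have "v \<in> component_verts K (H_orbit a)"
      unfolding h(2) by (rule component_verts_invariant[OF act_H _ orbit_closed[OF act_H a] b]) (use h(1) in simp_all)
    thus "w \<in> component_verts K (H_orbit a)"
      unfolding component_verts_def using v(2) by (blast intro: rtrancl_trans)
  qed
  obtain h where h: "h \<in> H" "(\<phi> h x, z) \<in> (adj K)\<^sup>*" using z unfolding component_verts_def orbit_def by auto
  have hc: "h \<in> carrier \<Gamma>" by (rule subgroup.mem_carrier[OF H_sub h(1)])
  have ih: "inv h \<in> H" by (rule subgroup.m_inv_closed[OF H_sub h(1)])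
  have "(\<phi> (inv h) (\<phi> h x), \<phi> (inv h) z) \<in> (adj K)\<^sup>*"
    by (rule rtrancl_image[of "adj K", OF simplicial_action_adj[OF act inv_closed[OF hc]] h(2)])
  hence "(x, \<phi> (inv h) z) \<in> (adj K)\<^sup>*" using actD(7)[OF hc x] by simp
  hence "(\<phi> (inv h) z, x) \<in> (adj K)\<^sup>*" by (rule adj_rtrancl_sym)
  thus xz: "x \<in> component_verts K (H_orbit z)" unfolding component_verts_def orbit_def using ih by auto
  show "component_verts K (H_orbit z) = component_verts K (H_orbit x)"
    using sub[OF x z] sub[OF zv xz] by blast
qed

text \<open>The class at which the test function of unimodularity is evaluated; \<open>b\<close>
  tells whether the new root \<open>z\<close> comes last or first.\<close>

definition two_rooted :: "bool \<Rightarrow> 'v \<Rightarrow> 'v \<Rightarrow> 'g model set" where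
  "two_rooted b x z = iso_class GG (ind_comp x) (ind_comp_action x) (adjoin b [G_root x] (G_root z))"

text \<open>Both sides list the roots in the same order and could differ only in the underlying
  complex, which is the same seen from \<open>x\<close> or from \<open>z\<close>.\<close>

lemma two_rooted_swap:
  assumes "x \<in> verts K" "z \<in> component_verts K (H_orbit x)"
  shows "two_rooted False x z = two_rooted True z x"
proof -
  have "H_comp z = H_comp x"
    unfolding H_comp_def components_meeting_eq component_verts_root(2)[OF assms] ..
  thus ?thesis unfolding two_rooted_def adjoin_def by simp
qed

text \<open>Translation by \<open>t\<close> carries both roots along, and
  \<open>ind_isomorphism\<close> lifts it. This is the diagonal invariance that
  \<open>mass_transport\<close> asks for.\<close>

lemma two_rooted_translate:
  assumes t: "t \<in> carrier \<Gamma>" and comm: "\<And>h. h \<in> H \<Longrightarrow> t \<otimes> h = h \<otimes> t"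
    and x: "x \<in> verts K" and z: "z \<in> component_verts K (H_orbit x)"
  shows "two_rooted b (\<phi> t x) (\<phi> t z) = two_rooted b x z"
proof -
  have V: "H_orbit x \<subseteq> verts K" by (rule orbit_subset_verts[OF act_H x])
  have zv: "z \<in> verts K" using z component_verts_subset[OF V] by blast
  let ?Rs = "adjoin b [H_orbit x] (H_orbit z)"
  note tr = translate_comp(1)[OF t comm x] translate_comp(3)[OF t comm x]
  have eq: "map ((`) (\<phi> t)) ?Rs = adjoin b [H_orbit (\<phi> t x)] (H_orbit (\<phi> t z))"
    unfolding map_adjoin using tr(2) x zv by simp
  note CD = orbit_rootedD[OF H_comp(1)[OF x]]
  have rz: "H_orbit z \<subseteq> verts (H_comp x)"
    unfolding H_comp(2)[OF x] component_verts_root(2)[OF x z, symmetric] by (rule component_verts_center)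
  have sub: "\<forall>R\<in>set ?Rs. R \<subseteq> verts (H_comp x)" unfolding set_adjoin using CD(3) rz by simp
  have "rooted_isomorphism (\<phi> t) HH (H_comp x) \<phi> ?Rs (H_comp (\<phi> t x)) \<phi> (adjoin b [H_orbit (\<phi> t x)] (H_orbit (\<phi> t z)))"
    using tr(1)[of ?Rs] unfolding eq .
  from ind.ind_isomorphism[unfolded ind_GH, OF CD(1) sub this]
  have "rooted_iso GG (ind_comp x) (ind_comp_action x) (adjoin b [G_root x] (G_root z))
      (ind_comp (\<phi> t x)) (ind_comp_action (\<phi> t x)) (adjoin b [G_root (\<phi> t x)] (G_root (\<phi> t z)))"
    unfolding rooted_iso_iff map_adjoin by auto
  moreover have "\<forall>R\<in>set (adjoin b [G_root x] (G_root z)). R \<subseteq> verts (ind_comp x)"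
    unfolding set_adjoin verts_ind_complex using CD(3) rz unfolding ind_root_def by auto
  ultimately show ?thesis
    unfolding two_rooted_def
    by (intro iso_class_eqI[symmetric] orbit_rootedD(1)[OF ind_comp(1)[OF x]])
qed

text \<open>The orbit under \<open>G\<close> of the class of \<open>(g, z)\<close> does not depend
  on \<open>g\<close>. So the second root runs over the vertices of the \<open>H\<close>-component,
  once for each left coset of \<open>H\<close>.\<close>

lemma nn_integral_ind_at:
  assumes x: "x \<in> verts K"
  shows "(case representative (ind_at x) of (M, \<xi>, Ts) \<Rightarrow>
      \<integral>\<^sup>+ y. F (iso_class GG M \<xi> (adjoin b Ts (orbit GG \<xi> y))) \<partial>count_space (verts M)) =
    of_nat (card ind.left_reps) *
      (\<integral>\<^sup>+ z. F (two_rooted b x z) * indicator (component_verts K (H_orbit x)) z \<partial>count_space UNIV)"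
proof -
  note C = H_comp[OF x] and CD = orbit_rootedD[OF H_comp(1)[OF x]]
  have CD1: "simplicial_action ind.GH (H_comp x) \<phi>" unfolding ind_GH by (rule CD(1))
  have cK: "verts (H_comp x) \<subseteq> verts K"
    unfolding C(2) by (rule component_verts_subset[OF orbit_subset_verts[OF act_H x]])
  have orb: "orbit GG (ind_comp_action x) (ind_pt GG H \<phi> g z) = G_root z"
    if g: "g \<in> carrier GG" and z: "z \<in> verts (H_comp x)" for g z
  proof -
    have v: "ind_pt GG H \<phi> \<one>\<^bsub>GG\<^esub> z \<in> verts (ind_comp x)"
      unfolding verts_ind_complex by (rule ind_rootI[OF ind.one_closed z])
    have "ind_pt GG H \<phi> g z = ind_comp_action x g (ind_pt GG H \<phi> \<one>\<^bsub>GG\<^esub> z)"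
      using ind.ind_action_pt[OF z ind.one_closed g] g ind.r_one[OF g] by simp
    hence "orbit GG (ind_comp_action x) (ind_pt GG H \<phi> g z) =
        orbit GG (ind_comp_action x) (ind_pt GG H \<phi> \<one>\<^bsub>GG\<^esub> z)"
      using orbit_translate[OF orbit_rootedD(1)[OF ind_comp(1)[OF x]] v g] by simp
    thus ?thesis using ind.ind_root_orbit[OF CD1 z] unfolding ind_GH by simp
  qed
  have "(\<integral>\<^sup>+ Y. F (iso_class GG (ind_comp x) (ind_comp_action x) (adjoin b [G_root x] (orbit GG (ind_comp_action x) Y)))
        \<partial>count_space (verts (ind_comp x))) =
      of_nat (card ind.left_reps) * (\<integral>\<^sup>+ z. F (two_rooted b x z) \<partial>count_space (verts (H_comp x)))"
    by (rule ind.nn_integral_ind[OF fin_GG CD1 C(3)]) (simp add: orb two_rooted_def)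
  also have "(\<integral>\<^sup>+ z. F (two_rooted b x z) \<partial>count_space (verts (H_comp x))) =
      (\<integral>\<^sup>+ z. F (two_rooted b x z) * indicator (component_verts K (H_orbit x)) z \<partial>count_space UNIV)"
    unfolding C(2) by (rule nn_integral_count_space_indicator) simp
  finally show ?thesis
    unfolding ind_at_eq[OF x] nn_integral_representative[OF ind_comp[OF x]] .
qed

end

section \<open>The limit measure\<close>

context proper_cocompact_action
begin

lemma orbit_representatives:
  obtains I where "fundamental_domain \<Gamma> (verts K) \<phi> I" "finite I" "I \<subseteq> verts K" "I \<noteq> {}"
proof -
  obtain I where I: "fundamental_domain \<Gamma> (verts K) \<phi> I" by (rule fundamental_domain_exists[OF act])
  have sub: "I \<subseteq> verts K" using I unfolding fundamental_domain_def by blast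
  obtain \<sigma> where \<sigma>: "\<sigma> \<in> K" using actD(1) unfolding simplicial_complex_def by blast
  obtain v where "v \<in> \<sigma>" using simplicial_complexD(2)[OF actD(1) \<sigma>] by blast
  hence v: "v \<in> verts K" by (rule verts_insert[OF \<sigma>])
  have "I \<noteq> {}" by (rule fundamental_domainE[OF I act v]) blast
  thus thesis by (rule that[OF I finite_fundamental_domain[OF I act fin_orbits] sub])
qed

lemma stabilizer_subgroup:
  assumes "subgroup M \<Gamma>" "x \<in> verts K"
  shows "finite (stabilizer (\<Gamma>\<lparr>carrier := M\<rparr>) \<phi> x)" "card (stabilizer (\<Gamma>\<lparr>carrier := M\<rparr>) \<phi> x) > 0"
proof -
  have "stabilizer (\<Gamma>\<lparr>carrier := M\<rparr>) \<phi> x \<subseteq> stabilizer \<Gamma> \<phi> x"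
    unfolding stabilizer_def using subgroup.subset[OF assms(1)] by auto
  thus fin: "finite (stabilizer (\<Gamma>\<lparr>carrier := M\<rparr>) \<phi> x)" using fin_stab[OF assms(2)] finite_subset by blast
  have "\<one> \<in> stabilizer (\<Gamma>\<lparr>carrier := M\<rparr>) \<phi> x"
    unfolding stabilizer_def using subgroup.one_closed[OF assms(1)] actD(3)[OF assms(2)] by simp
  thus "card (stabilizer (\<Gamma>\<lparr>carrier := M\<rparr>) \<phi> x) > 0" using fin by (auto simp: card_gt_0_iff)
qed

text \<open>A subgroup of finite index inherits cocompactness; the counting in
  \<open>orbit_sum\<close>, used for the zero function, already contains this.\<close>

lemma fundamental_domain_subgroup:
  assumes M: "subgroup M \<Gamma>" "finite (rcosets M)"
    and F: "fundamental_domain (\<Gamma>\<lparr>carrier := M\<rparr>) (verts K) \<phi> F"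
  shows "finite F" "F \<subseteq> verts K" "F \<noteq> {}" "orbit_weight (\<Gamma>\<lparr>carrier := M\<rparr>) \<phi> F > 0"
proof -
  obtain I where I: "fundamental_domain \<Gamma> (verts K) \<phi> I" "finite I" "I \<subseteq> verts K" "I \<noteq> {}" by (rule orbit_representatives)
  show fin: "finite F" by (rule orbit_sum(2)[OF act M fin_stab I(1,2) F, of "\<lambda>_. 0"]) simp_all
  show sub: "F \<subseteq> verts K" using F unfolding fundamental_domain_def by blast
  obtain v where v: "v \<in> verts K" using I(3,4) by blast
  show ne: "F \<noteq> {}"
    by (rule fundamental_domainE[OF F simplicial_action_subgroup[OF act M(1)] v]) blast
  have "card (stabilizer (\<Gamma>\<lparr>carrier := M\<rparr>) \<phi> x) > 0" if "x \<in> F" for x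
    by (rule stabilizer_subgroup(2)[OF M(1)]) (use that sub in blast)
  thus "orbit_weight (\<Gamma>\<lparr>carrier := M\<rparr>) \<phi> F > 0"
    unfolding orbit_weight_def by (intro sum_pos fin ne) simp
qed

section \<open>The limit measure for fixed \<open>\<Gamma>\<^sub>0\<close> and
  \<open>F\<^sub>0\<close>\<close>

context
  fixes \<Gamma>\<^sub>0 :: "'g set" and F\<^sub>0 :: "'v set"
  assumes sub0: "subgroup \<Gamma>\<^sub>0 \<Gamma>" "finite (rcosets \<Gamma>\<^sub>0)"
    and comm: "\<And>t h. t \<in> \<Gamma>\<^sub>0 \<Longrightarrow> h \<in> H \<Longrightarrow> t \<otimes> h = h \<otimes> t"
    and F0: "fundamental_domain (\<Gamma>\<lparr>carrier := \<Gamma>\<^sub>0\<rparr>) (verts K) \<phi> F\<^sub>0"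
begin

abbreviation "G0 \<equiv> \<Gamma>\<lparr>carrier := \<Gamma>\<^sub>0\<rparr>"
abbreviation "stab0 x \<equiv> real (card (stabilizer G0 \<phi> x))"
abbreviation "w0 \<equiv> orbit_weight G0 \<phi> F\<^sub>0"
abbreviation "weights \<equiv> point_measure F\<^sub>0 (\<lambda>x. ennreal (1 / w0 * (1 / stab0 x)))"
abbreviation "\<mu>G \<equiv> ind_measure GG H D (cocompact_complex_measure HH D K \<phi> G0 F\<^sub>0)"

lemmas F0' = fundamental_domain_subgroup[OF sub0 F0]

lemma F0_verts: "x \<in> F\<^sub>0 \<Longrightarrow> x \<in> verts K"
  using F0'(2) by blast

lemma ind_at_invariant:
  assumes "t \<in> \<Gamma>\<^sub>0" "x \<in> verts K"
  shows "ind_at (\<phi> t x) = ind_at x"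
  by (rule ind_at_translate[OF subgroup.mem_carrier[OF sub0(1) assms(1)] comm[OF assms(1)] assms(2)])

lemma ind_at_measurable: "ind_at \<in> measurable weights (SC_borel GG D 1)"
  unfolding measurable_point_measure_eq1 using ind_at_SC F0_verts by simp

text \<open>With the two push-forwards composed, integrals against the limit are finite sums over
  \<open>F\<^sub>0\<close>.\<close>

lemma \<mu>G_eq: "\<mu>G = distr weights (SC_borel GG D 1) ind_at"
proof -
  have 1: "ind_class GG H \<in> measurable (SC_borel HH D 1) (SC_borel GG D 1)"
    using ind.ind_class_measurable[OF fin_GG, of 1 D] unfolding ind_GH by simp
  have 2: "class_at HH K \<phi> \<in> measurable weights (SC_borel HH D 1)"
    unfolding measurable_point_measure_eq1 using class_at_SC F0_verts by simp
  have "ind_class GG H \<circ> class_at HH K \<phi> = ind_at" by (rule ext) (simp add: ind_at_def)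
  thus ?thesis
    unfolding ind_measure_def cocompact_complex_measure_def distr_distr[OF 1 2] by simp
qed

lemma prob_space_\<mu>G: "prob_space \<mu>G"
proof -
  have "(\<Sum>x\<in>F\<^sub>0. 1 / w0 * (1 / stab0 x)) = 1 / w0 * w0"
    unfolding sum_distrib_left[symmetric] by (simp only: orbit_weight_def)
  hence "(\<Sum>x\<in>F\<^sub>0. 1 / w0 * (1 / stab0 x)) = 1" using F0'(4) by simp
  hence "(\<Sum>x\<in>F\<^sub>0. ennreal (1 / w0 * (1 / stab0 x))) = 1"
    using F0'(4) by (subst sum_ennreal) simp_all
  hence "prob_space weights" by (intro prob_space_point_measure F0'(1)) simp_all
  thus ?thesis unfolding \<mu>G_eq by (rule prob_space.prob_space_distr[OF _ ind_at_measurable])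
qed

lemma integral_\<mu>G:
  fixes f :: "'g model set \<Rightarrow> real"
  assumes "f \<in> borel_measurable (SC_borel GG D 1)"
  shows "(\<integral>C. f C \<partial>\<mu>G) = (\<Sum>x\<in>F\<^sub>0. f (ind_at x) / stab0 x) / w0"
proof -
  have "(\<integral>C. f C \<partial>\<mu>G) = (\<integral>x. f (ind_at x) \<partial>weights)"
    unfolding \<mu>G_eq by (rule integral_distr[OF ind_at_measurable assms])
  also have "\<dots> = (\<Sum>x\<in>F\<^sub>0. (1 / w0 * (1 / stab0 x)) *\<^sub>R f (ind_at x))"
    by (rule lebesgue_integral_point_measure_finite[OF F0'(1)]) (use F0'(4) in simp)
  also have "\<dots> = (\<Sum>x\<in>F\<^sub>0. f (ind_at x) / stab0 x) / w0"
    unfolding sum_divide_distrib by (rule sum.cong[OF refl]) simp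
  finally show ?thesis .
qed

text \<open>The integrands of unimodularity depend on the choice made by
  \<open>representative\<close>, so their measurability is not at hand; concentration on finitely
  many Borel points replaces it.\<close>

lemma nn_integral_\<mu>G: "(\<integral>\<^sup>+ C. F C \<partial>\<mu>G) = ennreal (1 / w0) * (\<Sum>x\<in>F\<^sub>0. ennreal (1 / stab0 x) * F (ind_at x))"
proof -
  have "(\<integral>\<^sup>+ C. F C \<partial>\<mu>G) = (\<Sum>x\<in>F\<^sub>0. ennreal (1 / w0 * (1 / stab0 x)) * F (ind_at x))"
    unfolding \<mu>G_eq
  proof (rule nn_integral_distr_point_measure[OF F0'(1)])
    show "ind_at \<in> F\<^sub>0 \<rightarrow> space (SC_borel GG D 1)" using ind_at_SC F0_verts by simp
    show "{ind_at x} \<in> sets (SC_borel GG D 1)" if "x \<in> F\<^sub>0" for x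
      by (rule singleton_SC_borel[OF ind_at_SC[OF F0_verts[OF that]] _ fin_GG]) simp
  qed
  also have "\<dots> = (\<Sum>x\<in>F\<^sub>0. ennreal (1 / w0) * (ennreal (1 / stab0 x) * F (ind_at x)))"
  proof (rule sum.cong[OF refl])
    fix x
    have "ennreal (1 / w0 * (1 / stab0 x)) = ennreal (1 / w0) * ennreal (1 / stab0 x)"
      by (rule ennreal_mult) (use F0'(4) in simp_all)
    thus "ennreal (1 / w0 * (1 / stab0 x)) * F (ind_at x) = ennreal (1 / w0) * (ennreal (1 / stab0 x) * F (ind_at x))"
      by (simp only: mult.assoc)
  qed
  finally show ?thesis by (simp only: sum_distrib_left)
qed

lemma unimodular_\<mu>G: "unimodular GG D \<mu>G"
  unfolding unimodular_def
proof (intro allI impI)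
  fix f :: "'g model set \<Rightarrow> real"
  let ?F = "\<lambda>C. ennreal (f C)"
  \<comment> \<open>The index of \<open>H\<close> in \<open>G\<close>, a factor common to both
    sides.\<close>
  let ?\<kappa> = "of_nat (card ind.left_reps) :: ennreal"
  \<comment> \<open>The mass sent from \<open>x\<close> to \<open>z\<close>. It is set to 0 between
    different \<open>H\<close>-components, where \<open>x\<close> and \<open>z\<close> are not roots
    of a common connected class.\<close>
  define \<Phi> where "\<Phi> x z = (if x \<in> verts K \<and> z \<in> component_verts K (H_orbit x) then ?F (two_rooted True x z) else 0)" for x z
  have cK: "component_verts K (H_orbit x) \<subseteq> verts K" if "x \<in> verts K" for x
    by (rule component_verts_subset[OF orbit_subset_verts[OF act_H that]])
  have act0: "simplicial_action G0 K \<phi>" by (rule simplicial_action_subgroup[OF act sub0(1)])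
  have transport: "(\<Sum>x\<in>F\<^sub>0. ennreal (1 / stab0 x) * (\<integral>\<^sup>+ z. \<Phi> x z \<partial>count_space UNIV)) =
      (\<Sum>x\<in>F\<^sub>0. ennreal (1 / stab0 x) * (\<integral>\<^sup>+ z. \<Phi> z x \<partial>count_space UNIV))"
  proof (rule group.mass_transport[OF simplicial_actionD(6)[OF act0] act0 F0 F0'(1)])
    show "finite (stabilizer G0 \<phi> x)" if "x \<in> verts K" for x by (rule stabilizer_subgroup(1)[OF sub0(1) that])
    show "\<Phi> x z = 0" if "x \<notin> verts K \<or> z \<notin> verts K" for x z
      unfolding \<Phi>_def using that cK by auto
    fix t x z assume "t \<in> carrier G0" and x: "x \<in> verts K" and z: "z \<in> verts K"
    hence t: "t \<in> \<Gamma>\<^sub>0" by simp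
    have tc: "t \<in> carrier \<Gamma>" by (rule subgroup.mem_carrier[OF sub0(1) t])
    have tx: "\<phi> t x \<in> verts K" by (rule actD(5)[OF tc x])
    have img: "\<phi> t ` component_verts K (H_orbit x) = component_verts K (H_orbit (\<phi> t x))"
      by (rule translate_comp(2)[OF tc comm[OF t] x])
    have mem: "\<phi> t z \<in> component_verts K (H_orbit (\<phi> t x)) \<longleftrightarrow> z \<in> component_verts K (H_orbit x)"
      unfolding img[symmetric]
      by (rule inj_on_image_mem_iff[OF simplicial_action_inj[OF act tc] z cK[OF x]])
    show "\<Phi> (\<phi> t x) (\<phi> t z) = \<Phi> x z"
    proof (cases "z \<in> component_verts K (H_orbit x)")
      case True
      thus ?thesis unfolding \<Phi>_def using mem x tx two_rooted_translate[OF tc comm[OF t] x True] by simp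
    next
      case False
      thus ?thesis unfolding \<Phi>_def using mem by simp
    qed
  qed
  have gT: "(\<integral>\<^sup>+ z. ?F (two_rooted True x z) * indicator (component_verts K (H_orbit x)) z \<partial>count_space UNIV) =
      (\<integral>\<^sup>+ z. \<Phi> x z \<partial>count_space UNIV)" if x: "x \<in> verts K" for x
    by (rule nn_integral_cong) (simp add: \<Phi>_def x indicator_def)
  \<comment> \<open>Putting the new root in front exchanges sender and receiver.\<close>
  have gF: "(\<integral>\<^sup>+ z. ?F (two_rooted False x z) * indicator (component_verts K (H_orbit x)) z \<partial>count_space UNIV) =
      (\<integral>\<^sup>+ z. \<Phi> z x \<partial>count_space UNIV)" if x: "x \<in> verts K" for x
  proof (rule nn_integral_cong)
    fix z
    show "?F (two_rooted False x z) * indicator (component_verts K (H_orbit x)) z = \<Phi> z x"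
    proof (cases "z \<in> component_verts K (H_orbit x)")
      case True
      hence "z \<in> verts K" "x \<in> component_verts K (H_orbit z)" using cK[OF x] component_verts_root(1)[OF x] by blast+
      thus ?thesis unfolding \<Phi>_def two_rooted_swap[OF x True] using True by simp
    next
      case False
      hence not: "\<not> (z \<in> verts K \<and> x \<in> component_verts K (H_orbit z))" using component_verts_root(1) by blast
      show ?thesis unfolding \<Phi>_def if_not_P[OF not] using False by simp
    qed
  qed
  let ?L = "\<lambda>b C. case representative C of (M, \<xi>, Ts) \<Rightarrow>
      \<integral>\<^sup>+ y. ?F (iso_class GG M \<xi> (adjoin b Ts (orbit GG \<xi> y))) \<partial>count_space (verts M)"
  have pull: "(\<Sum>x\<in>F\<^sub>0. ennreal (1 / stab0 x) * (?\<kappa> * J x)) = ?\<kappa> * (\<Sum>x\<in>F\<^sub>0. ennreal (1 / stab0 x) * J x)" for J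
    unfolding sum_distrib_left by (rule sum.cong[OF refl]) (simp only: ac_simps)
  have T: "(\<integral>\<^sup>+ C. ?L True C \<partial>\<mu>G) =
      ennreal (1 / w0) * (?\<kappa> * (\<Sum>x\<in>F\<^sub>0. ennreal (1 / stab0 x) * (\<integral>\<^sup>+ z. \<Phi> x z \<partial>count_space UNIV)))"
    unfolding nn_integral_\<mu>G pull[symmetric]
    by (intro arg_cong2[where f = "(*)"] refl sum.cong) (simp add: nn_integral_ind_at[of _ ?F] F0_verts gT)
  have F: "(\<integral>\<^sup>+ C. ?L False C \<partial>\<mu>G) =
      ennreal (1 / w0) * (?\<kappa> * (\<Sum>x\<in>F\<^sub>0. ennreal (1 / stab0 x) * (\<integral>\<^sup>+ z. \<Phi> z x \<partial>count_space UNIV)))"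
    unfolding nn_integral_\<mu>G pull[symmetric]
    by (intro arg_cong2[where f = "(*)"] refl sum.cong) (simp add: nn_integral_ind_at[of _ ?F] F0_verts gF)
  have "(\<integral>\<^sup>+ C. ?L True C \<partial>\<mu>G) = (\<integral>\<^sup>+ C. ?L False C \<partial>\<mu>G)" unfolding T F transport ..
  thus "(\<integral>\<^sup>+ C. (case representative C of (K, \<phi>, Rs) \<Rightarrow>
            \<integral>\<^sup>+ x. ennreal (f (iso_class GG K \<phi> (Rs @ [orbit GG \<phi> x]))) \<partial>count_space (verts K)) \<partial>\<mu>G) =
        (\<integral>\<^sup>+ C. (case representative C of (K, \<phi>, Rs) \<Rightarrow>
            \<integral>\<^sup>+ x. ennreal (f (iso_class GG K \<phi> (orbit GG \<phi> x # Rs))) \<partial>count_space (verts K)) \<partial>\<mu>G)"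
    unfolding adjoin_def if_True if_False .
qed

lemma random_rooted_complex_\<mu>G: "random_rooted_complex GG D \<mu>G"
  unfolding random_rooted_complex_def
  using prob_space_\<mu>G unimodular_\<mu>G unfolding \<mu>G_eq by simp

section \<open>Weak convergence\<close>

text \<open>Continuity gives a radius for each class, but by invariance under
  \<open>\<Gamma>\<^sub>0\<close> every \<open>ind_at x\<close> already occurs for some vertex of
  the finite set \<open>F\<^sub>0\<close>. The largest of these radii serves for all.\<close>

lemma uniform_modulus:
  fixes f :: "'g model set \<Rightarrow> real"
  assumes f: "continuous_map (SC_topology GG D 1) euclideanreal f" and e: "e > 0"
  shows "\<exists>r::nat. r > 0 \<and> (\<forall>x\<in>verts K. \<forall>C\<in>SC GG D 1.
    SC_dist GG (ind_at x) C \<le> ennreal (2 powr - real r) \<longrightarrow> \<bar>f C - f (ind_at x)\<bar> < e)"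
proof -
  have "\<exists>r::nat. \<forall>C\<in>SC GG D 1. SC_dist GG (ind_at x) C \<le> ennreal (2 powr - real r) \<longrightarrow> \<bar>f C - f (ind_at x)\<bar> < e"
    if x: "x \<in> verts K" for x
  proof -
    let ?U = "{C \<in> topspace (SC_topology GG D 1). f C \<in> {f (ind_at x) - e <..< f (ind_at x) + e}}"
    have "openin (SC_topology GG D 1) ?U"
      by (rule openin_continuous_map_preimage[OF f]) simp
    moreover have "ind_at x \<in> ?U" using ind_at_SC[OF x] e by simp
    ultimately obtain d where d: "d > 0" "\<And>C. C \<in> SC GG D 1 \<Longrightarrow> SC_dist GG (ind_at x) C < d \<Longrightarrow> C \<in> ?U"
      unfolding SC_topology_def openin_emetric_topology by blast
    have "((\<lambda>r. ennreal (2 powr - real r)) \<longlongrightarrow> ennreal 0) sequentially"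
      by (intro tendsto_ennrealI) real_asymp
    hence "eventually (\<lambda>r. ennreal (2 powr - real r) < d) sequentially"
      using d(1) by (intro order_tendstoD(2)) simp_all
    then obtain r where r: "ennreal (2 powr - real r) < d" unfolding eventually_sequentially by blast
    have "\<bar>f C - f (ind_at x)\<bar> < e" if "C \<in> SC GG D 1" "SC_dist GG (ind_at x) C \<le> ennreal (2 powr - real r)" for C
      using d(2)[OF that(1) le_less_trans[OF that(2) r]] by auto
    thus ?thesis by blast
  qed
  then obtain r where r: "\<And>x C. x \<in> verts K \<Longrightarrow> C \<in> SC GG D 1 \<Longrightarrow>
      SC_dist GG (ind_at x) C \<le> ennreal (2 powr - real (r x)) \<Longrightarrow> \<bar>f C - f (ind_at x)\<bar> < e" by metis
  \<comment> \<open>The entry 1 keeps the radius positive, as \<open>SC_dist_le\<close>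
    requires.\<close>
  define m where "m = Max (insert 1 (r ` F\<^sub>0))"
  have m: "m \<ge> 1" "\<And>x. x \<in> F\<^sub>0 \<Longrightarrow> r x \<le> m"
    unfolding m_def by (rule Max_ge; use F0'(1) in simp)+
  have "\<bar>f C - f (ind_at x)\<bar> < e"
    if x: "x \<in> verts K" and C: "C \<in> SC GG D 1" "SC_dist GG (ind_at x) C \<le> ennreal (2 powr - real m)" for x C
  proof -
    obtain y where y: "y \<in> F\<^sub>0" "x \<in> orbit G0 \<phi> y"
      by (rule fundamental_domainE[OF F0 simplicial_action_subgroup[OF act sub0(1)] x]) blast
    then obtain t where t: "t \<in> \<Gamma>\<^sub>0" "x = \<phi> t y" unfolding orbit_def by auto
    have eq: "ind_at x = ind_at y" unfolding t(2) by (rule ind_at_invariant[OF t(1) F0_verts[OF y(1)]])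
    have "ennreal (2 powr - real m) \<le> ennreal (2 powr - real (r y))"
      using m(2)[OF y(1)] by (intro ennreal_leI powr_mono) simp_all
    thus ?thesis unfolding eq by (intro r[OF F0_verts[OF y(1)] C(1)] order_trans[OF C(2)[unfolded eq]])
  qed
  thus ?thesis using m(1) by (intro exI[of _ m]) simp
qed

section \<open>The quotients by the chain and their convergence\<close>

context
  fixes N :: "nat \<Rightarrow> 'g set"
  assumes N: "\<And>n. N n \<lhd> \<Gamma>" "\<And>n. finite (rcosets (N n))" "\<And>n. N (Suc n) \<subseteq> N n" "(\<Inter>n. N n) = {\<one>}"
begin

abbreviation "NN n \<equiv> \<Gamma>\<lparr>carrier := N n\<rparr>"
abbreviation "QQ n \<equiv> quotient_complex \<Gamma> K \<phi> (N n)"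
abbreviation "qa n \<equiv> quotient_action \<Gamma> K \<phi> (N n)"
abbreviation "class_Q n \<equiv> class_at GG (QQ n) (qa n)"
abbreviation "\<mu>Q n \<equiv> finite_complex_measure GG D (QQ n) (qa n)"

lemma normal_quotient: "normal_quotient (N n) \<Gamma> K \<phi>"
  unfolding normal_quotient_def normal_quotient_axioms_def using N(1) act by blast

lemma N_sub: "subgroup (N n) \<Gamma>"
  by (rule normal_imp_subgroup[OF N(1)])

lemma act_N: "simplicial_action (NN n) K \<phi>"
  by (rule simplicial_action_subgroup[OF act N_sub])

lemmas verts_QQ = normal_quotient.verts_Q[OF normal_quotient]

lemma act_Q: "simplicial_action GG (QQ n) (qa n)"
  by (rule simplicial_action_subgroup[OF normal_quotient.simplicial_action_Q[OF normal_quotient] G_sub])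

lemma deg_Q: "vertex_degree (QQ n) \<le> ennreal D"
  by (rule order_trans[OF normal_quotient.Q_vertex_degree[OF normal_quotient] deg])

lemma class_Q_SC: "X \<in> verts (QQ n) \<Longrightarrow> class_Q n X \<in> SC GG D 1"
  by (rule class_at_in_SC[OF act_Q deg_Q _ fin_GG])

text \<open>Vertices of the quotient are orbits, and a fundamental domain has one point in each.
  This turns a sum over the quotient into one to which \<open>orbit_average\<close> applies.\<close>

lemma bij_betw_fundamental_domain:
  assumes F: "fundamental_domain (NN n) (verts K) \<phi> F"
  shows "bij_betw (orbit (NN n) \<phi>) F (verts (QQ n))"
  unfolding bij_betw_def verts_QQ
proof
  have FK: "F \<subseteq> verts K" using F unfolding fundamental_domain_def by blast
  show "inj_on (orbit (NN n) \<phi>) F"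
  proof (rule inj_onI)
    fix x y assume xy: "x \<in> F" "y \<in> F" "orbit (NN n) \<phi> x = orbit (NN n) \<phi> y"
    have y: "y \<in> verts K" using xy(2) FK by blast
    have yy: "y \<in> orbit (NN n) \<phi> y" by (rule orbit_self[OF act_N y])
    obtain z where "\<And>v. v \<in> F \<Longrightarrow> y \<in> orbit (NN n) \<phi> v \<Longrightarrow> v = z"
      by (rule fundamental_domainE[OF F act_N y]) blast
    thus "x = y" using xy yy by metis
  qed
  show "orbit (NN n) \<phi> ` F = orbit (NN n) \<phi> ` verts K"
  proof
    show "orbit (NN n) \<phi> ` F \<subseteq> orbit (NN n) \<phi> ` verts K" by (rule image_mono[OF FK])
    show "orbit (NN n) \<phi> ` verts K \<subseteq> orbit (NN n) \<phi> ` F"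
    proof (rule image_subsetI)
      fix v assume v: "v \<in> verts K"
      obtain x where x: "x \<in> F" "v \<in> orbit (NN n) \<phi> x" by (rule fundamental_domainE[OF F act_N v]) blast
      have xK: "x \<in> verts K" using x(1) FK by blast
      obtain t where t: "t \<in> carrier (NN n)" "v = \<phi> t x" using x(2) unfolding orbit_def by blast
      have "orbit (NN n) \<phi> v = orbit (NN n) \<phi> x" unfolding t(2) by (rule orbit_translate[OF act_N xK t(1)])
      thus "orbit (NN n) \<phi> v \<in> orbit (NN n) \<phi> ` F" using x(1) by blast
    qed
  qed
qed

lemma finite_verts_QQ: "finite (verts (QQ n))" "verts (QQ n) \<noteq> {}"
proof -
  obtain F where F: "fundamental_domain (NN n) (verts K) \<phi> F" by (rule fundamental_domain_exists[OF act_N])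
  note F' = fundamental_domain_subgroup[OF N_sub N(2) F]
  have img: "orbit (NN n) \<phi> ` F = verts (QQ n)"
    by (rule bij_betw_imp_surj_on[OF bij_betw_fundamental_domain[OF F]])
  show "finite (verts (QQ n))" "verts (QQ n) \<noteq> {}" unfolding img[symmetric] using F'(1,3) by simp_all
qed

lemma class_Q_measurable: "class_Q n \<in> measurable (uniform_count_measure (verts (QQ n))) (SC_borel GG D 1)"
  unfolding uniform_count_measure_def measurable_point_measure_eq1 using class_Q_SC by simp

lemma prob_space_\<mu>Q: "prob_space (\<mu>Q n)" "sets (\<mu>Q n) = sets (SC_borel GG D 1)"
  unfolding finite_complex_measure_def
  by (rule prob_space.prob_space_distr[OF prob_space_uniform_count_measure[OF finite_verts_QQ] class_Q_measurable]) simp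

lemma integral_\<mu>Q:
  fixes f :: "'g model set \<Rightarrow> real"
  assumes "f \<in> borel_measurable (SC_borel GG D 1)"
  shows "(\<integral>C. f C \<partial>\<mu>Q n) = (\<Sum>X\<in>verts (QQ n). f (class_Q n X)) / real (card (verts (QQ n)))"
  unfolding finite_complex_measure_def integral_distr[OF class_Q_measurable assms]
  by (rule integral_uniform_count_measure[OF finite_verts_QQ(1)])

text \<open>Every vertex stabilizer is conjugate to one of the finitely many finite stabilizers over
  \<open>I\<close>, and a normal subgroup that avoids those avoids all of their conjugates.\<close>

lemma eventually_free: "\<exists>n0. \<forall>n\<ge>n0. \<forall>x\<in>verts K. stabilizer (NN n) \<phi> x = {\<one>}"
proof -
  obtain I where I: "fundamental_domain \<Gamma> (verts K) \<phi> I" "finite I" "I \<subseteq> verts K" "I \<noteq> {}" by (rule orbit_representatives)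
  have "finite (\<Union>i\<in>I. stabilizer \<Gamma> \<phi> i)" using I(2,3) fin_stab by blast
  then obtain n0 where n0: "\<And>n. n \<ge> n0 \<Longrightarrow> N n \<inter> (\<Union>i\<in>I. stabilizer \<Gamma> \<phi> i) \<subseteq> {\<one>}"
    using residual_chain_avoids[OF N(3,4)] by blast
  have "stabilizer (NN n) \<phi> x = {\<one>}" if n: "n \<ge> n0" and x: "x \<in> verts K" for n x
  proof
    interpret normal "N n" \<Gamma> by (rule N(1))
    show "{\<one>} \<subseteq> stabilizer (NN n) \<phi> x"
      unfolding stabilizer_def using actD(3)[OF x] by simp
    show "stabilizer (NN n) \<phi> x \<subseteq> {\<one>}"
    proof
      fix m assume "m \<in> stabilizer (NN n) \<phi> x"
      hence m: "m \<in> N n" "\<phi> m x = x" unfolding stabilizer_def by simp_all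
      have mc: "m \<in> carrier \<Gamma>" using m(1) by simp
      obtain i where i: "i \<in> I" "x \<in> orbit \<Gamma> \<phi> i" by (rule fundamental_domainE[OF I(1) act x]) blast
      have iK: "i \<in> verts K" using i(1) I(3) by blast
      obtain t where t: "t \<in> carrier \<Gamma>" "x = \<phi> t i" using i(2) unfolding orbit_def by blast
      have "\<phi> (inv t \<otimes> m \<otimes> t) i = \<phi> (inv t) (\<phi> m (\<phi> t i))"
        using actD(4)[of "inv t \<otimes> m" t i] actD(4)[of "inv t" m "\<phi> t i"] t(1) mc iK actD(5)[OF t(1) iK] by simp
      also have "\<dots> = i" using m(2) t(2) actD(7)[OF t(1) iK] by simp
      finally have "inv t \<otimes> m \<otimes> t \<in> stabilizer \<Gamma> \<phi> i" unfolding stabilizer_def using t(1) mc by simp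
      moreover have "inv t \<otimes> m \<otimes> t \<in> N n" by (rule inv_op_closed1[OF t(1) m(1)])
      ultimately have "inv t \<otimes> m \<otimes> t = \<one>" using n0[OF n] i(1) by blast
      hence "t \<otimes> (inv t \<otimes> m \<otimes> t) \<otimes> inv t = \<one>" using t(1) by simp
      moreover have "t \<otimes> (inv t \<otimes> m \<otimes> t) \<otimes> inv t = m" using t(1) mc by (simp add: m_assoc cancel_inv)
      ultimately show "m \<in> {\<one>}" by simp
    qed
  qed
  thus ?thesis by blast
qed

text \<open>Trivial stabilizers make all weights equal to 1, so the uniform average over the
  quotient is an instance of \<open>orbit_average\<close>.\<close>

lemma integral_\<mu>Q_average:
  fixes f :: "'g model set \<Rightarrow> real"
  assumes f: "f \<in> borel_measurable (SC_borel GG D 1)"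
    and free: "\<And>x. x \<in> verts K \<Longrightarrow> stabilizer (NN n) \<phi> x = {\<one>}"
    and I: "fundamental_domain \<Gamma> (verts K) \<phi> I" "finite I"
  shows "(\<integral>C. f C \<partial>\<mu>Q n) =
    (\<Sum>i\<in>I. coset_mean \<Gamma> (N n) (\<lambda>t. f (class_Q n (orbit (NN n) \<phi> (\<phi> t i)))) / real (card (stabilizer \<Gamma> \<phi> i))) /
      (\<Sum>i\<in>I. 1 / real (card (stabilizer \<Gamma> \<phi> i)))"
proof -
  obtain F where F: "fundamental_domain (NN n) (verts K) \<phi> F" by (rule fundamental_domain_exists[OF act_N])
  have FK: "F \<subseteq> verts K" using F unfolding fundamental_domain_def by blast
  note bij = bij_betw_fundamental_domain[OF F]
  let ?h = "\<lambda>x. f (class_Q n (orbit (NN n) \<phi> x))"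
  have one: "real (card (stabilizer (NN n) \<phi> x)) = 1" if "x \<in> F" for x
    using free[of x] that FK by auto
  have "(\<integral>C. f C \<partial>\<mu>Q n) = (\<Sum>x\<in>F. ?h x) / real (card F)"
    unfolding integral_\<mu>Q[OF f] bij_betw_same_card[OF bij]
    using sum.reindex_bij_betw[OF bij, of "\<lambda>X. f (class_Q n X)"] by simp
  also have "\<dots> = (\<Sum>x\<in>F. ?h x / real (card (stabilizer (NN n) \<phi> x))) / (\<Sum>x\<in>F. 1 / real (card (stabilizer (NN n) \<phi> x)))"
    using one by simp
  also have "\<dots> = (\<Sum>i\<in>I. coset_mean \<Gamma> (N n) (\<lambda>t. ?h (\<phi> t i)) / real (card (stabilizer \<Gamma> \<phi> i))) /
      (\<Sum>i\<in>I. 1 / real (card (stabilizer \<Gamma> \<phi> i)))"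
  proof (rule orbit_average[OF act N_sub N(2) fin_stab I F])
    fix m x assume "m \<in> N n" "x \<in> verts K"
    hence "orbit (NN n) \<phi> (\<phi> m x) = orbit (NN n) \<phi> x" using orbit_translate[OF act_N, of x m n] by simp
    thus "?h (\<phi> m x) = ?h x" by simp
  qed
  finally show ?thesis .
qed

text \<open>The isomorphism of balls refers to the whole quotient; balls about the root do not
  change when only the components meeting the root are kept.\<close>

lemma SC_dist_ind_at_class_Q:
  assumes x: "x \<in> verts K" and r: "r > 0" and sep: "separated \<Gamma> K \<phi> G H (N n) (2 * r + 1) x"
  shows "SC_dist GG (ind_at x) (class_Q n (orbit (NN n) \<phi> x)) \<le> ennreal (2 powr - real r)"
proof -
  have X: "orbit (NN n) \<phi> x \<in> verts (QQ n)" unfolding verts_QQ using x by blast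
  let ?S = "orbit GG (qa n) (orbit (NN n) \<phi> x)"
  note OQ = orbit_rooted_components(1)[OF act_Q deg_Q X]
  note c = countable_verts[OF OQ _ fin_GG]
  have "rooted_iso GG
      (ball_complex (real r) (ind_comp x) (G_root x)) (ind_comp_action x) [G_root x]
      (ball_complex (real r) (QQ n) ?S) (qa n) [?S]"
    using normal_quotient.ball_isomorphism_Q[OF normal_quotient G_sub H_sub H_G x deg sep]
    unfolding H_comp_def .
  hence "rooted_iso GG
      (ball_complex (real r) (ind_comp x) (\<Union>(set [G_root x]))) (ind_comp_action x) [G_root x]
      (ball_complex (real r) (components_meeting (QQ n) ?S) (\<Union>(set [?S]))) (qa n) [?S]"
    by (simp add: ball_complex_components)
  thus ?thesis
    unfolding ind_at_eq[OF x] class_at_def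
    by (rule SC_dist_le[OF ind_comp[OF x] OQ c, rotated 2]) (use r in simp_all)
qed

text \<open>Where \<open>\<phi> t i\<close> is separated, the two functions differ by less than
  \<open>e / 2\<close>; elsewhere they differ by at most \<open>2 * B\<close>, but the proportion of
  such cosets tends to zero.\<close>

lemma coset_mean_tendsto:
  fixes f :: "'g model set \<Rightarrow> real"
  assumes f: "continuous_map (SC_topology GG D 1) euclideanreal f" "bounded (f ` SC GG D 1)"
    and i: "i \<in> verts K"
  shows "(\<lambda>n. coset_mean \<Gamma> (N n) (\<lambda>t. f (class_Q n (orbit (NN n) \<phi> (\<phi> t i)))))
    \<longlonglongrightarrow> coset_mean \<Gamma> \<Gamma>\<^sub>0 (\<lambda>t. f (ind_at (\<phi> t i)))"
proof (rule LIMSEQ_I)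
  fix e :: real assume e: "e > 0"
  obtain B where B: "B > 0" "\<And>C. C \<in> SC GG D 1 \<Longrightarrow> \<bar>f C\<bar> \<le> B"
    using f(2) unfolding bounded_pos by auto
  obtain r :: nat where r: "r > 0" and modulus: "\<And>x C. x \<in> verts K \<Longrightarrow> C \<in> SC GG D 1 \<Longrightarrow>
      SC_dist GG (ind_at x) C \<le> ennreal (2 powr - real r) \<Longrightarrow> \<bar>f C - f (ind_at x)\<bar> < e / 2"
    using uniform_modulus[OF f(1), of "e / 2"] e by auto
  define S where "S = {s \<in> carrier \<Gamma>. \<exists>j\<le>2 * r + 1. (i, \<phi> s i) \<in> adj K ^^ j}"
  have finS: "finite S" unfolding S_def by (rule finite_displacements[OF act deg i fin_stab[OF i]])
  \<comment> \<open>The set whose avoidance forces the congruences for elements of \<open>H\<close>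
    to be equalities. It does not depend on \<open>t\<close>, so one stage of the chain works for
    all cosets.\<close>
  define E where "E = (\<lambda>(s, c). s \<otimes> inv c) ` (S \<times> (\<Union>h\<in>H. {t \<otimes> h \<otimes> inv t | t. t \<in> carrier \<Gamma>}))"
  have "finite H" using finite_subset[OF H_G fin_G] .
  hence "finite (\<Union>h\<in>H. {t \<otimes> h \<otimes> inv t | t. t \<in> carrier \<Gamma>})"
    by (rule finite_UN_I) (simp add: H_def)
  hence "finite E" unfolding E_def using finS by simp
  then obtain n1 where n1: "\<And>n. n \<ge> n1 \<Longrightarrow> N n \<inter> E \<subseteq> {\<one>}"
    using residual_chain_avoids[OF N(3,4)] by blast
  have GH: "finite (G - H)" "G - H \<subseteq> carrier \<Gamma>" using fin_G subgroup.subset[OF G_sub] by auto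
  have inf: "infinite {t \<otimes> g \<otimes> inv t | t. t \<in> carrier \<Gamma>}" if "g \<in> G - H" for g
    using that unfolding H_def by blast
  \<comment> \<open>Chosen so that the exceptional cosets, weighted by \<open>2 * B\<close>,
    contribute less than \<open>e / 2\<close>.\<close>
  have "e / 2 / (2 * B) > 0" using e B(1) by simp
  then obtain n2 where n2: "\<And>n. n \<ge> n2 \<Longrightarrow>
      coset_mean \<Gamma> (N n) (\<lambda>t. of_bool (conjugates_into (N n) (G - H) S t)) < e / 2 / (2 * B)"
    using conjugates_into_rare[OF N(1,2,3,4) GH inf finS] by blast
  have "\<bar>coset_mean \<Gamma> (N n) (\<lambda>t. f (class_Q n (orbit (NN n) \<phi> (\<phi> t i)))) -
      coset_mean \<Gamma> \<Gamma>\<^sub>0 (\<lambda>t. f (ind_at (\<phi> t i)))\<bar> < e" if n: "n \<ge> max n1 n2" for n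
  proof -
    let ?u = "\<lambda>t. f (class_Q n (orbit (NN n) \<phi> (\<phi> t i)))" and ?v = "\<lambda>t. f (ind_at (\<phi> t i))"
    let ?P = "conjugates_into (N n) (G - H) S"
    let ?m = "coset_mean \<Gamma> (N n) (\<lambda>t. of_bool (?P t))"
    have "\<bar>coset_mean \<Gamma> (N n) ?u - coset_mean \<Gamma> \<Gamma>\<^sub>0 ?v\<bar> \<le> e / 2 + (2 * B) * ?m"
    proof (rule coset_mean_diff_le[OF N_sub N(2) sub0])
      show "left_invariant \<Gamma> (N n) ?u"
        unfolding left_invariant_def
      proof (intro ballI)
        fix m t assume m: "m \<in> N n" and t: "t \<in> carrier \<Gamma>"
        have mc: "m \<in> carrier \<Gamma>" by (rule subgroup.mem_carrier[OF N_sub m])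
        have "orbit (NN n) \<phi> (\<phi> (m \<otimes> t) i) = orbit (NN n) \<phi> (\<phi> t i)"
          unfolding actD(4)[OF mc t i] by (rule orbit_translate[OF act_N actD(5)[OF t i]]) (use m in simp)
        thus "?u (m \<otimes> t) = ?u t" by simp
      qed
      show "left_invariant \<Gamma> \<Gamma>\<^sub>0 ?v"
        unfolding left_invariant_def
      proof (intro ballI)
        fix m t assume m: "m \<in> \<Gamma>\<^sub>0" and t: "t \<in> carrier \<Gamma>"
        have mc: "m \<in> carrier \<Gamma>" by (rule subgroup.mem_carrier[OF sub0(1) m])
        show "?v (m \<otimes> t) = ?v t"
          unfolding actD(4)[OF mc t i] ind_at_invariant[OF m actD(5)[OF t i]] ..
      qed
      show "left_invariant \<Gamma> (N n) ?P" by (rule conjugates_into_invariant[OF N(1) GH(2)])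
      fix t assume t: "t \<in> carrier \<Gamma>"
      have x: "\<phi> t i \<in> verts K" by (rule actD(5)[OF t i])
      have Q: "orbit (NN n) \<phi> (\<phi> t i) \<in> verts (QQ n)" unfolding verts_QQ using x by blast
      note C = class_Q_SC[OF Q]
      show "\<bar>?u t - ?v t\<bar> \<le> e / 2 + 2 * B * of_bool (?P t)"
      proof (cases "?P t")
        case True
        have "\<bar>?u t - ?v t\<bar> \<le> B + B" using B(2)[OF C] B(2)[OF ind_at_SC[OF x]] by linarith
        thus ?thesis using True e by simp
      next
        case False
        have "N n \<inter> E \<subseteq> {\<one>}" using n1 n by simp
        hence "separated \<Gamma> K \<phi> G H (N n) (2 * r + 1) (\<phi> t i)"
          using separated_if_not_conjugates_into[OF act i N(1) subgroup.subset[OF G_sub] t, of n "2 * r + 1" H] False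
          unfolding E_def S_def by blast
        from modulus[OF x C SC_dist_ind_at_class_Q[OF x r this]] show ?thesis using False by simp
      qed
    qed
    moreover have "(2 * B) * ?m < e / 2"
    proof -
      have lt: "?m < e / 2 / (2 * B)" by (rule n2) (use n in simp)
      have "0 < 2 * B" using B(1) by simp
      from lt[unfolded pos_less_divide_eq[OF this]] show ?thesis by (simp only: mult.commute)
    qed
    ultimately show ?thesis by linarith
  qed
  thus "\<exists>n0. \<forall>n\<ge>n0. norm (coset_mean \<Gamma> (N n) (\<lambda>t. f (class_Q n (orbit (NN n) \<phi> (\<phi> t i)))) -
      coset_mean \<Gamma> \<Gamma>\<^sub>0 (\<lambda>t. f (ind_at (\<phi> t i)))) < e"
    unfolding real_norm_def by blast
qed

text \<open>Both integrals are averages over \<open>I\<close> of coset means with the same weights,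
  so convergence can be checked at each \<open>i\<close>. The formula for the quotients holds from
  some stage on, which is enough for a limit.\<close>

lemma converges_weakly_\<mu>Q: "converges_weakly (SC_topology GG D 1) \<mu>Q \<mu>G"
  unfolding converges_weakly_def
proof (intro conjI allI impI)
  show "prob_space (\<mu>Q n)" "sets (\<mu>Q n) = sets (SC_borel GG D 1)" for n by (rule prob_space_\<mu>Q)+
  show "prob_space \<mu>G" by (rule prob_space_\<mu>G)
  show "sets \<mu>G = sets (SC_borel GG D 1)" unfolding \<mu>G_eq by simp
  fix f :: "'g model set \<Rightarrow> real"
  assume f: "continuous_map (SC_topology GG D 1) euclideanreal f \<and> bounded (f ` topspace (SC_topology GG D 1))"
  hence fc: "continuous_map (SC_topology GG D 1) euclideanreal f" and fb: "bounded (f ` SC GG D 1)" by simp_all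
  note fm = continuous_borel_measurable[OF fc]
  obtain I where I: "fundamental_domain \<Gamma> (verts K) \<phi> I" "finite I" "I \<subseteq> verts K" "I \<noteq> {}" by (rule orbit_representatives)
  let ?s = "\<lambda>i. real (card (stabilizer \<Gamma> \<phi> i))"
  let ?W = "\<Sum>i\<in>I. 1 / ?s i"
  let ?a = "\<lambda>n. (\<Sum>i\<in>I. coset_mean \<Gamma> (N n) (\<lambda>t. f (class_Q n (orbit (NN n) \<phi> (\<phi> t i)))) / ?s i) / ?W"
  have limit: "(\<integral>C. f C \<partial>\<mu>G) = (\<Sum>i\<in>I. coset_mean \<Gamma> \<Gamma>\<^sub>0 (\<lambda>t. f (ind_at (\<phi> t i))) / ?s i) / ?W"
    unfolding integral_\<mu>G[OF fm] orbit_weight_def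
    by (rule orbit_average[OF act sub0 fin_stab I(1,2) F0]) (simp_all add: ind_at_invariant)
  have "?a \<longlonglongrightarrow> (\<integral>C. f C \<partial>\<mu>G)"
    unfolding limit divide_inverse using I(3)
    by (intro tendsto_mult tendsto_const tendsto_sum coset_mean_tendsto[OF fc fb]) blast
  moreover obtain n0 where n0: "\<And>n x. n \<ge> n0 \<Longrightarrow> x \<in> verts K \<Longrightarrow> stabilizer (NN n) \<phi> x = {\<one>}"
    using eventually_free by blast
  have "eventually (\<lambda>n. ?a n = (\<integral>C. f C \<partial>\<mu>Q n)) sequentially"
    unfolding eventually_sequentially
  proof (intro exI[of _ n0] allI impI)
    fix n assume "n0 \<le> n"
    show "?a n = (\<integral>C. f C \<partial>\<mu>Q n)"
      by (rule integral_\<mu>Q_average[OF fm n0[OF \<open>n0 \<le> n\<close>] I(1,2), symmetric])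
  qed
  ultimately show "(\<lambda>n. \<integral>C. f C \<partial>\<mu>Q n) \<longlonglongrightarrow> (\<integral>C. f C \<partial>\<mu>G)"
    by (rule Lim_transform_eventually)
qed

end

end

end

theorem proposition3p6:
  fixes \<Gamma> :: "('g, 'b) monoid_scheme"
    and K :: "'v set set" and \<phi> :: "'g \<Rightarrow> 'v \<Rightarrow> 'v" and D :: real
    and G H \<Gamma>\<^sub>0 :: "'g set" and N :: "nat \<Rightarrow> 'g set" and F\<^sub>0 :: "'v set"
  assumes "D > 0" and "simplicial_complex K" and "vertex_degree K \<le> ennreal D"
    and "group \<Gamma>" and "acts_simplicially \<Gamma> K \<phi>"
    and "acts_properly \<Gamma> K \<phi>" and "acts_cocompactly \<Gamma> K \<phi>"
    and "subgroup G \<Gamma>" and "finite G"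
    and "H = {g \<in> G. finite {\<gamma> \<otimes>\<^bsub>\<Gamma>\<^esub> g \<otimes>\<^bsub>\<Gamma>\<^esub> inv\<^bsub>\<Gamma>\<^esub> \<gamma> | \<gamma>. \<gamma> \<in> carrier \<Gamma>}}"
    and "\<And>n. N n \<lhd> \<Gamma>" and "\<And>n. finite_index (N n) \<Gamma>" and "\<And>n. N (Suc n) \<subseteq> N n"
    and "(\<Inter>n. N n) = {\<one>\<^bsub>\<Gamma>\<^esub>}"
    and "subgroup \<Gamma>\<^sub>0 \<Gamma>" and "finite_index \<Gamma>\<^sub>0 \<Gamma>" and "\<Gamma>\<^sub>0 \<subseteq> (\<Inter>h\<in>H. centralizer \<Gamma> h)"
    and "fundamental_domain (\<Gamma>\<lparr>carrier := \<Gamma>\<^sub>0\<rparr>) (verts K) \<phi> F\<^sub>0"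
  shows "let \<mu>H = cocompact_complex_measure (\<Gamma>\<lparr>carrier := H\<rparr>) D K \<phi> (\<Gamma>\<lparr>carrier := \<Gamma>\<^sub>0\<rparr>) F\<^sub>0;
             \<mu>G = ind_measure (\<Gamma>\<lparr>carrier := G\<rparr>) H D \<mu>H
         in random_rooted_complex (\<Gamma>\<lparr>carrier := G\<rparr>) D \<mu>G \<and>
            converges_weakly (SC_topology (\<Gamma>\<lparr>carrier := G\<rparr>) D 1)
              (\<lambda>n. finite_complex_measure (\<Gamma>\<lparr>carrier := G\<rparr>) D
                     (quotient_complex \<Gamma> K \<phi> (N n)) (quotient_action \<Gamma> K \<phi> (N n)))
              \<mu>G"
proof -
  interpret group \<Gamma> by fact
  have act: "simplicial_action \<Gamma> K \<phi>"
    by (rule g_complex_imp_action) (use assms(5) in \<open>simp add: acts_simplicially_def\<close>)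
  interpret proper_cocompact_action \<Gamma> K \<phi> D G H
  proof (intro proper_cocompact_action.intro proper_cocompact_action_axioms.intro)
    show "finite (stabilizer \<Gamma> \<phi> v)" if "v \<in> verts K" for v
      using assms(6) that unfolding acts_properly_def by blast
    show "finite (orbits \<Gamma> (verts K) \<phi>)" using assms(7) unfolding acts_cocompactly_def .
  qed (fact act assms(3,4,8,9,10))+
  have comm: "t \<otimes>\<^bsub>\<Gamma>\<^esub> h = h \<otimes>\<^bsub>\<Gamma>\<^esub> t" if "t \<in> \<Gamma>\<^sub>0" "h \<in> H" for t h
    using assms(17) that unfolding centralizer_def by blast
  have fin: "finite (rcosets\<^bsub>\<Gamma>\<^esub> \<Gamma>\<^sub>0)" "finite (rcosets\<^bsub>\<Gamma>\<^esub> (N n))" for n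
    using assms(12,16) unfolding finite_index_def by blast+
  show ?thesis
    unfolding Let_def
    using random_rooted_complex_\<mu>G[OF assms(15) fin(1) comm assms(18)]
      converges_weakly_\<mu>Q[OF assms(15) fin(1) comm assms(18) assms(11) fin(2) assms(13,14)] by blast
qed

end
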